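(* Let $\Omega$ be a bounded domain of the Heisenberg group $\mathbb{H}^1$ with smooth boundary such that both $\Omega$ and $\mathbb{H}^1\setminus\overline{\Omega}$ satisfy the uniform exterior ball property. Then $$\lambda_1(\Omega)\le C_\Omega\,\frac{l_{11}^2}{\max_{\xi\in\Omega}r_\Omega^2(\xi)},\qquad C_\Omega=\min_{\xi\in A_\Omega}C_\Omega(\xi),$$ where $l_{11}$ is the first strictly positive zero of the Bessel function $J_1$ of the first kind and order $1$, $r_\Omega(\xi)$ is the harmonic radius of $\Omega$ at $\xi$, $A_\Omega\subset\Omega$ is the set of harmonic centers of $\Omega$ (the points of $\Omega$ at which $r_\Omega$ attains its maximum), and $$C_\Omega(\xi)=16\sqrt2\,\alpha_\Omega^6(\xi)\,C^2,\qquad C=\left(\frac{3}{2\pi}\right)^{1/4},\qquad \alpha_\Omega(\xi)=\frac{\sup_{\eta\in\partial\Omega}d_{\mathbb{H}^1}(\xi,\eta)}{\inf_{\eta\in\partial\Omega}d_{\mathbb{H}^1}(\xi,\eta)}.$$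
   Context: $\mathbb{H}^1$ is $\mathbb{R}^3$ with coordinates $(x,y,t)$ and group law $(x,y,t)\circ(x_0,y_0,t_0)=(x+x_0,\,y+y_0,\,t+t_0+2(x_0y-xy_0))$. Let $\rho(x,y,t)=((x^2+y^2)^2+t^2)^{1/4}$, $d_{\mathbb{H}^1}(\xi,\eta)=\rho(\xi^{-1}\circ\eta)$, and let $B(\xi,r)=\{\eta: d_{\mathbb{H}^1}(\xi,\eta)<r\}$ (Koranyi ball). Put $X=\partial_x+2y\partial_t$, $Y=\partial_y-2x\partial_t$, $\nabla_{\mathbb{H}^1}u=(Xu)X+(Yu)Y$, $|\nabla_{\mathbb{H}^1}u|^2=(Xu)^2+(Yu)^2$, and $\Delta_{\mathbb{H}^1}=X^2+Y^2$. The volume $dv$ is Lebesgue measure on $\mathbb{R}^3$. Uniform exterior ball property of an open set $D\subset\mathbb{H}^1$: there is $r_0>0$ such that for all $\xi\in\partial D$ and all $r\in\,]0,r_0]$ there is $\eta\in\mathbb{H}^1$ with $B(\eta,r)\cap D=\emptyset$ and $\xi\in\partial B(\eta,r)$. If a bounded domain with smooth boundary and the complement of its closure satisfy this property, then the domain is regular: for every $\varphi\in C(\partial\Omega)$ the problem $\Delta_{\mathbb{H}^1}u=0$ in $\Omega$, $u=\varphi$ on $\partial\Omega$ has a solution $u\in C^2(\Omega)\cap C(\overline\Omega)$. Harmonic radius: let $\Gamma_\xi(\eta)=\frac{1}{8\pi\rho^2(\xi^{-1}\circ\eta)}$ and let $H_\xi\in C^2(\Omega)\cap C(\overline\Omega)$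 be the solution of $\Delta_{\mathbb{H}^1}H_\xi=0$ in $\Omega$, $H_\xi=\Gamma_\xi$ on $\partial\Omega$. Then $r_\Omega(\xi)=\frac{1}{\sqrt{8\pi H_\xi(\xi)}}$. First eigenvalue: $\lambda_1(\Omega)$ is the smallest eigenvalue of the Dirichlet problem $-\Delta_{\mathbb{H}^1}u=\lambda u$ in $\Omega$, $u=0$ on $\partial\Omega$; equivalently $\lambda_1(\Omega)=\inf\left\{\int_\Omega|\nabla_{\mathbb{H}^1}v|^2\,dv\Big/\int_\Omega v^2\,dv\;:\;0\ne v\in S_0^{1,2}(\Omega)\right\}$, where $S_0^{1,2}(\Omega)$ is the completion (closure) of $C_0^\infty(\Omega)$ with respect to the norm $\left(\int_\Omega|\nabla_{\mathbb{H}^1}\varphi|^2\,dv\right)^{1/2}$. *)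

theory Defs
  imports "HOL-Analysis.Analysis"
begin

type_synonym heis = "real \<times> real \<times> real"

fun hmult :: "heis \<Rightarrow> heis \<Rightarrow> heis" where
  "hmult (x, y, t) (x0, y0, t0) = (x + x0, y + y0, t + t0 + 2 * (x0 * y - x * y0))"

fun hinv :: "heis \<Rightarrow> heis" where
  "hinv (x, y, t) = (- x, - y, - t)"

fun hrho :: "heis \<Rightarrow> real" where
  "hrho (x, y, t) = root 4 ((x\<^sup>2 + y\<^sup>2)\<^sup>2 + t\<^sup>2)"

definition hdist :: "heis \<Rightarrow> heis \<Rightarrow> real" where
  "hdist \<xi> \<eta> = hrho (hmult (hinv \<xi>) \<eta>)"

definition hball :: "heis \<Rightarrow> real \<Rightarrow> heis set" where
  "hball \<xi> r = {\<eta>. hdist \<xi> \<eta> < r}"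

(* The fields d/dx + 2y d/dt and d/dy - 2x d/dt, acting as directional derivatives. *)
fun hX :: "(heis \<Rightarrow> real) \<Rightarrow> heis \<Rightarrow> real" where
  "hX u (x, y, t) = frechet_derivative u (at (x, y, t)) (1, 0, 2 * y)"

fun hY :: "(heis \<Rightarrow> real) \<Rightarrow> heis \<Rightarrow> real" where
  "hY u (x, y, t) = frechet_derivative u (at (x, y, t)) (0, 1, - 2 * x)"

definition hlaplace :: "(heis \<Rightarrow> real) \<Rightarrow> heis \<Rightarrow> real" where
  "hlaplace u p = hX (hX u) p + hY (hY u) p"

(* C^k on an open set S; the values of f outside S are irrelevant. *)
fun Ck_on :: "nat \<Rightarrow> 'a::euclidean_space set \<Rightarrow> ('a \<Rightarrow> real) \<Rightarrow> bool" where
  "Ck_on 0 S f \<longleftrightarrow> continuous_on S f"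
| "Ck_on (Suc k) S f \<longleftrightarrow> (\<forall>p\<in>S. f differentiable (at p)) \<and>
     (\<forall>b\<in>Basis. Ck_on k S (\<lambda>p. frechet_derivative f (at p) b))"

definition smooth_on :: "'a::euclidean_space set \<Rightarrow> ('a \<Rightarrow> real) \<Rightarrow> bool" where
  "smooth_on S f \<longleftrightarrow> (\<forall>k. Ck_on k S f)"

definition bounded_domain :: "heis set \<Rightarrow> bool" where
  "bounded_domain \<Omega> \<longleftrightarrow> open \<Omega> \<and> connected \<Omega> \<and> \<Omega> \<noteq> {} \<and> bounded \<Omega>"

(* Near each boundary point, \<Omega> is the sublevel set of a smooth function with
   nowhere vanishing differential; the boundary is then locally its zero set. *)
definition smooth_boundary :: "heis set \<Rightarrow> bool" where
  "smooth_boundary \<Omega> \<longleftrightarrow> (\<forall>p\<in>frontier \<Omega>. \<exists>U f. open U \<and> p \<in> U \<and> smooth_on U f \<and>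
     (\<forall>q\<in>U. \<exists>v. frechet_derivative f (at q) v \<noteq> 0) \<and>
     \<Omega> \<inter> U = {q\<in>U. f q < 0})"

definition uniform_exterior_ball :: "heis set \<Rightarrow> bool" where
  "uniform_exterior_ball D \<longleftrightarrow> (\<exists>r0>0. \<forall>\<xi>\<in>frontier D. \<forall>r. 0 < r \<and> r \<le> r0 \<longrightarrow>
     (\<exists>\<eta>. hball \<eta> r \<inter> D = {} \<and> \<xi> \<in> frontier (hball \<eta> r)))"

definition dirichlet_solution :: "heis set \<Rightarrow> (heis \<Rightarrow> real) \<Rightarrow> (heis \<Rightarrow> real) \<Rightarrow> bool" where
  "dirichlet_solution \<Omega> \<phi> u \<longleftrightarrow> Ck_on 2 \<Omega> u \<and> continuous_on (closure \<Omega>) u \<and>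
     (\<forall>p\<in>\<Omega>. hlaplace u p = 0) \<and> (\<forall>p\<in>frontier \<Omega>. u p = \<phi> p)"

definition fund_sol :: "heis \<Rightarrow> heis \<Rightarrow> real" where
  "fund_sol \<xi> \<eta> = 1 / (8 * pi * (hrho (hmult (hinv \<xi>) \<eta>))\<^sup>2)"

(* By the maximum principle solutions are unique on the closure of \<Omega>; the choice
   only fixes the irrelevant values outside it. *)
definition harmonic_part :: "heis set \<Rightarrow> heis \<Rightarrow> heis \<Rightarrow> real" where
  "harmonic_part \<Omega> \<xi> = (SOME H. dirichlet_solution \<Omega> (fund_sol \<xi>) H)"

definition harmonic_radius :: "heis set \<Rightarrow> heis \<Rightarrow> real" where
  "harmonic_radius \<Omega> \<xi> = 1 / sqrt (8 * pi * harmonic_part \<Omega> \<xi> \<xi>)"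

definition harmonic_centers :: "heis set \<Rightarrow> heis set" where
  "harmonic_centers \<Omega> = {\<xi>\<in>\<Omega>. \<forall>\<eta>\<in>\<Omega>. harmonic_radius \<Omega> \<eta> \<le> harmonic_radius \<Omega> \<xi>}"

definition test_function :: "heis set \<Rightarrow> (heis \<Rightarrow> real) \<Rightarrow> bool" where
  "test_function \<Omega> \<phi> \<longleftrightarrow> smooth_on UNIV \<phi> \<and>
     (\<exists>K. compact K \<and> K \<subseteq> \<Omega> \<and> (\<forall>p. p \<notin> K \<longrightarrow> \<phi> p = 0))"

definition L2_on :: "heis set \<Rightarrow> (heis \<Rightarrow> real) \<Rightarrow> bool" where
  "L2_on \<Omega> f \<longleftrightarrow> f \<in> borel_measurable (lebesgue_on \<Omega>) \<and>
     integrable (lebesgue_on \<Omega>) (\<lambda>p. (f p)\<^sup>2)"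

(* v belongs to the closure of the test functions in the norm (\<integral> |Xu|^2 + |Yu|^2)^(1/2),
   with horizontal derivatives g = Xv and h = Yv, the L^2 limits of those of the
   approximating test functions.  For bounded \<Omega> the Poincare inequality makes a
   sequence that is Cauchy in this norm converge in L^2, so that the completion is a
   space of functions, and integration by parts makes g and h unique almost everywhere. *)
definition S012 :: "heis set \<Rightarrow> (heis \<Rightarrow> real) \<Rightarrow> (heis \<Rightarrow> real) \<Rightarrow> (heis \<Rightarrow> real) \<Rightarrow> bool" where
  "S012 \<Omega> v g h \<longleftrightarrow> L2_on \<Omega> v \<and> L2_on \<Omega> g \<and> L2_on \<Omega> h \<and>
     (\<exists>\<phi>. (\<forall>n::nat. test_function \<Omega> (\<phi> n)) \<and>
       (\<lambda>n. LINT p|lebesgue_on \<Omega>. (\<phi> n p - v p)\<^sup>2) \<longlonglongrightarrow> 0 \<and>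
       (\<lambda>n. LINT p|lebesgue_on \<Omega>. (hX (\<phi> n) p - g p)\<^sup>2 + (hY (\<phi> n) p - h p)\<^sup>2) \<longlonglongrightarrow> 0)"

definition first_eigenvalue :: "heis set \<Rightarrow> real" where
  "first_eigenvalue \<Omega> = Inf {(LINT p|lebesgue_on \<Omega>. (g p)\<^sup>2 + (h p)\<^sup>2) /
       (LINT p|lebesgue_on \<Omega>. (v p)\<^sup>2) | v g h.
     S012 \<Omega> v g h \<and> \<not> (AE p in lebesgue_on \<Omega>. v p = 0)}"

definition bessel_J :: "nat \<Rightarrow> real \<Rightarrow> real" where
  "bessel_J n x = (\<Sum>k. (- 1) ^ k / (fact k * fact (k + n)) * (x / 2) ^ (2 * k + n))"

definition l11 :: real where
  "l11 = (LEAST x. 0 < x \<and> bessel_J 1 x = 0)"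

definition alpha :: "heis set \<Rightarrow> heis \<Rightarrow> real" where
  "alpha \<Omega> \<xi> = (SUP \<eta>\<in>frontier \<Omega>. hdist \<xi> \<eta>) / (INF \<eta>\<in>frontier \<Omega>. hdist \<xi> \<eta>)"

definition C_at :: "heis set \<Rightarrow> heis \<Rightarrow> real" where
  "C_at \<Omega> \<xi> = 16 * sqrt 2 * alpha \<Omega> \<xi> ^ 6 * ((3 / (2 * pi)) powr (1 / 4))\<^sup>2"

(* LEAST and GREATEST over the reals denote an attained minimum and maximum. *)
definition C_const :: "heis set \<Rightarrow> real" where
  "C_const \<Omega> = (LEAST c. c \<in> C_at \<Omega> ` harmonic_centers \<Omega>)"

definition max_radius_sq :: "heis set \<Rightarrow> real" where
  "max_radius_sq \<Omega> = (GREATEST m. m \<in> (\<lambda>\<xi>. (harmonic_radius \<Omega> \<xi>)\<^sup>2) ` \<Omega>)"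

end

theory Submission
  imports Defs
begin

text \<open>At a harmonic center \<open>\<xi>\<close> let \<open>d\<close> be the smallest and \<open>\<alpha> d\<close> the largest Koranyi distance from \<open>\<xi>\<close>
  to the boundary. The inequality joins two estimates through \<open>d\<close>.

  First, the Koranyi ball of radius \<open>d\<close> around \<open>\<xi>\<close> lies in \<open>\<Omega>\<close>, so by monotonicity of the Rayleigh quotient
  \<open>\<lambda>\<^sub>1(\<Omega>)\<close> is at most \<open>d\<^sup>-\<^sup>2\<close> times its value on the unit ball; a bump that depends on \<open>\<rho>\<close> only already gives
  \<open>\<lambda>\<^sub>1(\<Omega>) \<le> 110.4 / d\<^sup>2\<close> (\<open>first_eigenvalue_le\<close>). Secondly, on the boundary the harmonic part \<open>H\<^sub>\<xi>\<close> equals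
  \<open>1 / (8\<pi>\<rho>\<^sup>2)\<close>, which is at least \<open>1 / (8\<pi>\<alpha>\<^sup>2d\<^sup>2)\<close>; the maximum principle carries this bound to \<open>\<xi>\<close>, whence
  \<open>r\<^sub>\<Omega>(\<xi>)\<^sup>2 \<le> \<alpha>\<^sup>2d\<^sup>2\<close> (\<open>harmonic_radius_le_far\<close>). So \<open>\<lambda>\<^sub>1(\<Omega>) r\<^sub>\<Omega>(\<xi>)\<^sup>2 \<le> 110.4 \<alpha>\<^sup>2\<close>. Since \<open>\<alpha> \<ge> 1\<close> and
  \<open>l\<^sub>1\<^sub>1\<^sup>2 \<ge> 8\<close> (\<open>l11_bound\<close>), this is at most \<open>16\<surd>2 \<alpha>\<^sup>6 (3/2\<pi>)\<^sup>1\<^sup>/\<^sup>2 l\<^sub>1\<^sub>1\<^sup>2\<close>.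

  What takes work is that the quantities in the statement have their intended values: the harmonic part must
  exist, and the maximum of the radius and the minimum of the constant over the centers must be attained
  (\<open>optimal_center\<close>). Attainment follows from the maximum principle: \<open>H\<^sub>\<xi>(\<xi>)\<close> is continuous in \<open>\<xi>\<close>, and by
  comparison with a fundamental solution whose pole is the center of an exterior ball it tends to infinity at
  the boundary (\<open>continuous_hval\<close>, \<open>hval_blow_up\<close>).

  Existence is shown by a random walk on balls. The functions \<open>|z|\<^sup>2 g(\<rho>\<^sup>4)\<close> are the kernels for which harmonic
  functions have the mean value property, because their change with the radius is the sub-Laplacian of a
  compactly supported function (\<open>dkern_eq\<close>); in particular averaging a fundamental solution does not increase it, and preserves
  it at points where the averaged ball omits the pole. Averaging repeatedly, at each point over a ball of half the distance to the complement, the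
  fundamental solution with pole \<open>\<xi>\<close> decreases to a function \<open>F(\<zeta>, \<xi>)\<close> of the starting point \<open>\<zeta>\<close>. In \<open>\<zeta>\<close> it has
  good boundary behaviour, since barriers built from exterior balls are invariant under the walk
  (\<open>swept_barrier\<close>). In \<open>\<xi>\<close> it is a limit of superpositions of fundamental solutions over mass that leaves every
  compact set, so it has the mean value property (\<open>avg_swept\<close>) and is therefore smooth and harmonic. The
  two kinds of information are about different variables; they meet because \<open>F\<close> is symmetric. Indeed
  \<open>F(\<zeta>, \<cdot>)\<close> is invariant under the walk and lies below the fundamental solution with pole \<open>\<zeta>\<close>, so walking in
  that variable gives \<open>F(\<zeta>, \<xi>) \<le> F(\<xi>, \<zeta>)\<close> (\<open>swept_sym\<close>). Thus \<open>F(\<zeta>, \<cdot>) / 8\<pi>\<close> solves the Dirichlet problem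
  that defines the harmonic part (\<open>dirichlet_solution_Hsol\<close>).\<close>

section \<open>The Heisenberg group and the Koranyi metric\<close>

text \<open>\<open>zsq\<close> is \<open>|z|\<^sup>2\<close> for \<open>z = x + iy\<close>, and \<open>hquart\<close> is \<open>\<rho>\<^sup>4\<close>: a polynomial, hence smooth at the origin
  where \<open>\<rho>\<close> is not.\<close>

definition zsq :: "heis \<Rightarrow> real" where
  "zsq p = (fst p)\<^sup>2 + (fst (snd p))\<^sup>2"

definition hquart :: "heis \<Rightarrow> real" where
  "hquart p = (zsq p)\<^sup>2 + (snd (snd p))\<^sup>2"

definition hdil :: "real \<Rightarrow> heis \<Rightarrow> heis" where
  "hdil R p = (R * fst p, R * fst (snd p), R\<^sup>2 * snd (snd p))"

lemma hmult_eq: "hmult p q = (fst p + fst q, fst (snd p) + fst (snd q),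
    snd (snd p) + snd (snd q) + 2 * (fst q * fst (snd p) - fst p * fst (snd q)))"
  by (cases p; cases q) auto

lemma hinv_eq: "hinv p = (- fst p, - fst (snd p), - snd (snd p))"
  by (cases p) auto

lemma hrho_eq: "hrho p = root 4 (hquart p)"
  by (cases p) (auto simp: hquart_def zsq_def)

declare hmult.simps [simp del] hinv.simps [simp del] hrho.simps [simp del]

lemma zsq_nonneg [simp]: "0 \<le> zsq p" by (simp add: zsq_def)
lemma hquart_nonneg [simp]: "0 \<le> hquart p" by (simp add: hquart_def)

lemma hrho_nonneg [simp]: "0 \<le> hrho p"
  by (simp add: hrho_eq)

lemma hrho_pow4: "hrho p ^ 4 = hquart p"
  by (simp add: hrho_eq)

lemma hrho_sq: "(hrho p)\<^sup>2 = sqrt (hquart p)"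
proof -
  have "((hrho p)\<^sup>2)\<^sup>2 = hquart p" using hrho_pow4[of p] by simp
  thus ?thesis by (metis real_sqrt_unique zero_le_power2)
qed

lemma hmult_assoc: "hmult (hmult p q) r = hmult p (hmult q r)"
  by (simp add: hmult_eq algebra_simps)

lemma hmult_zero [simp]: "hmult 0 p = p" "hmult p 0 = p"
  by (simp_all add: hmult_eq)

lemma hinv_hmult [simp]: "hmult (hinv p) p = 0" "hmult p (hinv p) = 0"
  by (simp_all add: hmult_eq hinv_eq zero_prod_def)

lemma hmult_hinv_cancel [simp]: "hmult (hinv p) (hmult p q) = q" "hmult p (hmult (hinv p) q) = q"
  by (simp_all flip: hmult_assoc)

lemma hinv_hinv [simp]: "hinv (hinv p) = p" by (simp add: hinv_eq)

lemma hinv_mult: "hinv (hmult p q) = hmult (hinv q) (hinv p)"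
  by (simp add: hmult_eq hinv_eq algebra_simps)

lemma zsq_hinv [simp]: "zsq (hinv p) = zsq p" by (simp add: zsq_def hinv_eq)
lemma hquart_hinv [simp]: "hquart (hinv p) = hquart p" by (simp add: hquart_def) (simp add: hinv_eq)
lemma hrho_hinv [simp]: "hrho (hinv p) = hrho p" by (simp add: hrho_eq)

lemma hquart_eq_0: "hquart p = 0 \<longleftrightarrow> p = 0"
  by (cases p) (auto simp: hquart_def zsq_def zero_prod_def add_nonneg_eq_0_iff)

lemma hrho_eq_0 [simp]: "hrho p = 0 \<longleftrightarrow> p = 0"
  by (simp add: hrho_eq hquart_eq_0)

lemma hrho_0 [simp]: "hrho 0 = 0" by simp

lemma hrho_pos: "p \<noteq> 0 \<Longrightarrow> 0 < hrho p"
  by (metis hrho_eq_0 hrho_nonneg order_le_less)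

lemma zsq_hdil: "zsq (hdil R p) = R\<^sup>2 * zsq p"
  by (simp add: zsq_def hdil_def algebra_simps power2_eq_square)

lemma hquart_hdil: "hquart (hdil R p) = R ^ 4 * hquart p"
  by (simp add: hquart_def zsq_hdil) (simp add: hdil_def algebra_simps power2_eq_square power4_eq_xxxx)

lemma hrho_hdil: "hrho (hdil R p) = \<bar>R\<bar> * hrho p"
proof -
  have "root 4 (R ^ 4) = \<bar>R\<bar>"
    using real_root_power_cancel[of 4 "\<bar>R\<bar>"] by (simp add: power_even_abs)
  thus ?thesis by (simp add: hrho_eq hquart_hdil real_root_mult)
qed

lemma hdil_hmult: "hdil R (hmult p q) = hmult (hdil R p) (hdil R q)"
  by (simp add: hdil_def hmult_eq algebra_simps power2_eq_square)

lemma hdil_hdil: "hdil R (hdil S p) = hdil (R * S) p"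
  by (simp add: hdil_def power_mult_distrib)

lemma hdil_1 [simp]: "hdil 1 p = p" by (simp add: hdil_def)
lemma hdil_0 [simp]: "hdil 0 p = 0" by (simp add: hdil_def zero_prod_def)
lemma hdil_zero [simp]: "hdil R 0 = 0" by (simp add: hdil_def zero_prod_def)

text \<open>In \<open>\<rho>(p)\<^sup>2 = \<bar>|z|\<^sup>2 + it\<bar>\<close> the group law becomes addition of the complex numbers \<open>|z|\<^sup>2 + it\<close> up to a
  cross term of modulus \<open>2|z||w|\<close>, which completes the square (Cygan).\<close>

lemma hrho_triangle: "hrho (hmult p q) \<le> hrho p + hrho q"
proof -
  obtain x y t where p: "p = (x, y, t)" by (cases p)
  obtain a b u where q: "q = (a, b, u)" by (cases q)
  have mod: "cmod (Complex (zsq r) (snd (snd r))) = (hrho r)\<^sup>2" for r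
    by (simp add: hrho_sq hquart_def complex_norm)
  define c where "c = 2 * (Complex x y * cnj (Complex a b))"
  have eq: "Complex (zsq (hmult p q)) (snd (snd (hmult p q))) =
      Complex (zsq p) t + Complex (zsq q) u + c"
    unfolding c_def p q by (simp add: complex_eq_iff zsq_def hmult_eq power2_eq_square algebra_simps)
  have zle: "sqrt (zsq r) \<le> hrho r" for r
  proof -
    have "zsq r \<le> (hrho r)\<^sup>2" unfolding hrho_sq hquart_def
      by (simp add: real_le_rsqrt)
    thus ?thesis by (simp add: real_le_lsqrt)
  qed
  have "cmod c = 2 * (cmod (Complex x y) * cmod (Complex a b))"
    unfolding c_def by (simp only: norm_mult complex_mod_cnj) simp
  also have "\<dots> = 2 * (sqrt (zsq p) * sqrt (zsq q))"
    by (simp add: p q zsq_def complex_norm)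
  also have "\<dots> \<le> 2 * (hrho p * hrho q)"
    by (intro mult_left_mono mult_mono zle) auto
  finally have c: "cmod c \<le> 2 * (hrho p * hrho q)" .
  have "(hrho (hmult p q))\<^sup>2 = cmod (Complex (zsq p) t + Complex (zsq q) u + c)"
    using mod[of "hmult p q"] eq by simp
  also have "\<dots> \<le> (hrho p)\<^sup>2 + (hrho q)\<^sup>2 + cmod c"
    using mod[of p] mod[of q] norm_triangle_ineq[of "Complex (zsq p) t + Complex (zsq q) u" c]
      norm_triangle_ineq[of "Complex (zsq p) t" "Complex (zsq q) u"] by (simp add: p q)
  also have "\<dots> \<le> (hrho p + hrho q)\<^sup>2"
    using c by (simp add: power2_sum)
  finally show ?thesis by (rule power2_le_imp_le) simp
qed

lemma hdist_nonneg [simp]: "0 \<le> hdist p q" by (simp add: hdist_def)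

lemma hdist_sym: "hdist p q = hdist q p"
  unfolding hdist_def by (metis hrho_hinv hinv_mult hinv_hinv)

lemma hdist_triangle: "hdist p r \<le> hdist p q + hdist q r"
proof -
  have "hmult (hinv p) r = hmult (hmult (hinv p) q) (hmult (hinv q) r)"
    by (simp add: hmult_assoc)
  thus ?thesis unfolding hdist_def using hrho_triangle by metis
qed

lemma hdist_eq_0 [simp]: "hdist p q = 0 \<longleftrightarrow> p = q"
  unfolding hdist_def hrho_eq_0 by (metis hinv_hmult(1) hmult_hinv_cancel(2) hmult_zero(2))

lemma hdist_hmult [simp]: "hdist \<xi> (hmult \<xi> p) = hrho p" by (simp add: hdist_def)

lemma hdist_pos: "p \<noteq> q \<Longrightarrow> 0 < hdist p q"
  by (metis hdist_eq_0 hdist_nonneg order_le_less)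

lemma continuous_on_hinv [continuous_intros]:
  "continuous_on S f \<Longrightarrow> continuous_on S (\<lambda>x. hinv (f x))"
  unfolding hinv_eq by (intro continuous_intros)

lemma continuous_on_hmult [continuous_intros]:
  "continuous_on S f \<Longrightarrow> continuous_on S g \<Longrightarrow> continuous_on S (\<lambda>x. hmult (f x) (g x))"
  unfolding hmult_eq by (intro continuous_intros)

lemma continuous_on_hdil [continuous_intros]:
  "continuous_on S f \<Longrightarrow> continuous_on S g \<Longrightarrow> continuous_on S (\<lambda>x. hdil (f x) (g x))"
  unfolding hdil_def by (intro continuous_intros)

lemma continuous_on_zsq [continuous_intros]:
  "continuous_on S f \<Longrightarrow> continuous_on S (\<lambda>x. zsq (f x))"
  unfolding zsq_def by (intro continuous_intros)

lemma continuous_on_hquart [continuous_intros]: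
  "continuous_on S f \<Longrightarrow> continuous_on S (\<lambda>x. hquart (f x))"
  unfolding hquart_def by (intro continuous_intros)

lemma continuous_on_hrho [continuous_intros]:
  "continuous_on S f \<Longrightarrow> continuous_on S (\<lambda>x. hrho (f x))"
  unfolding hrho_eq by (intro continuous_intros)

lemma continuous_on_hdist [continuous_intros]:
  "continuous_on S f \<Longrightarrow> continuous_on S g \<Longrightarrow> continuous_on S (\<lambda>x. hdist (f x) (g x))"
  unfolding hdist_def by (intro continuous_intros)

lemma zsq_le_hrho: "zsq p \<le> (hrho p)\<^sup>2"
  unfolding hrho_sq hquart_def by (simp add: real_le_rsqrt)

lemma hrho_bounds:
  assumes "hrho p \<le> R"
  shows "\<bar>fst p\<bar> \<le> R" "\<bar>fst (snd p)\<bar> \<le> R" "\<bar>snd (snd p)\<bar> \<le> R\<^sup>2"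
proof -
  have R: "0 \<le> R" using assms hrho_nonneg[of p] by linarith
  have sq: "(hrho p)\<^sup>2 \<le> R\<^sup>2" using assms by (simp add: power_mono)
  have z: "zsq p \<le> R\<^sup>2" using zsq_le_hrho[of p] sq by linarith
  show "\<bar>fst p\<bar> \<le> R" "\<bar>fst (snd p)\<bar> \<le> R"
    using z R abs_le_square_iff[of "fst p" R] abs_le_square_iff[of "fst (snd p)" R]
      zero_le_power2[of "fst p"] zero_le_power2[of "fst (snd p)"] unfolding zsq_def by linarith+
  have "\<bar>snd (snd p)\<bar> = sqrt ((snd (snd p))\<^sup>2)" by simp
  also have "\<dots> \<le> (hrho p)\<^sup>2" unfolding hrho_sq hquart_def by simp
  finally show "\<bar>snd (snd p)\<bar> \<le> R\<^sup>2" using sq by linarith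
qed

text \<open>Coordinate boxes that contain the Koranyi balls; the integrals that are differentiated under the integral
  sign are taken over boxes.\<close>

definition hbox :: "real \<Rightarrow> heis set" where
  "hbox R = cbox (-R, -R, -(R\<^sup>2)) (R, R, R\<^sup>2)"

lemma hrho_le_imp_hbox:
  assumes "hrho p \<le> R" shows "p \<in> hbox R"
proof -
  have "(fst p, fst (snd p), snd (snd p)) \<in> hbox R"
    unfolding hbox_def cbox_Pair_eq mem_Times_iff fst_conv snd_conv box_real
    using hrho_bounds[OF assms] by (simp add: abs_le_iff)
  thus ?thesis by simp
qed

lemma compact_hrho_le: "compact {p. hrho p \<le> R}"
proof -
  have "closed {p. hrho p \<le> R}"
    by (intro closed_Collect_le continuous_intros)
  moreover have "bounded {p. hrho p \<le> R}"
  proof (rule bounded_subset)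
    show "bounded (hbox R)" by (simp add: hbox_def)
    show "{p. hrho p \<le> R} \<subseteq> hbox R" using hrho_le_imp_hbox by blast
  qed
  ultimately show ?thesis by (simp add: compact_eq_bounded_closed)
qed

lemma hcball_eq_image: "{q. hdist \<xi> q \<le> R} = hmult \<xi> ` {p. hrho p \<le> R}"
proof (intro set_eqI iffI)
  fix q assume "q \<in> {q. hdist \<xi> q \<le> R}"
  thus "q \<in> hmult \<xi> ` {p. hrho p \<le> R}"
    by (intro image_eqI[of _ _ "hmult (hinv \<xi>) q"]) (simp_all add: hdist_def)
qed auto

lemma compact_hcball: "compact {q. hdist \<xi> q \<le> R}"
  unfolding hcball_eq_image
  by (intro compact_continuous_image compact_hrho_le continuous_intros)

lemma open_hball: "open (hball \<xi> r)"
  unfolding hball_def by (intro open_Collect_less continuous_intros)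

text \<open>The Koranyi balls generate the Euclidean topology. Where a closed unit ball sticks out of \<open>U\<close>, the
  distance from \<open>\<xi>\<close> to the part outside is attained by compactness, and it is positive.\<close>

lemma open_contains_hcball:
  assumes "open U" "\<xi> \<in> U"
  obtains R where "0 < R" "{q. hdist \<xi> q \<le> R} \<subseteq> U"
proof (cases "{q. hdist \<xi> q \<le> 1} \<subseteq> U")
  case True
  thus ?thesis using that[of 1] by auto
next
  case False
  define K where "K = {q. hdist \<xi> q \<le> 1} - U"
  have K: "compact K" "K \<noteq> {}" using compact_hcball[of \<xi> 1] assms False
    by (auto simp: K_def compact_diff)
  have "continuous_on K (\<lambda>q. hdist \<xi> q)" by (intro continuous_intros)
  then obtain m where m: "m \<in> K" "\<And>q. q \<in> K \<Longrightarrow> hdist \<xi> m \<le> hdist \<xi> q"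
    using continuous_attains_inf[OF K] by metis
  have pos: "0 < hdist \<xi> m" using m(1) assms by (intro hdist_pos) (auto simp: K_def)
  have le: "hdist \<xi> m \<le> 1" using m(1) by (simp add: K_def)
  show ?thesis
  proof (rule that[of "hdist \<xi> m / 2"])
    show "{q. hdist \<xi> q \<le> hdist \<xi> m / 2} \<subseteq> U"
    proof
      fix q assume q: "q \<in> {q. hdist \<xi> q \<le> hdist \<xi> m / 2}"
      show "q \<in> U"
      proof (rule ccontr)
        assume "q \<notin> U"
        hence "q \<in> K" using q le pos by (auto simp: K_def)
        thus False using m(2)[of q] q pos by auto
      qed
    qed
  qed (use pos in simp)
qed

lemma hdist_self [simp]: "hdist p p = 0" by simp

lemma continuous_on_hdist_lipschitz:
  assumes lip: "\<And>\<xi> \<eta>. f \<xi> \<le> f \<eta> + hdist \<xi> \<eta>"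
  shows "continuous_on S (f :: heis \<Rightarrow> real)"
proof -
  have "isCont f \<zeta>" for \<zeta>
  proof -
    have "continuous_on UNIV (\<lambda>\<eta>. hdist \<zeta> \<eta>)" by (intro continuous_intros)
    from this[unfolded continuous_on_def, rule_format, of \<zeta>]
    have "((\<lambda>\<eta>. hdist \<zeta> \<eta>) \<longlongrightarrow> 0) (at \<zeta>)" by simp
    moreover have "norm (f \<eta> - f \<zeta>) \<le> hdist \<zeta> \<eta>" for \<eta>
      using lip[of \<zeta> \<eta>] lip[of \<eta> \<zeta>] hdist_sym[of \<zeta> \<eta>] by simp
    hence "\<forall>\<^sub>F \<eta> in at \<zeta>. norm (f \<eta> - f \<zeta>) \<le> hdist \<zeta> \<eta>" by simp
    ultimately have "((\<lambda>\<eta>. f \<eta> - f \<zeta>) \<longlongrightarrow> 0) (at \<zeta>)"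
      by (rule Lim_null_comparison[rotated])
    thus ?thesis by (simp add: isCont_def LIM_zero_iff)
  qed
  thus ?thesis by (simp add: continuous_at_imp_continuous_on)
qed

section \<open>Haar measure and integration by parts\<close>

lemma borel_measurable_heis [measurable]:
  "hmult \<xi> \<in> borel_measurable borel" "(\<lambda>p. hmult p \<xi>) \<in> borel_measurable borel"
  "hdil R \<in> borel_measurable borel" "hrho \<in> borel_measurable borel"
  "zsq \<in> borel_measurable borel" "hquart \<in> borel_measurable borel" "hinv \<in> borel_measurable borel"
  by (intro borel_measurable_continuous_onI continuous_intros)+

lemma lborel_heis: "(lborel :: heis measure) = lborel \<Otimes>\<^sub>M (lborel \<Otimes>\<^sub>M lborel)"
  by (simp add: lborel_prod)

lemma nn_integral_heis:
  fixes f :: "heis \<Rightarrow> ennreal"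
  assumes [measurable]: "f \<in> borel_measurable borel"
  shows "(\<integral>\<^sup>+p. f p \<partial>lborel) = (\<integral>\<^sup>+x. \<integral>\<^sup>+y. \<integral>\<^sup>+t. f (x, y, t) \<partial>lborel \<partial>lborel \<partial>lborel)"
proof -
  have f: "f \<in> borel_measurable (lborel \<Otimes>\<^sub>M (lborel \<Otimes>\<^sub>M lborel))"
    using assms by (simp add: lborel_prod)
  have "(\<integral>\<^sup>+p. f p \<partial>lborel) = (\<integral>\<^sup>+x. \<integral>\<^sup>+q. f (x, q) \<partial>(lborel \<Otimes>\<^sub>M lborel) \<partial>lborel)"
    unfolding lborel_heis
    by (rule sigma_finite_measure.nn_integral_fst[OF _ f, symmetric])
       (simp add: lborel_prod sigma_finite_lborel)
  also have "\<dots> = (\<integral>\<^sup>+x. \<integral>\<^sup>+y. \<integral>\<^sup>+t. f (x, y, t) \<partial>lborel \<partial>lborel \<partial>lborel)"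
  proof (rule nn_integral_cong)
    fix x :: real
    have "(\<lambda>q. f (x, q)) \<in> borel_measurable borel" by measurable
    hence "(\<lambda>q. f (x, q)) \<in> borel_measurable (lborel \<Otimes>\<^sub>M lborel)"
      by (simp add: lborel_prod)
    thus "(\<integral>\<^sup>+q. f (x, q) \<partial>(lborel \<Otimes>\<^sub>M lborel)) = (\<integral>\<^sup>+y. \<integral>\<^sup>+t. f (x, y, t) \<partial>lborel \<partial>lborel)"
      by (rule lborel.nn_integral_fst[symmetric])
  qed
  finally show ?thesis .
qed

text \<open>Translations on either side, dilations and reflections are all affine and triangular, so three
  one-dimensional substitutions give every change of variables that is needed.\<close>

lemma nn_integral_triangular:
  fixes f :: "heis \<Rightarrow> ennreal"
  assumes [measurable]: "f \<in> borel_measurable borel" and nz: "\<alpha> \<noteq> 0" "\<beta> \<noteq> 0" "\<gamma> \<noteq> 0"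
  shows "(\<integral>\<^sup>+p. f p \<partial>lborel) = ennreal (\<bar>\<alpha>\<bar> * \<bar>\<beta>\<bar> * \<bar>\<gamma>\<bar>) *
    (\<integral>\<^sup>+p. f (a + \<alpha> * fst p, b + \<beta> * fst (snd p),
        c + \<gamma> * snd (snd p) + m * fst p + n * fst (snd p)) \<partial>lborel)"
proof -
  have t: "(\<integral>\<^sup>+t. f (x, y, t) \<partial>lborel) = ennreal \<bar>\<gamma>\<bar> * (\<integral>\<^sup>+t. f (x, y, d + \<gamma> * t) \<partial>lborel)" for x y d
    by (rule nn_integral_real_affine) (use nz in measurable)
  have y: "(\<integral>\<^sup>+y. \<integral>\<^sup>+t. f (x, y, t) \<partial>lborel \<partial>lborel) = ennreal \<bar>\<beta>\<bar> *
      (\<integral>\<^sup>+y. \<integral>\<^sup>+t. f (x, b + \<beta> * y, t) \<partial>lborel \<partial>lborel)" for x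
    by (rule nn_integral_real_affine[of "\<lambda>y. \<integral>\<^sup>+t. f (x, y, t) \<partial>lborel" \<beta> b]) (use nz in measurable)
  have x: "(\<integral>\<^sup>+x. \<integral>\<^sup>+y. \<integral>\<^sup>+t. f (x, y, t) \<partial>lborel \<partial>lborel \<partial>lborel) = ennreal \<bar>\<alpha>\<bar> *
      (\<integral>\<^sup>+x. \<integral>\<^sup>+y. \<integral>\<^sup>+t. f (a + \<alpha> * x, y, t) \<partial>lborel \<partial>lborel \<partial>lborel)"
    by (rule nn_integral_real_affine[of "\<lambda>x. \<integral>\<^sup>+y. \<integral>\<^sup>+t. f (x, y, t) \<partial>lborel \<partial>lborel" \<alpha> a])
       (use nz in measurable)
  have "(\<integral>\<^sup>+p. f p \<partial>lborel) = ennreal \<bar>\<alpha>\<bar> * (\<integral>\<^sup>+x. ennreal \<bar>\<beta>\<bar> * (\<integral>\<^sup>+y. ennreal \<bar>\<gamma>\<bar> *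
     (\<integral>\<^sup>+t. f (a + \<alpha> * x, b + \<beta> * y, (c + m * x + n * y) + \<gamma> * t) \<partial>lborel) \<partial>lborel) \<partial>lborel)"
    unfolding nn_integral_heis[OF assms(1)] x
    by (intro arg_cong2[where f = "(*)"] refl nn_integral_cong, subst y)
       (intro arg_cong2[where f = "(*)"] refl nn_integral_cong t)
  also have "\<dots> = ennreal (\<bar>\<alpha>\<bar> * \<bar>\<beta>\<bar> * \<bar>\<gamma>\<bar>) * (\<integral>\<^sup>+x. \<integral>\<^sup>+y. \<integral>\<^sup>+t.
      f (a + \<alpha> * x, b + \<beta> * y, (c + m * x + n * y) + \<gamma> * t) \<partial>lborel \<partial>lborel \<partial>lborel)"
    by (subst nn_integral_cmult, measurable)+ (simp add: ennreal_mult mult.assoc)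
  also have "\<dots> = ennreal (\<bar>\<alpha>\<bar> * \<bar>\<beta>\<bar> * \<bar>\<gamma>\<bar>) * (\<integral>\<^sup>+p. f (a + \<alpha> * fst p, b + \<beta> * fst (snd p),
        c + \<gamma> * snd (snd p) + m * fst p + n * fst (snd p)) \<partial>lborel)"
  proof -
    have "(\<lambda>p::heis. (a + \<alpha> * fst p, b + \<beta> * fst (snd p),
        c + \<gamma> * snd (snd p) + m * fst p + n * fst (snd p))) \<in> borel_measurable borel"
      by (intro borel_measurable_continuous_onI continuous_intros)
    from measurable_compose[OF this assms(1)] show ?thesis
      by (subst nn_integral_heis) (simp_all add: algebra_simps)
  qed
  finally show ?thesis .
qed

lemma nn_integral_hmult_left:
  assumes "f \<in> borel_measurable borel"
  shows "(\<integral>\<^sup>+p. f (hmult \<xi> p) \<partial>lborel) = (\<integral>\<^sup>+p. (f p :: ennreal) \<partial>lborel)"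
  using nn_integral_triangular[OF assms, of 1 1 1 "fst \<xi>" "fst (snd \<xi>)" "snd (snd \<xi>)"
      "2 * fst (snd \<xi>)" "- 2 * fst \<xi>"]
  by (simp add: hmult_eq algebra_simps)

lemma nn_integral_hmult_right:
  assumes "f \<in> borel_measurable borel"
  shows "(\<integral>\<^sup>+p. f (hmult p \<xi>) \<partial>lborel) = (\<integral>\<^sup>+p. (f p :: ennreal) \<partial>lborel)"
  using nn_integral_triangular[OF assms, of 1 1 1 "fst \<xi>" "fst (snd \<xi>)" "snd (snd \<xi>)"
      "- 2 * fst (snd \<xi>)" "2 * fst \<xi>"]
  by (simp add: hmult_eq algebra_simps)

lemma nn_integral_hdil:
  assumes "f \<in> borel_measurable borel" "0 < R"
  shows "(\<integral>\<^sup>+p. (f p :: ennreal) \<partial>lborel) = ennreal (R ^ 4) * (\<integral>\<^sup>+p. f (hdil R p) \<partial>lborel)"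
  using nn_integral_triangular[OF assms(1), of R R "R\<^sup>2" 0 0 0 0 0] assms(2)
  by (simp add: hdil_def power2_eq_square power4_eq_xxxx mult.assoc)

text \<open>Transfers a substitution rule from nonnegative to arbitrary real integrands.\<close>

lemma distr_lborel_eqI:
  fixes T :: "heis \<Rightarrow> heis"
  assumes [measurable]: "T \<in> borel_measurable borel" and "0 \<le> c"
    and "\<And>f :: heis \<Rightarrow> ennreal. f \<in> borel_measurable borel \<Longrightarrow>
      ennreal c * (\<integral>\<^sup>+p. f (T p) \<partial>lborel) = (\<integral>\<^sup>+p. f p \<partial>lborel)"
  shows "lborel = density (distr lborel borel T) (\<lambda>_. ennreal c)"
proof (rule measure_eqI)
  fix A :: "heis set" assume "A \<in> sets lborel"
  hence [measurable]: "A \<in> sets borel" by simp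
  have "emeasure lborel A = (\<integral>\<^sup>+p. indicator A p \<partial>lborel)" by simp
  also have "\<dots> = ennreal c * (\<integral>\<^sup>+p. indicator A (T p) \<partial>lborel)" by (rule assms(3)[symmetric]) measurable
  also have "\<dots> = emeasure (density (distr lborel borel T) (\<lambda>_. ennreal c)) A"
  proof -
    have "(\<integral>\<^sup>+p. indicator A (T p) \<partial>lborel) = emeasure (distr lborel borel T) A"
      using nn_integral_distr[of T lborel borel "indicator A"] by simp
    thus ?thesis by (simp add: emeasure_density nn_integral_cmult)
  qed
  finally show "emeasure lborel A = \<dots>" .
qed simp

lemma integral_substitution:
  fixes T :: "heis \<Rightarrow> heis" and f :: "heis \<Rightarrow> real"
  assumes "T \<in> borel_measurable borel" "0 \<le> c"
    and "\<And>f :: heis \<Rightarrow> ennreal. f \<in> borel_measurable borel \<Longrightarrow>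
      ennreal c * (\<integral>\<^sup>+p. f (T p) \<partial>lborel) = (\<integral>\<^sup>+p. f p \<partial>lborel)"
    and "f \<in> borel_measurable borel"
  shows "(LINT p|lborel. f p) = c * (LINT p|lborel. f (T p))"
  by (subst distr_lborel_eqI[OF assms(1-3)])
     (use assms in \<open>simp_all add: integral_density integral_distr\<close>)

lemma integral_hmult_left:
  assumes "f \<in> borel_measurable borel"
  shows "(LINT p|lborel. f (hmult \<xi> p)) = (LINT p|lborel. (f p :: real))"
  using integral_substitution[of "hmult \<xi>" 1 f] assms by (simp add: nn_integral_hmult_left)

lemma integral_hmult_right:
  assumes "f \<in> borel_measurable borel"
  shows "(LINT p|lborel. f (hmult p \<xi>)) = (LINT p|lborel. (f p :: real))"
  using integral_substitution[of "\<lambda>p. hmult p \<xi>" 1 f] assms by (simp add: nn_integral_hmult_right)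

lemma integral_hdil:
  assumes "f \<in> borel_measurable borel" "0 < R"
  shows "(LINT p|lborel. (f p :: real)) = R ^ 4 * (LINT p|lborel. f (hdil R p))"
  by (rule integral_substitution) (use assms in \<open>auto simp flip: nn_integral_hdil\<close>)

lemma integrable_hbox:
  fixes f :: "heis \<Rightarrow> real"
  assumes "continuous_on UNIV f" "\<And>p. p \<notin> hbox R \<Longrightarrow> f p = 0"
  shows "integrable lborel f" "integral (hbox R) f = (LINT p|lborel. f p)"
proof -
  have "integrable lborel (\<lambda>p. indicat_real (hbox R) p *\<^sub>R f p)"
    by (rule borel_integrable_compact)
       (use assms in \<open>auto simp: hbox_def intro: continuous_on_subset\<close>)
  moreover have eq: "(\<lambda>p. indicat_real (hbox R) p *\<^sub>R f p) = f"
  proof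
    show "indicat_real (hbox R) p *\<^sub>R f p = f p" for p
      using assms(2)[of p] by (cases "p \<in> hbox R") simp_all
  qed
  ultimately show int: "integrable lborel f" by simp
  have "integral (hbox R) f = integral UNIV f"
    by (rule integral_spike_set) (auto intro: negligible_subset[OF negligible_empty] simp: assms(2))
  thus "integral (hbox R) f = (LINT p|lborel. f p)" by (simp add: integral_lborel int)
qed

text \<open>The derivative along the left-invariant field generated by a horizontal vector \<open>v\<close> (third component
  \<open>0\<close>). Its flow is right translation by multiples of \<open>v\<close>, which makes left invariance immediate.\<close>

definition has_hderiv :: "heis \<Rightarrow> (heis \<Rightarrow> real) \<Rightarrow> real \<Rightarrow> heis \<Rightarrow> bool" where
  "has_hderiv v u d p \<longleftrightarrow> ((\<lambda>h. u (hmult p (h *\<^sub>R v))) has_real_derivative d) (at 0)"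

lemma hmult_line:
  assumes "snd (snd v) = 0"
  shows "hmult (hmult p (h *\<^sub>R v)) (k *\<^sub>R v) = hmult p ((h + k) *\<^sub>R v)"
  using assms by (cases v) (simp add: hmult_eq algebra_simps)

lemma scaleR_horizontal: "snd (snd v) = 0 \<Longrightarrow> h *\<^sub>R v = hdil h v"
  by (cases v) (simp add: hdil_def)

lemma has_hderiv_along:
  assumes "snd (snd v) = 0" "has_hderiv v u d (hmult p (\<tau> *\<^sub>R v))"
  shows "((\<lambda>h. u (hmult p (h *\<^sub>R v))) has_real_derivative d) (at \<tau>)"
proof -
  have "((\<lambda>h. u (hmult p ((h + \<tau>) *\<^sub>R v))) has_real_derivative d) (at 0)"
    using assms(2) unfolding has_hderiv_def hmult_line[OF assms(1)] by (simp add: add.commute)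
  thus ?thesis using DERIV_shift[of "\<lambda>h. u (hmult p (h *\<^sub>R v))" d 0 \<tau>] by simp
qed

lemma has_hderiv_left:
  "has_hderiv v (\<lambda>p. u (hmult \<xi> p)) d p \<longleftrightarrow> has_hderiv v u d (hmult \<xi> p)"
  by (simp add: has_hderiv_def hmult_assoc)

lemma has_hderiv_mult:
  assumes "has_hderiv v u d p" "has_hderiv v w e p"
  shows "has_hderiv v (\<lambda>p. u p * w p) (d * w p + u p * e) p"
  using DERIV_mult[OF assms[unfolded has_hderiv_def]] by (simp add: has_hderiv_def mult.commute)

lemma has_hderiv_cong_open:
  assumes "open U" "p \<in> U" "\<And>q. q \<in> U \<Longrightarrow> u q = w q"
  shows "has_hderiv v u d p \<longleftrightarrow> has_hderiv v w d p"
proof -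
  have "((\<lambda>h. hmult p (h *\<^sub>R v)) \<longlongrightarrow> hmult p (0 *\<^sub>R v)) (at 0)"
    by (rule continuous_on_tendsto_compose[of UNIV]) (auto intro!: continuous_intros tendsto_intros)
  hence "\<forall>\<^sub>F h in at 0. hmult p (h *\<^sub>R v) \<in> U"
    by (rule topological_tendstoD) (use assms in auto)
  hence "\<forall>\<^sub>F h in nhds 0. u (hmult p (h *\<^sub>R v)) = w (hmult p (h *\<^sub>R v))"
    unfolding eventually_nhds_conv_at
    by (auto elim!: eventually_mono intro!: assms(3) simp: assms(2))
  thus ?thesis unfolding has_hderiv_def by (intro DERIV_cong_ev) auto
qed

text \<open>Right translations preserve the volume and are the flow of the field, so the integral of a
  derivative is the derivative of a constant.\<close>

lemma integral_hderiv_eq_0: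
  assumes v: "snd (snd v) = 0"
    and cont: "continuous_on UNIV F" "continuous_on UNIV F'"
    and der: "\<And>p. has_hderiv v F (F' p) p"
    and zero: "\<And>p. R0 < hrho p \<Longrightarrow> F p = 0" "\<And>p. R0 < hrho p \<Longrightarrow> F' p = 0"
  shows "(LINT p|lborel. F' p) = 0"
proof -
  \<comment> \<open>A box that contains the support of all translates by \<open>h v\<close> with \<open>|h| < 1\<close>.\<close>
  define R where "R = R0 + hrho v"
  define U where "U = {-1<..<1::real}"
  have out: "F (hmult p (h *\<^sub>R v)) = 0" if "h \<in> U" "p \<notin> hbox R" for h p
  proof -
    have "hrho p \<le> hrho (hmult p (h *\<^sub>R v)) + hrho (hinv (h *\<^sub>R v))"
      using hrho_triangle[of "hmult p (h *\<^sub>R v)" "hinv (h *\<^sub>R v)"] by (simp add: hmult_assoc)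
    moreover have "hrho (hinv (h *\<^sub>R v)) \<le> 1 * hrho v"
      unfolding hrho_hinv scaleR_horizontal[OF v] hrho_hdil
      by (rule mult_right_mono) (use that in \<open>auto simp: U_def\<close>)
    moreover have "R < hrho p" using that(2) hrho_le_imp_hbox[of p R] by (meson not_le)
    ultimately have "R0 < hrho (hmult p (h *\<^sub>R v))" by (simp add: R_def)
    thus ?thesis by (rule zero)
  qed
  have out': "F' p = 0" if "p \<notin> hbox R" for p
  proof (rule zero(2))
    have "R < hrho p" using that hrho_le_imp_hbox[of p R] by (meson not_le)
    thus "R0 < hrho p" using hrho_nonneg[of v] unfolding R_def by linarith
  qed
  have const: "integral (hbox R) (\<lambda>p. F (hmult p (h *\<^sub>R v))) = (LINT p|lborel. F p)" if "h \<in> U" for h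
  proof -
    have "continuous_on UNIV (\<lambda>p. F (hmult p (h *\<^sub>R v)))"
      by (rule continuous_on_compose2[OF cont(1)]) (auto intro!: continuous_intros)
    thus ?thesis using integrable_hbox(2)[of "\<lambda>p. F (hmult p (h *\<^sub>R v))" R] out[OF that]
      integral_hmult_right[of F "h *\<^sub>R v"] cont(1) by (simp add: borel_measurable_continuous_onI)
  qed
  have "((\<lambda>h. integral (cbox (-R, -R, -(R\<^sup>2)) (R, R, R\<^sup>2)) (\<lambda>p. F (hmult p (h *\<^sub>R v)))) has_field_derivative
      integral (cbox (-R, -R, -(R\<^sup>2)) (R, R, R\<^sup>2)) (\<lambda>p. F' (hmult p (0 *\<^sub>R v)))) (at 0 within U)"
  proof (rule leibniz_rule_field_derivative)
    show "((\<lambda>h. F (hmult p (h *\<^sub>R v))) has_real_derivative F' (hmult p (h *\<^sub>R v))) (at h within U)" for h p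
      by (rule has_field_derivative_at_within, rule has_hderiv_along[OF v der])
    show "(\<lambda>p. F (hmult p (h *\<^sub>R v))) integrable_on cbox (-R, -R, -(R\<^sup>2)) (R, R, R\<^sup>2)" for h
      by (rule integrable_continuous, rule continuous_on_compose2[OF cont(1)])
         (auto intro!: continuous_intros)
    show "continuous_on (U \<times> cbox (-R, -R, -(R\<^sup>2)) (R, R, R\<^sup>2)) (\<lambda>(h, p). F' (hmult p (h *\<^sub>R v)))"
      unfolding case_prod_beta
      by (rule continuous_on_compose2[OF cont(2)]) (auto intro!: continuous_intros)
  qed (auto simp: U_def)
  note leibniz = this
  have "((\<lambda>h. integral (hbox R) (\<lambda>p. F (hmult p (h *\<^sub>R v)))) has_field_derivative (LINT p|lborel. F' p)) (at 0)"
  proof -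
    have "integral (hbox R) F' = (LINT p|lborel. F' p)"
      by (rule integrable_hbox(2)[OF cont(2)]) (rule out')
    moreover have "at 0 within U = at (0::real)" by (rule at_within_open) (auto simp: U_def)
    ultimately show ?thesis using leibniz by (simp flip: hbox_def)
  qed
  hence "((\<lambda>h. LINT p|lborel. F p) has_field_derivative (LINT p|lborel. F' p)) (at 0)"
    by (rule has_field_derivative_transform_within_open[of _ _ _ U]) (auto simp: const U_def)
  thus ?thesis using DERIV_unique DERIV_const by blast
qed

section \<open>A smooth profile\<close>

text \<open>The linear span of these functions is closed under differentiation, so smoothness of the standard
  bump at \<open>0\<close> reduces to the single limit \<open>flat_exp_tendsto_0\<close>.\<close>

definition flat_exp :: "nat \<Rightarrow> real \<Rightarrow> real" where
  "flat_exp k x = (if 0 < x then exp (- (1 / x)) / x ^ k else 0)"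

lemma flat_exp_nonneg [simp]: "0 \<le> flat_exp k x" by (simp add: flat_exp_def)
lemma flat_exp_eq_0 [simp]: "x \<le> 0 \<Longrightarrow> flat_exp k x = 0" by (simp add: flat_exp_def)
lemma flat_exp_pos: "0 < x \<Longrightarrow> 0 < flat_exp k x" by (simp add: flat_exp_def)

lemma flat_exp_tendsto_0: "(flat_exp k \<longlongrightarrow> 0) (at 0)"
proof (rule filterlim_split_at)
  have "((\<lambda>x. (inverse x) ^ k / exp (inverse x)) \<longlongrightarrow> 0) (at_right (0::real))"
    by (rule filterlim_compose[OF tendsto_power_div_exp_0 filterlim_inverse_at_top_right])
  thus "(flat_exp k \<longlongrightarrow> 0) (at_right 0)"
    by (rule Lim_transform_eventually)
       (auto simp: eventually_at_filter flat_exp_def exp_minus field_simps)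
  show "(flat_exp k \<longlongrightarrow> 0) (at_left 0)"
    by (rule tendsto_eventually) (auto simp: eventually_at_filter)
qed

lemma flat_exp_deriv:
  "(flat_exp k has_real_derivative flat_exp (k + 2) x - real k * flat_exp (k + 1) x) (at x)"
proof (cases x "0::real" rule: linorder_cases)
  case greater
  have "((\<lambda>x. exp (- (1 / x)) / x ^ k) has_real_derivative
      flat_exp (k + 2) x - real k * flat_exp (k + 1) x) (at x)"
  proof (cases k)
    case (Suc n)
    have "n = 0 \<or> x ^ n = x * x ^ (n - Suc 0)" by (cases n) simp_all
    thus ?thesis using greater Suc
      by (auto intro!: derivative_eq_intros simp: flat_exp_def field_simps power2_eq_square)
  qed (use greater in \<open>auto intro!: derivative_eq_intros simp: flat_exp_def field_simps power2_eq_square\<close>)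
  thus ?thesis
    by (rule has_field_derivative_transform_within_open[of _ _ _ "{0<..}"])
       (use greater in \<open>auto simp: flat_exp_def\<close>)
next
  case less
  have "((\<lambda>x. 0) has_real_derivative flat_exp (k + 2) x - real k * flat_exp (k + 1) x) (at x)"
    using less by simp
  thus ?thesis
    by (rule has_field_derivative_transform_within_open[of _ _ _ "{..<0}"]) (use less in auto)
next
  case equal
  have "((\<lambda>h. (flat_exp k h - flat_exp k 0) / (h - 0)) \<longlongrightarrow> 0) (at 0)"
    using flat_exp_tendsto_0[of "Suc k"]
    by (rule Lim_transform_eventually) (auto simp: eventually_at_filter flat_exp_def)
  thus ?thesis using equal by (simp add: has_field_derivative_iff)
qed

lemma continuous_on_flat_exp [continuous_intros]:
  "continuous_on S f \<Longrightarrow> continuous_on S (\<lambda>x. flat_exp k (f x))"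
  by (rule continuous_on_compose2[of UNIV "flat_exp k"])
     (auto intro: DERIV_continuous_on flat_exp_deriv has_field_derivative_at_within)

section \<open>The radial averages\<close>

text \<open>A radial function has \<open>\<Delta>\<phi>(\<rho>\<^sup>4) = |z|\<^sup>2 (16\<tau>\<phi>'' + 24\<phi>')\<close> at \<open>\<tau> = \<rho>\<^sup>4\<close>. The factor \<open>|z|\<^sup>2\<close> is common to all of
  them, so the kernels of the mean value formula have the form \<open>|z|\<^sup>2 g(\<rho>\<^sup>4)\<close>. With \<open>g = - G'\<close> the function
  whose sub-Laplacian is the radial change of the kernel is explicit, namely \<open>G(\<rho>\<^sup>4)\<close>.\<close>

definition Gprof :: "real \<Rightarrow> real" where "Gprof \<tau> = flat_exp 0 (1 - \<tau>)"
definition gprof :: "real \<Rightarrow> real" where "gprof \<tau> = flat_exp 2 (1 - \<tau>)"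
definition gprof' :: "real \<Rightarrow> real" where "gprof' \<tau> = 2 * flat_exp 3 (1 - \<tau>) - flat_exp 4 (1 - \<tau>)"

lemma prof_deriv:
  "(Gprof has_real_derivative - gprof \<tau>) (at \<tau>)" "(gprof has_real_derivative gprof' \<tau>) (at \<tau>)"
proof -
  have 1: "((\<lambda>t::real. 1 - t) has_real_derivative -1) (at \<tau>)" by (auto intro!: derivative_eq_intros)
  show "(Gprof has_real_derivative - gprof \<tau>) (at \<tau>)"
    using DERIV_chain2[OF flat_exp_deriv 1, of 0] by (simp add: Gprof_def[abs_def] gprof_def numeral_eq_Suc)
  show "(gprof has_real_derivative gprof' \<tau>) (at \<tau>)"
    using DERIV_chain2[OF flat_exp_deriv 1, of 2]
    by (simp add: gprof_def[abs_def] gprof'_def algebra_simps numeral_eq_Suc)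
qed

lemma prof_nonneg [simp]: "0 \<le> gprof \<tau>" "0 \<le> Gprof \<tau>" by (simp_all add: gprof_def Gprof_def)
lemma prof_eq_0: "1 \<le> \<tau> \<Longrightarrow> gprof \<tau> = 0" "1 \<le> \<tau> \<Longrightarrow> Gprof \<tau> = 0" "1 \<le> \<tau> \<Longrightarrow> gprof' \<tau> = 0"
  by (simp_all add: gprof_def Gprof_def gprof'_def)

lemma continuous_on_prof [continuous_intros]:
  "continuous_on S f \<Longrightarrow> continuous_on S (\<lambda>x. gprof (f x))"
  "continuous_on S f \<Longrightarrow> continuous_on S (\<lambda>x. Gprof (f x))"
  "continuous_on S f \<Longrightarrow> continuous_on S (\<lambda>x. gprof' (f x))"
  unfolding gprof_def Gprof_def gprof'_def by (intro continuous_intros; assumption)+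

definition wker :: "heis \<Rightarrow> real" where "wker p = zsq p * gprof (hquart p)"

definition wmass :: real where "wmass = (LINT p|lborel. wker p)"

text \<open>The kernel at radius \<open>R\<close>. The exponent is the homogeneous dimension \<open>4\<close> plus \<open>2\<close> for the factor
  \<open>|z|\<^sup>2\<close>, so that its mass does not depend on \<open>R\<close>.\<close>

definition kern :: "real \<Rightarrow> heis \<Rightarrow> real" where
  "kern R p = zsq p * gprof (hquart p / R ^ 4) / R ^ 6"

lemma hrho_less_iff: "0 < R \<Longrightarrow> hrho p < R \<longleftrightarrow> hquart p < R ^ 4"
  by (metis hrho_nonneg hrho_pow4 less_eq_real_def power_less_imp_less_base power_strict_mono zero_less_numeral)

lemma hquart_div_ge_1: "0 < R \<Longrightarrow> R \<le> hrho p \<Longrightarrow> 1 \<le> hquart p / R ^ 4"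
  using hrho_less_iff[of R p] by (auto simp: field_simps not_less)

lemma wker_nonneg [simp]: "0 \<le> wker p" by (simp add: wker_def)
lemma wker_eq_0: "1 \<le> hrho p \<Longrightarrow> wker p = 0"
  using hquart_div_ge_1[of 1 p] by (simp add: wker_def prof_eq_0)
lemma kern_eq_0: "0 < R \<Longrightarrow> R \<le> hrho p \<Longrightarrow> kern R p = 0"
  using hquart_div_ge_1[of R p] by (simp add: kern_def prof_eq_0)
lemma kern_nonneg [simp]: "0 \<le> kern R p" by (simp add: kern_def)

lemma continuous_on_wker [continuous_intros]:
  "continuous_on S f \<Longrightarrow> continuous_on S (\<lambda>x. wker (f x))"
  unfolding wker_def by (intro continuous_intros)

lemma borel_measurable_wker [measurable]: "wker \<in> borel_measurable borel"
  by (intro borel_measurable_continuous_onI continuous_intros)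

lemma continuous_on_kern [continuous_intros]:
  "continuous_on S f \<Longrightarrow> 0 < R \<Longrightarrow> continuous_on S (\<lambda>x. kern R (f x))"
  unfolding kern_def by (intro continuous_intros) auto

lemma kern_hdil: "0 < R \<Longrightarrow> R ^ 4 * kern R (hdil R p) = wker p"
  by (simp add: kern_def wker_def zsq_hdil hquart_hdil field_simps power2_eq_square eval_nat_numeral)

lemma integral_kern:
  fixes u :: "heis \<Rightarrow> real"
  assumes R: "0 < R" and m: "(\<lambda>p. u p * kern R p) \<in> borel_measurable borel"
  shows "(LINT p|lborel. u p * kern R p) = (LINT p|lborel. u (hdil R p) * wker p)"
proof -
  have "(LINT p|lborel. u p * kern R p) = (LINT p|lborel. u (hdil R p) * (R ^ 4 * kern R (hdil R p)))"
    unfolding integral_hdil[OF m R] integral_mult_right_zero[symmetric]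
    by (rule Bochner_Integration.integral_cong) (simp_all add: mult_ac)
  thus ?thesis by (simp add: kern_hdil[OF R])
qed

lemma not_in_hbox: "p \<notin> hbox R \<Longrightarrow> R < hrho p"
  using hrho_le_imp_hbox[of p R] by (meson not_le)

lemma integrable_wker: "integrable lborel wker"
  by (rule integrable_hbox(1)[of _ 1])
     (auto intro!: continuous_intros wker_eq_0 dest!: not_in_hbox simp del: split_paired_All)

lemma integral_pos_heis:
  fixes f :: "heis \<Rightarrow> real"
  assumes cont: "continuous_on UNIV f" and nn: "\<And>p. 0 \<le> f p" and zero: "\<And>p. R < hrho p \<Longrightarrow> f p = 0"
    and p0: "0 < f p0"
  shows "0 < (LINT p|lborel. f p)"
proof (rule ccontr)
  define S where "S = max 1 R"
  have z: "f p = 0" if "p \<notin> hbox S" for p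
    using not_in_hbox[OF that] by (intro zero) (simp add: S_def)
  note I = integrable_hbox[OF cont z]
  assume "\<not> 0 < (LINT p|lborel. f p)"
  moreover have "0 \<le> (LINT p|lborel. f p)" by (simp add: nn)
  ultimately have "integral (hbox S) f = 0" using I(2) by simp
  moreover have "f integrable_on hbox S" unfolding hbox_def
    by (rule integrable_continuous) (rule continuous_on_subset[OF cont], simp)
  ultimately have *: "(f has_integral 0) (hbox S)" by (simp add: has_integral_iff)
  have "p0 \<in> hbox S" by (rule ccontr) (use z[of p0] p0 in simp)
  moreover have "0 < S" by (simp add: S_def)
  hence "box (-S, -S, -(S\<^sup>2)) (S, S, S\<^sup>2) \<noteq> {}"
    by (auto simp: box_ne_empty Basis_prod_def)
  ultimately have "f p0 = 0"
    using has_integral_0_cbox_imp_0[of "(-S, -S, -(S\<^sup>2))" "(S, S, S\<^sup>2)" f p0] * nn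
      continuous_on_subset[OF cont] unfolding hbox_def by blast
  thus False using p0 by simp
qed

lemma wmass_pos: "0 < wmass"
  unfolding wmass_def
proof (rule integral_pos_heis[of _ 1 "(1/2, 0, 0)"])
  show "0 < wker (1/2, 0, 0)"
    by (simp add: wker_def zsq_def hquart_def gprof_def flat_exp_pos power2_eq_square)
qed (auto intro!: continuous_intros wker_eq_0)

subsection \<open>Derivatives of radial functions along the horizontal fields\<close>

definition e1 :: heis where "e1 = (1, 0, 0)"
definition e2 :: heis where "e2 = (0, 1, 0)"

lemma horizontal_e [simp]: "v \<in> {e1, e2} \<Longrightarrow> snd (snd v) = 0"
  by (auto simp: e1_def e2_def)

text \<open>The quartic \<open>\<rho>\<^sup>4\<close> with \<open>|z|\<^sup>2\<close> shifted by \<open>\<epsilon>\<close>, and its first two derivatives along a horizontal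
  direction. The shift removes the zero at the origin, which regularizes the fundamental solution below.\<close>

definition sreg :: "real \<Rightarrow> heis \<Rightarrow> real" where
  "sreg \<epsilon> p = (zsq p + \<epsilon>)\<^sup>2 + (snd (snd p))\<^sup>2"

definition dsreg :: "real \<Rightarrow> heis \<Rightarrow> heis \<Rightarrow> real" where
  "dsreg \<epsilon> v p = 4 * (zsq p + \<epsilon>) * (fst p * fst v + fst (snd p) * fst (snd v)) +
     4 * snd (snd p) * (fst v * fst (snd p) - fst (snd v) * fst p)"

definition ddsreg :: "real \<Rightarrow> heis \<Rightarrow> heis \<Rightarrow> real" where
  "ddsreg \<epsilon> v p = 8 * (fst p * fst v + fst (snd p) * fst (snd v))\<^sup>2 + 4 * (zsq p + \<epsilon>) * zsq v +
     8 * (fst v * fst (snd p) - fst (snd v) * fst p)\<^sup>2"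

lemma sreg_0: "sreg 0 = hquart"
  by (simp add: sreg_def hquart_def fun_eq_iff)

lemma sreg_hderiv:
  assumes "snd (snd v) = 0"
  shows "has_hderiv v (sreg \<epsilon>) (dsreg \<epsilon> v p) p" "has_hderiv v (dsreg \<epsilon> v) (ddsreg \<epsilon> v p) p"
  unfolding has_hderiv_def sreg_def dsreg_def ddsreg_def zsq_def hmult_eq using assms
  by (auto intro!: derivative_eq_intros simp: algebra_simps power2_eq_square)

lemma sum_ddsreg: "ddsreg \<epsilon> e1 p + ddsreg \<epsilon> e2 p = 24 * zsq p + 8 * \<epsilon>"
  by (simp add: ddsreg_def e1_def e2_def zsq_def algebra_simps power2_eq_square)

lemma sum_dsreg_sq: "(dsreg \<epsilon> e1 p)\<^sup>2 + (dsreg \<epsilon> e2 p)\<^sup>2 = 16 * zsq p * sreg \<epsilon> p"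
  by (simp add: dsreg_def e1_def e2_def sreg_def zsq_def algebra_simps power2_eq_square)

lemma continuous_on_sreg [continuous_intros]:
  "continuous_on S f \<Longrightarrow> continuous_on S (\<lambda>x. sreg \<epsilon> (f x))"
  unfolding sreg_def by (intro continuous_intros)

lemma continuous_on_dsreg [continuous_intros]:
  "continuous_on S f \<Longrightarrow> continuous_on S (\<lambda>x. dsreg \<epsilon> v (f x))"
  "continuous_on S f \<Longrightarrow> continuous_on S (\<lambda>x. ddsreg \<epsilon> v (f x))"
  unfolding dsreg_def ddsreg_def by (intro continuous_intros; assumption)+

definition Psi :: "real \<Rightarrow> heis \<Rightarrow> real" where "Psi R p = Gprof (hquart p / R ^ 4)"
definition Psi1 :: "real \<Rightarrow> heis \<Rightarrow> heis \<Rightarrow> real" where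
  "Psi1 R v p = - gprof (hquart p / R ^ 4) * (dsreg 0 v p / R ^ 4)"
definition Psi2 :: "real \<Rightarrow> heis \<Rightarrow> heis \<Rightarrow> real" where
  "Psi2 R v p = - (gprof' (hquart p / R ^ 4) * (dsreg 0 v p / R ^ 4)\<^sup>2 + gprof (hquart p / R ^ 4) * (ddsreg 0 v p / R ^ 4))"

lemma Psi_hderiv:
  assumes v: "snd (snd v) = 0"
  shows "has_hderiv v (Psi R) (Psi1 R v p) p" "has_hderiv v (Psi1 R v) (Psi2 R v p) p"
proof -
  note q = sreg_hderiv[OF v, of 0 p, unfolded sreg_0 has_hderiv_def]
  have chain: "((\<lambda>h. f (hquart (hmult p (h *\<^sub>R v)) / R ^ 4)) has_real_derivative
      d * (dsreg 0 v p / R ^ 4)) (at 0)"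
    if "(f has_real_derivative d) (at (hquart p / R ^ 4))" for f d
    using DERIV_chain2[of f d "\<lambda>h. hquart (hmult p (h *\<^sub>R v)) / R ^ 4" 0, OF _ DERIV_cdivide[OF q(1)]] that
    by simp
  show 1: "has_hderiv v (Psi R) (Psi1 R v p) p"
    unfolding has_hderiv_def Psi_def Psi1_def by (rule chain[OF prof_deriv(1)])
  have "has_hderiv v (\<lambda>p. gprof (hquart p / R ^ 4)) (gprof' (hquart p / R ^ 4) * (dsreg 0 v p / R ^ 4)) p"
    unfolding has_hderiv_def by (rule chain[OF prof_deriv(2)])
  moreover have "has_hderiv v (\<lambda>p. - (dsreg 0 v p / R ^ 4)) (- (ddsreg 0 v p / R ^ 4)) p"
    unfolding has_hderiv_def by (rule DERIV_minus, rule DERIV_cdivide, rule q(2))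
  ultimately have "has_hderiv v (\<lambda>p. gprof (hquart p / R ^ 4) * - (dsreg 0 v p / R ^ 4))
     (gprof' (hquart p / R ^ 4) * (dsreg 0 v p / R ^ 4) * - (dsreg 0 v p / R ^ 4) +
      gprof (hquart p / R ^ 4) * - (ddsreg 0 v p / R ^ 4)) p"
    by (rule has_hderiv_mult)
  thus "has_hderiv v (Psi1 R v) (Psi2 R v p) p"
    by (simp add: Psi1_def[abs_def] Psi2_def power2_eq_square algebra_simps)
qed

lemma Psi_eq_0:
  assumes "0 < R" "R \<le> hrho p"
  shows "Psi R p = 0" "Psi1 R v p = 0" "Psi2 R v p = 0"
  using hquart_div_ge_1[OF assms] by (simp_all add: Psi_def Psi1_def Psi2_def prof_eq_0)

lemma Psi_nonneg [simp]: "0 \<le> Psi R p" by (simp add: Psi_def)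

lemma continuous_on_Psi [continuous_intros]:
  "continuous_on S f \<Longrightarrow> 0 < R \<Longrightarrow> continuous_on S (\<lambda>x. Psi R (f x))"
  "continuous_on S f \<Longrightarrow> 0 < R \<Longrightarrow> continuous_on S (\<lambda>x. Psi1 R v (f x))"
  "continuous_on S f \<Longrightarrow> 0 < R \<Longrightarrow> continuous_on S (\<lambda>x. Psi2 R v (f x))"
  unfolding Psi_def Psi1_def Psi2_def by (intro continuous_intros; simp)+

definition dkern :: "real \<Rightarrow> heis \<Rightarrow> real" where
  "dkern R p = - zsq p * (6 * gprof (hquart p / R ^ 4) / R ^ 7 + 4 * hquart p * gprof' (hquart p / R ^ 4) / R ^ 11)"

lemma kern_deriv:
  assumes "0 < R"
  shows "((\<lambda>R. kern R p) has_real_derivative dkern R p) (at R)"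
proof -
  have "((\<lambda>R. hquart p / R ^ 4) has_real_derivative - 4 * hquart p / R ^ 5) (at R)"
    using assms by (auto intro!: derivative_eq_intros simp: field_simps eval_nat_numeral)
  note 1 = DERIV_chain2[OF prof_deriv(2) this]
  have "((\<lambda>R. inverse (R ^ 6)) has_real_derivative - 6 / R ^ 7) (at R)"
    using assms by (auto intro!: derivative_eq_intros simp: field_simps eval_nat_numeral)
  note 2 = DERIV_cmult[OF DERIV_mult[OF 1 this], of "zsq p"]
  have eq: "(\<lambda>R. kern R p) = (\<lambda>R. zsq p * (gprof (hquart p / R ^ 4) * inverse (R ^ 6)))"
    by (simp add: kern_def divide_inverse mult.assoc)
  show ?thesis
    unfolding eq by (rule DERIV_cong[OF 2], unfold dkern_def)
      (use assms in \<open>simp add: field_simps eval_nat_numeral\<close>)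
qed

text \<open>The radial change of the kernel is the sub-Laplacian of a compactly supported function. This
  identity is the source of all mean value statements.\<close>

lemma dkern_eq: "0 < R \<Longrightarrow> 4 * R ^ 3 * dkern R p = Psi2 R e1 p + Psi2 R e2 p"
proof -
  assume R: "0 < R"
  define g g' where "g = gprof (hquart p / R ^ 4)" and "g' = gprof' (hquart p / R ^ 4)"
  have "Psi2 R e1 p + Psi2 R e2 p = - (g' * ((dsreg 0 e1 p)\<^sup>2 + (dsreg 0 e2 p)\<^sup>2) / R ^ 8 + g * (ddsreg 0 e1 p + ddsreg 0 e2 p) / R ^ 4)"
    unfolding Psi2_def g_def[symmetric] g'_def[symmetric] using R
    by (simp add: field_simps eval_nat_numeral)
  also have "\<dots> = 4 * R ^ 3 * dkern R p"
    unfolding sum_ddsreg sum_dsreg_sq sreg_0 dkern_def g_def[symmetric] g'_def[symmetric] using R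
    by (simp add: field_simps eval_nat_numeral)
  finally show ?thesis by simp
qed

section \<open>Mean value inequalities\<close>

text \<open>Twice continuously differentiable in the horizontal directions only, with the derivatives as data.
  This is all that Green's formula and the maximum principle use, and it is stable under translation.\<close>

definition horiz_C2 :: "heis set \<Rightarrow> (heis \<Rightarrow> real) \<Rightarrow> (heis \<Rightarrow> heis \<Rightarrow> real) \<Rightarrow> (heis \<Rightarrow> heis \<Rightarrow> real) \<Rightarrow> bool" where
  "horiz_C2 U u u1 u2 \<longleftrightarrow> open U \<and> continuous_on U u \<and> (\<forall>v\<in>{e1, e2}.
     continuous_on U (u1 v) \<and> continuous_on U (u2 v) \<and>
     (\<forall>p\<in>U. has_hderiv v u (u1 v p) p \<and> has_hderiv v (u1 v) (u2 v p) p))"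

lemma continuous_on_extend_0:
  fixes f :: "'a::topological_space \<Rightarrow> 'b::real_normed_vector"
  assumes "open U" "closed C" "C \<subseteq> U" "continuous_on U f" "\<And>p. p \<notin> C \<Longrightarrow> f p = 0"
  shows "continuous_on UNIV f"
proof -
  have "continuous_on (- C) f"
    by (rule continuous_on_eq[of _ "\<lambda>_. 0"]) (use assms in auto)
  hence "continuous_on (U \<union> - C) f"
    using assms by (intro continuous_on_open_Un) auto
  moreover have "U \<union> - C = UNIV" using assms(3) by auto
  ultimately show ?thesis by simp
qed

lemma closed_hrho_le: "closed {p. hrho p \<le> R}"
  by (intro closed_Collect_le continuous_intros)

lemma continuous_on_cutoff:
  fixes f w :: "heis \<Rightarrow> real"
  assumes "open U" "{p. hrho p \<le> R} \<subseteq> U" "continuous_on U f" "continuous_on UNIV w"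
    "\<And>p. R \<le> hrho p \<Longrightarrow> w p = 0"
  shows "continuous_on UNIV (\<lambda>p. f p * w p)"
proof (rule continuous_on_extend_0[OF assms(1) closed_hrho_le assms(2)])
  show "continuous_on U (\<lambda>p. f p * w p)"
    by (intro continuous_intros assms continuous_on_subset[OF assms(4)]) simp
  show "f p * w p = 0" if "p \<notin> {p. hrho p \<le> R}" for p
    using that assms(5)[of p] by simp
qed

lemma integrable_cutoff:
  fixes f w :: "heis \<Rightarrow> real"
  assumes "open U" "{p. hrho p \<le> R} \<subseteq> U" "continuous_on U f" "continuous_on UNIV w"
    "\<And>p. R \<le> hrho p \<Longrightarrow> w p = 0"
  shows "integrable lborel (\<lambda>p. f p * w p)"
    "integral (hbox R) (\<lambda>p. f p * w p) = (LINT p|lborel. f p * w p)"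
proof -
  have "f p * w p = 0" if "p \<notin> hbox R" for p
    using not_in_hbox[OF that] assms(5)[of p] by simp
  from integrable_hbox[OF continuous_on_cutoff[OF assms] this]
  show "integrable lborel (\<lambda>p. f p * w p)"
    "integral (hbox R) (\<lambda>p. f p * w p) = (LINT p|lborel. f p * w p)" by auto
qed

lemma has_hderiv_0_open: "open U \<Longrightarrow> p \<in> U \<Longrightarrow> (\<And>q. q \<in> U \<Longrightarrow> u q = 0) \<Longrightarrow> has_hderiv v u 0 p"
  using has_hderiv_cong_open[of U p u "\<lambda>_. 0" v 0] by (simp add: has_hderiv_def)

lemma has_hderiv_diff:
  "has_hderiv v u d p \<Longrightarrow> has_hderiv v w e p \<Longrightarrow> has_hderiv v (\<lambda>p. u p - w p) (d - e) p"
  unfolding has_hderiv_def by (rule DERIV_diff)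

text \<open>The function \<open>u \<cdot> v\<Psi> - \<Psi> \<cdot> v u\<close> vanishes off the ball, so the integral of its derivative along \<open>v\<close> is \<open>0\<close>.\<close>

lemma green_radial:
  assumes u: "horiz_C2 U u u1 u2" and R: "0 < R" "{p. hrho p \<le> R} \<subseteq> U"
  shows "(LINT p|lborel. u p * (Psi2 R e1 p + Psi2 R e2 p)) =
    (LINT p|lborel. (u2 e1 p + u2 e2 p) * Psi R p)"
proof -
  note U = u[unfolded horiz_C2_def, THEN conjunct1]
  have cw: "continuous_on UNIV (Psi R)" "continuous_on UNIV (Psi1 R v)" "continuous_on UNIV (Psi2 R v)" for v
    using continuous_on_Psi[OF continuous_on_id[of UNIV] R(1)] by simp_all
  note int = integrable_cutoff(1)[OF U R(2)] and cont = continuous_on_cutoff[OF U R(2)]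
  have "integrable lborel (\<lambda>p. u p * Psi2 R v p) \<and> integrable lborel (\<lambda>p. u2 v p * Psi R p) \<and>
      (LINT p|lborel. u p * Psi2 R v p) = (LINT p|lborel. u2 v p * Psi R p)" if v: "v \<in> {e1, e2}" for v
  proof -
    have c: "continuous_on U u" "continuous_on U (u1 v)" "continuous_on U (u2 v)"
      and d: "\<And>p. p \<in> U \<Longrightarrow> has_hderiv v u (u1 v p) p" "\<And>p. p \<in> U \<Longrightarrow> has_hderiv v (u1 v) (u2 v p) p"
      using u v unfolding horiz_C2_def by blast+
    have hv: "snd (snd v) = 0" by (rule horizontal_e[OF v])
    note i = int[OF c(1) cw(3) Psi_eq_0(3)[OF R(1)], of v] int[OF c(3) cw(1) Psi_eq_0(1)[OF R(1)]]
    have "(LINT p|lborel. u p * Psi2 R v p - u2 v p * Psi R p) = 0"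
    proof (rule integral_hderiv_eq_0[OF hv, of "\<lambda>p. u p * Psi1 R v p - u1 v p * Psi R p" _ R])
      show "continuous_on UNIV (\<lambda>p. u p * Psi1 R v p - u1 v p * Psi R p)"
        "continuous_on UNIV (\<lambda>p. u p * Psi2 R v p - u2 v p * Psi R p)"
        by (intro continuous_on_diff cont c cw Psi_eq_0 R; simp)+
      show "has_hderiv v (\<lambda>p. u p * Psi1 R v p - u1 v p * Psi R p) (u p * Psi2 R v p - u2 v p * Psi R p) p" for p
      proof (cases "p \<in> U")
        case True
        have "has_hderiv v (\<lambda>p. u p * Psi1 R v p) (u1 v p * Psi1 R v p + u p * Psi2 R v p) p"
          by (rule has_hderiv_mult[OF d(1)[OF True] Psi_hderiv(2)[OF hv]])
        moreover have "has_hderiv v (\<lambda>p. u1 v p * Psi R p) (u2 v p * Psi R p + u1 v p * Psi1 R v p) p"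
          by (rule has_hderiv_mult[OF d(2)[OF True] Psi_hderiv(1)[OF hv]])
        ultimately have "has_hderiv v (\<lambda>p. u p * Psi1 R v p - u1 v p * Psi R p)
            (u1 v p * Psi1 R v p + u p * Psi2 R v p - (u2 v p * Psi R p + u1 v p * Psi1 R v p)) p"
          by (rule has_hderiv_diff)
        thus ?thesis by (simp add: algebra_simps)
      next
        case False
        hence "R < hrho p" using R(2) by force
        moreover have "open {p. R < hrho p}" by (intro open_Collect_less continuous_intros)
        ultimately have "has_hderiv v (\<lambda>p. u p * Psi1 R v p - u1 v p * Psi R p) 0 p"
          by (intro has_hderiv_0_open[of "{p. R < hrho p}"]) (simp_all add: Psi_eq_0 R)
        thus ?thesis using \<open>R < hrho p\<close> by (simp add: Psi_eq_0 R)
      qed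
    qed (simp_all add: Psi_eq_0 R)
    thus ?thesis using i by simp
  qed
  from this[of e1] this[of e2] show ?thesis by (simp add: algebra_simps)
qed

text \<open>Differentiating the kernel in \<open>R\<close> and applying Green's formula to its sub-Laplacian form.\<close>

lemma mean_deriv:
  assumes u: "horiz_C2 U u u1 u2" and R: "0 < R" "R < R0" "{p. hrho p \<le> R0} \<subseteq> U"
  shows "((\<lambda>R. LINT p|lborel. u p * kern R p) has_real_derivative
    (LINT p|lborel. (u2 e1 p + u2 e2 p) * Psi R p) / (4 * R ^ 3)) (at R)"
proof -
  note U = u[unfolded horiz_C2_def, THEN conjunct1]
  have cu: "continuous_on U u" using u by (simp add: horiz_C2_def)
  define V where "V = {0<..<R0}"
  have V: "0 < r" "{p. hrho p \<le> r} \<subseteq> U" if "r \<in> V" for r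
    using that order_trans[OF _ R(3), of "{p. hrho p \<le> r}"] by (force simp: V_def)+
  have box: "integral (hbox R0) (\<lambda>p. u p * w p) = (LINT p|lborel. u p * w p)"
    if "r \<in> V" "continuous_on UNIV w" "\<And>p. r \<le> hrho p \<Longrightarrow> w p = 0" for r w
    by (rule integrable_cutoff(2)[OF U R(3) cu that(2)]) (use that in \<open>auto simp: V_def\<close>)
  have dk0: "dkern r p = 0" if "0 < r" "r \<le> hrho p" for r p
    using hquart_div_ge_1[OF that] by (simp add: dkern_def prof_eq_0)
  have cdk: "continuous_on S (\<lambda>p. dkern r p)" if "0 < r" for r S
    unfolding dkern_def using that by (intro continuous_intros) auto
  have "((\<lambda>r. integral (cbox (-R0, -R0, -(R0\<^sup>2)) (R0, R0, R0\<^sup>2)) (\<lambda>p. u p * kern r p)) has_field_derivative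
      integral (cbox (-R0, -R0, -(R0\<^sup>2)) (R0, R0, R0\<^sup>2)) (\<lambda>p. u p * dkern R p)) (at R within V)"
  proof (rule leibniz_rule_field_derivative)
    show "((\<lambda>r. u p * kern r p) has_real_derivative u p * dkern r p) (at r within V)" if "r \<in> V" for r p
      by (rule has_field_derivative_at_within, rule DERIV_cmult, rule kern_deriv, rule V[OF that])
    show "(\<lambda>p. u p * kern r p) integrable_on cbox (-R0, -R0, -(R0\<^sup>2)) (R0, R0, R0\<^sup>2)" if "r \<in> V" for r
      by (rule integrable_continuous, rule continuous_on_subset[OF continuous_on_cutoff[OF U V(2)[OF that] cu]])
         (use V[OF that] in \<open>auto intro!: continuous_intros kern_eq_0\<close>)
    \<comment> \<open>Where \<open>u\<close> is not known to be continuous the kernel vanishes: \<open>\<rho>(p) > r\<close> there.\<close>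
    have "continuous_on (V \<times> UNIV) (\<lambda>(r, p). u p * dkern r p)"
    proof -
      have "continuous_on (V \<times> U) (\<lambda>x. u (snd x))"
        by (rule continuous_on_compose2[OF cu continuous_on_snd[OF continuous_on_id]]) auto
      moreover have "continuous_on (V \<times> U) (\<lambda>x. dkern (fst x) (snd x))"
        unfolding dkern_def by (intro continuous_intros) (auto simp: V_def)
      ultimately have "continuous_on (V \<times> U) (\<lambda>(r, p). u p * dkern r p)"
        unfolding case_prod_beta by (rule continuous_on_mult)
      moreover have "continuous_on {x. fst x \<in> V \<and> fst x < hrho (snd x)} (\<lambda>(r, p). u p * dkern r p)"
        by (rule continuous_on_eq[of _ "\<lambda>_. 0"]) (use dk0 V(1) in \<open>auto simp del: split_paired_All\<close>)
      moreover have "open (V \<times> U)" using U by (auto simp: V_def intro: open_Times)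
      moreover have "open {x::real \<times> heis. fst x \<in> V \<and> fst x < hrho (snd x)}"
      proof -
        have "open {x::real \<times> heis. 0 < fst x \<and> fst x < R0 \<and> fst x < hrho (snd x)}"
          by (intro open_Collect_conj open_Collect_less continuous_intros)
        thus ?thesis by (simp add: V_def conj_assoc)
      qed
      ultimately have "continuous_on (V \<times> U \<union> {x. fst x \<in> V \<and> fst x < hrho (snd x)}) (\<lambda>(r, p). u p * dkern r p)"
        by (intro continuous_on_open_Un)
      moreover have "V \<times> UNIV \<subseteq> V \<times> U \<union> {x. fst x \<in> V \<and> fst x < hrho (snd x)}"
      proof
        fix x :: "real \<times> heis" assume x: "x \<in> V \<times> UNIV"
        show "x \<in> V \<times> U \<union> {x. fst x \<in> V \<and> fst x < hrho (snd x)}"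
          using V(2)[of "fst x"] x by (cases "hrho (snd x) \<le> fst x") (auto simp: mem_Times_iff subset_iff simp del: split_paired_All)
      qed
      ultimately show ?thesis by (rule continuous_on_subset)
    qed
    thus "continuous_on (V \<times> cbox (-R0, -R0, -(R0\<^sup>2)) (R0, R0, R0\<^sup>2)) (\<lambda>(r, p). u p * dkern r p)"
      by (rule continuous_on_subset) auto
  qed (use R in \<open>auto simp: V_def\<close>)
  moreover have "at R within V = at R" by (rule at_within_open) (use R in \<open>auto simp: V_def\<close>)
  ultimately have "((\<lambda>r. integral (hbox R0) (\<lambda>p. u p * kern r p)) has_field_derivative
      integral (hbox R0) (\<lambda>p. u p * dkern R p)) (at R)"
    by (simp flip: hbox_def)
  moreover have "integral (hbox R0) (\<lambda>p. u p * dkern R p) = (LINT p|lborel. u p * dkern R p)"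
    by (rule box[of R]) (use R cdk dk0 in \<open>auto simp: V_def\<close>)
  ultimately have "((\<lambda>r. integral (hbox R0) (\<lambda>p. u p * kern r p)) has_field_derivative
      (LINT p|lborel. u p * dkern R p)) (at R)" by simp
  hence "((\<lambda>r. LINT p|lborel. u p * kern r p) has_field_derivative
      (LINT p|lborel. u p * dkern R p)) (at R)"
  proof (rule has_field_derivative_transform_within_open[of _ _ _ V])
    show "integral (hbox R0) (\<lambda>p. u p * kern r p) = (LINT p|lborel. u p * kern r p)" if "r \<in> V" for r
      by (rule box[OF that]) (use V[OF that] in \<open>auto intro!: continuous_intros kern_eq_0\<close>)
  qed (use R in \<open>auto simp: V_def\<close>)
  moreover have "(LINT p|lborel. u p * dkern R p) =
      (LINT p|lborel. (u2 e1 p + u2 e2 p) * Psi R p) / (4 * R ^ 3)"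
  proof -
    have "(LINT p|lborel. u p * dkern R p) = (LINT p|lborel. u p * (Psi2 R e1 p + Psi2 R e2 p) / (4 * R ^ 3))"
      by (rule Bochner_Integration.integral_cong) (use R in \<open>simp_all add: dkern_eq[symmetric]\<close>)
    also have "\<dots> = (LINT p|lborel. (u2 e1 p + u2 e2 p) * Psi R p) / (4 * R ^ 3)"
      using green_radial[OF u R(1) V(2)] R by (simp add: V_def)
    finally show ?thesis .
  qed
  ultimately show ?thesis by simp
qed

lemma hdist_zero [simp]: "hdist 0 p = hrho p"
  using hdist_hmult[of 0 p] by simp

lemma integral_kern_1: "0 < R \<Longrightarrow> (LINT p|lborel. kern R p) = wmass"
  using integral_kern[of R "\<lambda>_. 1"] borel_measurable_continuous_onI[of "kern R"]
    continuous_on_kern[OF continuous_on_id, of R UNIV] by (simp add: wmass_def)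

lemma integrable_kern: "0 < R \<Longrightarrow> integrable lborel (kern R)"
  using integrable_cutoff(1)[of UNIV R "\<lambda>_. 1" "kern R"]
    continuous_on_kern[OF continuous_on_id, of R UNIV] kern_eq_0[of R] by auto

lemma mean_limit:
  assumes "open U" "0 \<in> U" "continuous_on U u"
  shows "((\<lambda>R. LINT p|lborel. u p * kern R p) \<longlongrightarrow> u 0 * wmass) (at_right 0)"
proof (rule tendstoI)
  fix e :: real assume e: "0 < e"
  define d where "d = e / (2 * wmass)"
  have d: "0 < d" using e wmass_pos by (simp add: d_def)
  have "open (U \<inter> u -` ball (u 0) d)"
    by (rule continuous_open_preimage[OF assms(3,1)]) simp
  then obtain \<delta> where \<delta>: "0 < \<delta>" "{q. hdist 0 q \<le> \<delta>} \<subseteq> U \<inter> u -` ball (u 0) d"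
    using open_contains_hcball[of "U \<inter> u -` ball (u 0) d" 0] d assms(2) by auto
  have *: "dist (LINT p|lborel. u p * kern R p) (u 0 * wmass) < e" if R: "0 < R" "R < \<delta>" for R
  proof -
    have in_ball: "p \<in> U \<inter> u -` ball (u 0) d" if "hrho p \<le> R" for p
    proof (rule subsetD[OF \<delta>(2)])
      show "p \<in> {q. hdist 0 q \<le> \<delta>}" using R that by simp
    qed
    have sub: "{p. hrho p \<le> R} \<subseteq> U" using in_ball by blast
    have near: "\<bar>u p - u 0\<bar> \<le> d" if "hrho p \<le> R" for p
      using in_ball[OF that] by (simp add: dist_real_def abs_minus_commute)
    have ck: "continuous_on UNIV (kern R)" using continuous_on_kern[OF continuous_on_id, of R UNIV] R by simp
    have int: "integrable lborel (\<lambda>p. u p * kern R p)"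
      by (rule integrable_cutoff(1)[OF assms(1) sub assms(3) ck]) (use R kern_eq_0 in auto)
    have "(LINT p|lborel. u p * kern R p) - u 0 * wmass = (LINT p|lborel. (u p - u 0) * kern R p)"
      using int integrable_kern[OF R(1)] integral_kern_1[OF R(1)] by (simp add: algebra_simps)
    also have "\<bar>\<dots>\<bar> \<le> (LINT p|lborel. \<bar>(u p - u 0) * kern R p\<bar>)" by (rule integral_abs_bound)
    also have "\<dots> \<le> (LINT p|lborel. d * kern R p)"
    proof (rule integral_mono)
      show "integrable lborel (\<lambda>p. \<bar>(u p - u 0) * kern R p\<bar>)"
        using int integrable_kern[OF R(1)] by (auto simp: left_diff_distrib)
      show "\<bar>(u p - u 0) * kern R p\<bar> \<le> d * kern R p" for p
        using near[of p] kern_eq_0[OF R(1), of p] kern_nonneg[of R p]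
        by (cases "hrho p \<le> R") (auto simp: abs_mult intro!: mult_right_mono)
    qed (use integrable_kern[OF R(1)] in auto)
    also have "\<dots> = d * wmass" using integral_kern_1[OF R(1)] by simp
    also have "\<dots> < e" using e wmass_pos by (simp add: d_def)
    finally show ?thesis by (simp add: dist_real_def)
  qed
  show "\<forall>\<^sub>F R in at_right 0. dist (LINT p|lborel. u p * kern R p) (u 0 * wmass) < e"
    unfolding eventually_at_right_field using * \<delta>(1) by blast
qed

lemma mean_le:
  assumes u: "horiz_C2 U u u1 u2" and R: "0 < R" "R < R0" "{p. hrho p \<le> R0} \<subseteq> U"
    and super: "\<And>p. hrho p \<le> R0 \<Longrightarrow> u2 e1 p + u2 e2 p \<le> 0"
  shows "(LINT p|lborel. u p * kern R p) \<le> u 0 * wmass"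
proof -
  define \<phi> where "\<phi> R = (LINT p|lborel. u p * kern R p)" for R
  have mono: "\<phi> R \<le> \<phi> r" if "0 < r" "r < R" for r
  proof (rule DERIV_nonpos_imp_nonincreasing[OF less_imp_le[OF that(2)]])
    fix s assume s: "r \<le> s" "s \<le> R"
    have "(LINT p|lborel. (u2 e1 p + u2 e2 p) * Psi s p) \<le> 0"
    proof -
      have "0 \<le> (LINT p|lborel. - ((u2 e1 p + u2 e2 p) * Psi s p))"
      proof (rule Bochner_Integration.integral_nonneg)
        show "0 \<le> - ((u2 e1 p + u2 e2 p) * Psi s p)" for p
          using super[of p] Psi_eq_0(1)[of s p] Psi_nonneg[of s p] s that R
          by (cases "hrho p \<le> s") (auto simp: mult_nonpos_nonneg)
      qed
      thus ?thesis by simp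
    qed
    hence "(LINT p|lborel. (u2 e1 p + u2 e2 p) * Psi s p) / (4 * s ^ 3) \<le> 0"
      using s that by (intro divide_nonpos_nonneg) auto
    moreover have "(\<phi> has_real_derivative (LINT p|lborel. (u2 e1 p + u2 e2 p) * Psi s p) / (4 * s ^ 3)) (at s)"
      unfolding \<phi>_def by (rule mean_deriv[OF u _ _ R(3)]) (use s that R in auto)
    ultimately show "\<exists>y. (\<phi> has_real_derivative y) (at s) \<and> y \<le> 0" by blast
  qed
  have "0 \<in> {p. hrho p \<le> R0}" using R by simp
  hence "(\<phi> \<longlongrightarrow> u 0 * wmass) (at_right 0)"
    unfolding \<phi>_def using u R(3) by (intro mean_limit[of U]) (auto simp: horiz_C2_def)
  moreover have "\<forall>\<^sub>F r in at_right 0. \<phi> R \<le> \<phi> r"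
    unfolding eventually_at_right_field using mono R by blast
  ultimately have "\<phi> R \<le> u 0 * wmass"
    by (intro tendsto_lowerbound) auto
  thus ?thesis by (simp add: \<phi>_def)
qed

lemma horiz_C2_minus:
  assumes "horiz_C2 U u u1 u2"
  shows "horiz_C2 U (\<lambda>p. - u p) (\<lambda>v p. - u1 v p) (\<lambda>v p. - u2 v p)"
  using assms unfolding horiz_C2_def has_hderiv_def
  by (auto intro!: continuous_on_minus derivative_intros simp del: split_paired_All)

lemma mean_eq:
  assumes u: "horiz_C2 U u u1 u2" and R: "0 < R" "R < R0" "{p. hrho p \<le> R0} \<subseteq> U"
    and harm: "\<And>p. hrho p \<le> R0 \<Longrightarrow> u2 e1 p + u2 e2 p = 0"
  shows "(LINT p|lborel. u p * kern R p) = u 0 * wmass"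
  using mean_le[OF u R] mean_le[OF horiz_C2_minus[OF u] R] harm by fastforce

text \<open>A nonzero sub-Laplacian at the center has a constant sign on a small ball, where the averages would then
  be strictly monotone in the radius.\<close>

lemma mean_imp_harmonic:
  assumes u: "horiz_C2 U u u1 u2" and R0: "0 < R0" "{p. hrho p \<le> R0} \<subseteq> U"
    and mvp: "\<And>R. 0 < R \<Longrightarrow> R < R0 \<Longrightarrow> (LINT p|lborel. u p * kern R p) = c"
  shows "u2 e1 0 + u2 e2 0 = 0"
proof -
  have main: "\<not> 0 < w2 e1 0 + w2 e2 0" if w: "horiz_C2 U w w1 w2"
    and mw: "\<And>R. 0 < R \<Longrightarrow> R < R0 \<Longrightarrow> (LINT p|lborel. w p * kern R p) = c" for w w1 w2 c
  proof
    define L where "L p = w2 e1 p + w2 e2 p" for p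
    assume pos: "0 < w2 e1 0 + w2 e2 0"
    have U: "open U" and cL: "continuous_on U L"
      using w unfolding horiz_C2_def L_def[abs_def] by (auto intro!: continuous_on_add)
    have "open (U \<inter> L -` {L 0 / 2<..})" by (rule continuous_open_preimage[OF cL U]) simp
    moreover have "0 \<in> U \<inter> L -` {L 0 / 2<..}" using pos R0 by (auto simp: L_def)
    ultimately obtain \<delta> where \<delta>: "0 < \<delta>" "{q. hdist 0 q \<le> \<delta>} \<subseteq> U \<inter> L -` {L 0 / 2<..}"
      using open_contains_hcball by blast
    define R where "R = min \<delta> (R0 / 2)"
    have R: "0 < R" "R < R0" "R \<le> \<delta>" using \<delta>(1) R0 by (auto simp: R_def)
    have sub: "{p. hrho p \<le> R} \<subseteq> U"
      using R(2) by (intro order_trans[OF _ R0(2)] Collect_mono) auto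
    have Lp: "L 0 / 2 \<le> L p" if "hrho p \<le> R" for p
    proof -
      have "p \<in> {q. hdist 0 q \<le> \<delta>}" using R that by simp
      from subsetD[OF \<delta>(2) this] show ?thesis by simp
    qed
    have cP: "continuous_on UNIV (Psi R)" using continuous_on_Psi(1)[OF continuous_on_id R(1), of UNIV] by simp
    have "((\<lambda>R. LINT p|lborel. w p * kern R p) has_real_derivative (LINT p|lborel. L p * Psi R p) / (4 * R ^ 3)) (at R)"
      unfolding L_def by (rule mean_deriv[OF w R(1,2) R0(2)])
    hence "((\<lambda>R. c) has_real_derivative (LINT p|lborel. L p * Psi R p) / (4 * R ^ 3)) (at R)"
      by (rule has_field_derivative_transform_within_open[of _ _ _ "{0<..<R0}"]) (use R mw in auto)
    hence "(LINT p|lborel. L p * Psi R p) / (4 * R ^ 3) = 0" using DERIV_unique DERIV_const by blast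
    hence "(LINT p|lborel. L p * Psi R p) = 0" using R by simp
    moreover have "(LINT p|lborel. (L 0 / 2) * Psi R p) \<le> (LINT p|lborel. L p * Psi R p)"
    proof (rule integral_mono)
      show "integrable lborel (\<lambda>p. (L 0 / 2) * Psi R p)"
        using integrable_cutoff(1)[of UNIV R "\<lambda>_. L 0 / 2" "Psi R"] cP Psi_eq_0(1)[OF R(1)] by auto
      show "integrable lborel (\<lambda>p. L p * Psi R p)"
        by (rule integrable_cutoff(1)[OF U sub cL cP Psi_eq_0(1)[OF R(1)]])
      show "(L 0 / 2) * Psi R p \<le> L p * Psi R p" for p
      proof (cases "hrho p \<le> R")
        case True
        show ?thesis by (rule mult_right_mono[OF Lp[OF True] Psi_nonneg])
      qed (simp add: Psi_eq_0(1)[OF R(1)])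
    qed
    moreover have "0 < (LINT p|lborel. (L 0 / 2) * Psi R p)"
    proof (rule integral_pos_heis[of _ R 0])
      have "hquart 0 = 0" by (simp add: hquart_eq_0)
      thus "0 < L 0 / 2 * Psi R 0"
        using pos by (simp add: L_def Psi_def Gprof_def flat_exp_pos)
      show "0 \<le> L 0 / 2 * Psi R p" for p using pos by (simp add: L_def)
      show "continuous_on UNIV (\<lambda>p. L 0 / 2 * Psi R p)"
        by (rule continuous_on_mult[OF continuous_on_const cP])
    qed (simp add: Psi_eq_0(1)[OF R(1)])
    ultimately show False by linarith
  qed
  have "\<not> 0 < u2 e1 0 + u2 e2 0" by (rule main[OF u mvp])
  moreover have "\<not> 0 < - u2 e1 0 + - u2 e2 0"
    by (rule main[OF horiz_C2_minus[OF u], of "- c"]) (simp add: mvp)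
  ultimately show ?thesis by linarith
qed

section \<open>Averages of the fundamental solution\<close>

text \<open>A smooth regularization of the fundamental solution. Its sub-Laplacian \<open>-4\<epsilon>s\<^sup>-\<^sup>3\<^sup>/\<^sup>2\<close> is negative for
  \<open>\<epsilon> > 0\<close>, and \<open>\<epsilon> = 0\<close> gives harmonicity off the pole, so one computation serves both purposes.\<close>

definition Nreg :: "real \<Rightarrow> heis \<Rightarrow> real" where "Nreg \<epsilon> p = 1 / sqrt (sreg \<epsilon> p)"
definition Nreg1 :: "real \<Rightarrow> heis \<Rightarrow> heis \<Rightarrow> real" where
  "Nreg1 \<epsilon> v p = - dsreg \<epsilon> v p / (2 * sreg \<epsilon> p * sqrt (sreg \<epsilon> p))"
definition Nreg2 :: "real \<Rightarrow> heis \<Rightarrow> heis \<Rightarrow> real" where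
  "Nreg2 \<epsilon> v p = 3 * (dsreg \<epsilon> v p)\<^sup>2 / (4 * (sreg \<epsilon> p)\<^sup>2 * sqrt (sreg \<epsilon> p)) -
     ddsreg \<epsilon> v p / (2 * sreg \<epsilon> p * sqrt (sreg \<epsilon> p))"

lemma Nreg_hderiv:
  assumes v: "snd (snd v) = 0" and s: "0 < sreg \<epsilon> p"
  shows "has_hderiv v (Nreg \<epsilon>) (Nreg1 \<epsilon> v p) p" "has_hderiv v (Nreg1 \<epsilon> v) (Nreg2 \<epsilon> v p) p"
proof -
  define S D where "S h = sreg \<epsilon> (hmult p (h *\<^sub>R v))" and "D h = dsreg \<epsilon> v (hmult p (h *\<^sub>R v))" for h
  have S: "(S has_real_derivative dsreg \<epsilon> v p) (at 0)" and D: "(D has_real_derivative ddsreg \<epsilon> v p) (at 0)"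
    using sreg_hderiv[OF v, of \<epsilon> p] unfolding has_hderiv_def S_def D_def by auto
  have S0: "S 0 = sreg \<epsilon> p" "0 < S 0" "D 0 = dsreg \<epsilon> v p" using s by (simp_all add: S_def D_def)
  have sq: "sqrt (sreg \<epsilon> p) * sqrt (sreg \<epsilon> p) = sreg \<epsilon> p" "sqrt (sreg \<epsilon> p) > 0"
    using s by simp_all
  define r where "r = sqrt (sreg \<epsilon> p)"
  have r: "sreg \<epsilon> p = r * r" "r > 0" using sq by (simp_all add: r_def)
  have "((\<lambda>h. 1 / sqrt (S h)) has_real_derivative - dsreg \<epsilon> v p / (2 * r * r * r)) (at 0)"
    using S0 r by (auto intro!: derivative_eq_intros S simp: field_simps r_def[symmetric])
  thus "has_hderiv v (Nreg \<epsilon>) (Nreg1 \<epsilon> v p) p"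
    unfolding has_hderiv_def Nreg_def Nreg1_def S_def r_def[symmetric] by (simp add: r(1) mult.assoc)
  have "((\<lambda>h. - D h / (2 * S h * sqrt (S h))) has_real_derivative
     3 * (dsreg \<epsilon> v p)\<^sup>2 / (4 * (r*r)\<^sup>2 * r) - ddsreg \<epsilon> v p / (2 * (r * r) * r)) (at 0)"
    using S0 r by (auto intro!: derivative_eq_intros S D simp: field_simps r_def[symmetric] power2_eq_square)
  thus "has_hderiv v (Nreg1 \<epsilon> v) (Nreg2 \<epsilon> v p) p"
    unfolding has_hderiv_def Nreg1_def Nreg2_def S_def D_def r_def[symmetric] by (simp add: r(1))
qed

lemma Nreg_laplace:
  assumes s: "0 < sreg \<epsilon> p"
  shows "Nreg2 \<epsilon> e1 p + Nreg2 \<epsilon> e2 p = - 4 * \<epsilon> / (sreg \<epsilon> p * sqrt (sreg \<epsilon> p))"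
proof -
  define S r where "S = sreg \<epsilon> p" and "r = sqrt S"
  have r: "0 < S" "0 < r" using s by (simp_all add: S_def r_def)
  have "Nreg2 \<epsilon> e1 p + Nreg2 \<epsilon> e2 p = 3 * ((dsreg \<epsilon> e1 p)\<^sup>2 + (dsreg \<epsilon> e2 p)\<^sup>2) / (4 * S\<^sup>2 * r) -
     (ddsreg \<epsilon> e1 p + ddsreg \<epsilon> e2 p) / (2 * S * r)"
    by (simp add: Nreg2_def S_def r_def add_divide_distrib distrib_left)
  also have "\<dots> = - 4 * \<epsilon> / (S * r)"
    unfolding sum_dsreg_sq sum_ddsreg S_def[symmetric] using r by (simp add: field_simps power2_eq_square)
  finally show ?thesis by (simp add: S_def r_def)
qed

lemma borel_measurable_sreg [measurable]: "sreg \<epsilon> \<in> borel_measurable borel"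
  by (intro borel_measurable_continuous_onI continuous_intros)

lemma Nreg_horiz_C2: "horiz_C2 {p. 0 < sreg \<epsilon> p} (Nreg \<epsilon>) (Nreg1 \<epsilon>) (Nreg2 \<epsilon>)"
proof -
  have "continuous_on {p. 0 < sreg \<epsilon> p} (Nreg \<epsilon>)" "continuous_on {p. 0 < sreg \<epsilon> p} (Nreg1 \<epsilon> v)"
     "continuous_on {p. 0 < sreg \<epsilon> p} (Nreg2 \<epsilon> v)" for v
    unfolding Nreg_def Nreg1_def Nreg2_def
    by (intro continuous_intros; force)+
  moreover have "open {p. 0 < sreg \<epsilon> p}" by (intro open_Collect_less continuous_intros)
  ultimately show ?thesis using Nreg_hderiv horizontal_e unfolding horiz_C2_def by blast
qed

lemma horiz_C2_left:
  assumes "horiz_C2 U u u1 u2"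
  shows "horiz_C2 (hmult \<zeta> -` U) (\<lambda>p. u (hmult \<zeta> p)) (\<lambda>v p. u1 v (hmult \<zeta> p)) (\<lambda>v p. u2 v (hmult \<zeta> p))"
proof -
  have c: "continuous_on (hmult \<zeta> -` U) (\<lambda>p. f (hmult \<zeta> p))" if "continuous_on U f" for f :: "heis \<Rightarrow> real"
    by (rule continuous_on_compose2[OF that, of _ "hmult \<zeta>"]) (auto intro!: continuous_intros)
  have "open (hmult \<zeta> -` U)"
    using assms by (intro open_vimage continuous_intros) (simp add: horiz_C2_def)
  thus ?thesis using assms unfolding horiz_C2_def has_hderiv_left by (auto intro!: c simp del: split_paired_All)
qed

lemma sreg_pos: "0 < \<epsilon> \<Longrightarrow> 0 < sreg \<epsilon> p"
proof -
  assume "0 < \<epsilon>"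
  hence "0 < zsq p + \<epsilon>" using zsq_nonneg[of p] by linarith
  hence "0 < (zsq p + \<epsilon>)\<^sup>2" by (rule zero_less_power)
  thus ?thesis unfolding sreg_def by (rule add_pos_nonneg) simp
qed

lemma sreg_0_pos: "p \<noteq> 0 \<Longrightarrow> 0 < sreg 0 p"
  unfolding sreg_0 using hquart_eq_0 hquart_nonneg by (metis order_le_less)

lemma hmult_nonzero: "hrho p < hrho \<zeta> \<Longrightarrow> hmult \<zeta> p \<noteq> 0"
  by (metis hmult_hinv_cancel(1) hmult_zero(2) hrho_hinv less_irrefl)

lemma Nreg_mean_le:
  assumes "0 < \<epsilon>" "0 < R"
  shows "(LINT p|lborel. Nreg \<epsilon> (hmult \<zeta> p) * kern R p) \<le> Nreg \<epsilon> \<zeta> * wmass"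
proof -
  have "(LINT p|lborel. Nreg \<epsilon> (hmult \<zeta> p) * kern R p) \<le> Nreg \<epsilon> (hmult \<zeta> 0) * wmass"
  proof (rule mean_le[OF horiz_C2_left[OF Nreg_horiz_C2], of R "R + 1"])
    show "Nreg2 \<epsilon> e1 (hmult \<zeta> p) + Nreg2 \<epsilon> e2 (hmult \<zeta> p) \<le> 0" for p
      unfolding Nreg_laplace[OF sreg_pos[OF assms(1)]]
      using assms(1) sreg_pos[OF assms(1), of "hmult \<zeta> p"] by (intro divide_nonpos_nonneg) auto
  qed (use assms sreg_pos in auto)
  thus ?thesis by simp
qed

lemma Nreg_0_mean_eq:
  assumes "0 < R" "R < hrho \<zeta>"
  shows "(LINT p|lborel. Nreg 0 (hmult \<zeta> p) * kern R p) = Nreg 0 \<zeta> * wmass"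
proof -
  define R0 where "R0 = (R + hrho \<zeta>) / 2"
  have pos: "0 < sreg 0 (hmult \<zeta> p)" if "hrho p \<le> R0" for p
    by (rule sreg_0_pos[OF hmult_nonzero]) (use that assms in \<open>simp add: R0_def\<close>)
  have "(LINT p|lborel. Nreg 0 (hmult \<zeta> p) * kern R p) = Nreg 0 (hmult \<zeta> 0) * wmass"
    by (rule mean_eq[OF horiz_C2_left[OF Nreg_horiz_C2], of R R0])
       (use assms pos in \<open>auto simp: Nreg_laplace R0_def\<close>)
  thus ?thesis by simp
qed

subsection \<open>The averaging operator on extended nonnegative functions\<close>

text \<open>Averages of functions with values in \<^typ>\<open>ennreal\<close>: the fundamental solution can be infinite at its
  pole, as superharmonicity requires, and integrals can be interchanged freely. Radius \<open>0\<close> gives the value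
  at the point, so that no case distinction is needed at the boundary.\<close>

definition avg :: "real \<Rightarrow> (heis \<Rightarrow> ennreal) \<Rightarrow> heis \<Rightarrow> ennreal" where
  "avg R f \<zeta> = (\<integral>\<^sup>+p. f (hmult \<zeta> (hdil R p)) * ennreal (wker p / wmass) \<partial>lborel)"

definition hN :: "heis \<Rightarrow> ennreal" where "hN p = inverse (ennreal ((hrho p)\<^sup>2))"

lemma borel_measurable_hN [measurable]: "hN \<in> borel_measurable borel"
  unfolding hN_def[abs_def] by measurable

lemma hN_real: "p \<noteq> 0 \<Longrightarrow> hN p = ennreal (1 / (hrho p)\<^sup>2)"
  unfolding hN_def by (subst inverse_ennreal) (auto simp: hrho_pos inverse_eq_divide)

lemma hN_hinv [simp]: "hN (hinv p) = hN p" by (simp add: hN_def)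

lemma Nreg_0: "Nreg 0 p = 1 / (hrho p)\<^sup>2"
  by (simp add: Nreg_def sreg_0 hrho_sq)

lemma measurable_hmult_hdil [measurable]: "(\<lambda>p. hmult \<zeta> (hdil R p)) \<in> borel_measurable borel"
  by (intro borel_measurable_continuous_onI continuous_intros)

lemma nn_integral_weight: "(\<integral>\<^sup>+p. ennreal (wker p / wmass) \<partial>lborel) = 1"
proof -
  have "(\<integral>\<^sup>+p. ennreal (wker p / wmass) \<partial>lborel) = ennreal (LINT p|lborel. wker p / wmass)"
    using wmass_pos integrable_wker by (intro nn_integral_eq_integral) auto
  thus ?thesis using wmass_pos integrable_wker by (simp flip: wmass_def)
qed

lemma avg_mono: "(\<And>p. hrho p < 1 \<Longrightarrow> f (hmult \<zeta> (hdil R p)) \<le> g (hmult \<zeta> (hdil R p))) \<Longrightarrow> avg R f \<zeta> \<le> avg R g \<zeta>"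
  unfolding avg_def
proof (rule nn_integral_mono)
  fix p assume *: "\<And>p. hrho p < 1 \<Longrightarrow> f (hmult \<zeta> (hdil R p)) \<le> g (hmult \<zeta> (hdil R p))"
  show "f (hmult \<zeta> (hdil R p)) * ennreal (wker p / wmass) \<le> g (hmult \<zeta> (hdil R p)) * ennreal (wker p / wmass)"
    using *[of p] wker_eq_0[of p] by (cases "hrho p < 1") (auto intro: mult_right_mono)
qed

lemma avg_cong: "(\<And>p. hrho p < 1 \<Longrightarrow> f (hmult \<zeta> (hdil R p)) = g (hmult \<zeta> (hdil R p))) \<Longrightarrow> avg R f \<zeta> = avg R g \<zeta>"
  by (intro antisym avg_mono) auto

lemma avg_const: "avg R (\<lambda>_. c) \<zeta> = c"
  unfolding avg_def by (subst nn_integral_cmult) (auto simp: nn_integral_weight)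

lemma avg_0: "avg 0 f \<zeta> = f \<zeta>"
  using avg_const[of 0 "f \<zeta>" \<zeta>] by (simp add: avg_def)

lemma avg_add:
  assumes [measurable]: "f \<in> borel_measurable borel" "g \<in> borel_measurable borel"
  shows "avg R (\<lambda>p. f p + g p) \<zeta> = avg R f \<zeta> + avg R g \<zeta>"
  unfolding avg_def distrib_right by (rule nn_integral_add) measurable

lemma avg_cmult:
  assumes [measurable]: "f \<in> borel_measurable borel"
  shows "avg R (\<lambda>p. c * f p) \<zeta> = c * avg R f \<zeta>"
  unfolding avg_def mult.assoc by (rule nn_integral_cmult) measurable

lemma avg_left: "avg R (\<lambda>p. f (hmult a p)) \<zeta> = avg R f (hmult a \<zeta>)"
  by (simp add: avg_def hmult_assoc)

lemma avg_kern:
  assumes [measurable]: "f \<in> borel_measurable borel" and R: "0 < R"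
  shows "avg R f \<zeta> = (\<integral>\<^sup>+p. f (hmult \<zeta> p) * ennreal (kern R p / wmass) \<partial>lborel)"
proof -
  have [measurable]: "kern R \<in> borel_measurable borel"
    using R by (intro borel_measurable_continuous_onI continuous_intros)
  have "(\<integral>\<^sup>+p. f (hmult \<zeta> p) * ennreal (kern R p / wmass) \<partial>lborel) = ennreal (R ^ 4) *
     (\<integral>\<^sup>+p. f (hmult \<zeta> (hdil R p)) * ennreal (kern R (hdil R p) / wmass) \<partial>lborel)"
    by (rule nn_integral_hdil[OF _ R]) measurable
  also have "\<dots> = (\<integral>\<^sup>+p. ennreal (R ^ 4) * (f (hmult \<zeta> (hdil R p)) * ennreal (kern R (hdil R p) / wmass)) \<partial>lborel)"
    by (rule nn_integral_cmult[symmetric]) measurable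
  also have "\<dots> = avg R f \<zeta>"
    unfolding avg_def
  proof (rule nn_integral_cong)
    fix p
    have "ennreal (wker p / wmass) = ennreal (R ^ 4) * ennreal (kern R (hdil R p) / wmass)"
      using R wmass_pos by (simp add: ennreal_mult[symmetric] kern_hdil[OF R, symmetric])
    thus "ennreal (R ^ 4) * (f (hmult \<zeta> (hdil R p)) * ennreal (kern R (hdil R p) / wmass)) =
      f (hmult \<zeta> (hdil R p)) * ennreal (wker p / wmass)" by (simp add: mult_ac)
  qed
  finally show ?thesis by simp
qed

lemma avg_real:
  assumes "open U" "{p. hrho p \<le> R} \<subseteq> hmult \<zeta> -` U" "continuous_on U u" "0 < R" "\<And>p. 0 \<le> u p"
    "u \<in> borel_measurable borel"
  shows "avg R (\<lambda>p. ennreal (u p)) \<zeta> = ennreal ((LINT p|lborel. u (hmult \<zeta> p) * kern R p) / wmass)"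
proof -
  have ck: "continuous_on UNIV (kern R)" using continuous_on_kern[OF continuous_on_id, of R UNIV] assms by simp
  have "open (hmult \<zeta> -` U)" using assms(1) by (intro open_vimage continuous_intros)
  moreover have "continuous_on (hmult \<zeta> -` U) (\<lambda>p. u (hmult \<zeta> p))"
    by (rule continuous_on_compose2[OF assms(3), of _ "hmult \<zeta>"]) (auto intro!: continuous_intros)
  ultimately have int: "integrable lborel (\<lambda>p. u (hmult \<zeta> p) * kern R p)"
    by (intro integrable_cutoff(1)[OF _ assms(2) _ ck kern_eq_0[OF assms(4)]])
  have "avg R (\<lambda>p. ennreal (u p)) \<zeta> = (\<integral>\<^sup>+p. ennreal (u (hmult \<zeta> p) * kern R p / wmass) \<partial>lborel)"
    using assms wmass_pos by (subst avg_kern) (auto simp: ennreal_mult[symmetric])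
  also have "\<dots> = ennreal (LINT p|lborel. u (hmult \<zeta> p) * kern R p / wmass)"
    using assms wmass_pos int by (intro nn_integral_eq_integral) auto
  finally show ?thesis by simp
qed

lemma avg_Nreg_le:
  assumes "0 < \<epsilon>" "0 < R"
  shows "avg R (\<lambda>p. ennreal (Nreg \<epsilon> p)) \<zeta> \<le> ennreal (Nreg \<epsilon> \<zeta>)"
proof -
  have c: "continuous_on UNIV (Nreg \<epsilon>)"
    using Nreg_horiz_C2[of \<epsilon>] sreg_pos[OF assms(1)] by (simp add: horiz_C2_def)
  have "avg R (\<lambda>p. ennreal (Nreg \<epsilon> p)) \<zeta> = ennreal ((LINT p|lborel. Nreg \<epsilon> (hmult \<zeta> p) * kern R p) / wmass)"
    by (rule avg_real[OF open_UNIV]) (use c assms sreg_pos in \<open>auto simp: Nreg_def[of \<epsilon>] less_imp_le borel_measurable_continuous_onI\<close>)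
  thus ?thesis using Nreg_mean_le[OF assms, of \<zeta>] wmass_pos by (simp add: ennreal_leI field_simps)
qed

lemma Nreg_tendsto: "((\<lambda>n. ennreal (Nreg (1 / real (Suc n)) p)) \<longlongrightarrow> hN p) sequentially"
proof -
  have s: "(\<lambda>n. sqrt (sreg (1 / real (Suc n)) p)) \<longlonglongrightarrow> (hrho p)\<^sup>2"
  proof -
    have "(\<lambda>n. sqrt (sreg (1 / real (Suc n)) p)) \<longlonglongrightarrow> sqrt (sreg 0 p)"
      unfolding sreg_def by (intro tendsto_intros LIMSEQ_Suc lim_1_over_n)
    thus ?thesis by (simp add: sreg_0 hrho_sq)
  qed
  have "(\<lambda>n. inverse (ennreal (sqrt (sreg (1 / real (Suc n)) p)))) \<longlonglongrightarrow> inverse (ennreal ((hrho p)\<^sup>2))"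
    by (rule continuous_on_tendsto_compose[of UNIV inverse, OF continuous_on_inverse_ennreal[OF continuous_on_id]])
       (auto intro: tendsto_ennrealI[OF s] simp del: of_nat_Suc)
  thus ?thesis unfolding hN_def Nreg_def
    by (subst (asm) inverse_ennreal) (auto simp: sreg_pos inverse_eq_divide)
qed

text \<open>Fatou's lemma for the regularizations, whose averages decrease.\<close>

lemma avg_hN_le: "0 \<le> R \<Longrightarrow> avg R hN \<zeta> \<le> hN \<zeta>"
proof -
  assume "0 \<le> R"
  show ?thesis
  proof (cases "R = 0")
    case True thus ?thesis by (simp add: avg_0)
  next
    case False
    with \<open>0 \<le> R\<close> have R: "0 < R" by simp
    define F where "F n p = ennreal (Nreg (1 / real (Suc n)) p)" for n p
    have [measurable]: "F n \<in> borel_measurable borel" for n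
      unfolding F_def[abs_def] Nreg_def by measurable
    have lim: "liminf (\<lambda>n. F n p) = hN p" for p
      using Nreg_tendsto[of p] unfolding F_def by (intro lim_imp_Liminf) auto
    have "avg R hN \<zeta> \<le> (\<integral>\<^sup>+p. liminf (\<lambda>n. F n (hmult \<zeta> (hdil R p)) * ennreal (wker p / wmass)) \<partial>lborel)"
      unfolding avg_def
    proof (rule nn_integral_mono)
      fix p
      have "(\<lambda>n. F n (hmult \<zeta> (hdil R p)) * ennreal (wker p / wmass)) \<longlonglongrightarrow>
          hN (hmult \<zeta> (hdil R p)) * ennreal (wker p / wmass)" if "wker p \<noteq> 0"
        using Nreg_tendsto[of "hmult \<zeta> (hdil R p)"] that wmass_pos wker_nonneg[of p] unfolding F_def
        by (intro tendsto_mult_ennreal) (auto simp: less_le)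
      hence "liminf (\<lambda>n. F n (hmult \<zeta> (hdil R p)) * ennreal (wker p / wmass)) =
          hN (hmult \<zeta> (hdil R p)) * ennreal (wker p / wmass)"
        by (cases "wker p = 0") (auto intro!: lim_imp_Liminf simp: Liminf_const)
      thus "hN (hmult \<zeta> (hdil R p)) * ennreal (wker p / wmass) \<le>
        liminf (\<lambda>n. F n (hmult \<zeta> (hdil R p)) * ennreal (wker p / wmass))" by simp
    qed
    also have "\<dots> \<le> liminf (\<lambda>n. \<integral>\<^sup>+p. F n (hmult \<zeta> (hdil R p)) * ennreal (wker p / wmass) \<partial>lborel)"
      by (rule nn_integral_liminf) measurable
    also have "\<dots> \<le> liminf (\<lambda>n. F n \<zeta>)"
      using avg_Nreg_le[OF _ R] unfolding F_def avg_def by (intro Liminf_mono) auto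
    finally show ?thesis by (simp add: lim)
  qed
qed

lemma avg_hN_eq:
  assumes "0 \<le> R" "R < hrho \<zeta>"
  shows "avg R hN \<zeta> = hN \<zeta>"
proof (cases "R = 0")
  case False
  with assms have R: "0 < R" by simp
  have sub: "{p. hrho p \<le> R} \<subseteq> hmult \<zeta> -` {p. 0 < sreg 0 p}"
    using sreg_0_pos[OF hmult_nonzero] assms(2) by (simp add: subset_iff del: split_paired_All)
  have m: "Nreg 0 \<in> borel_measurable borel" unfolding Nreg_0[abs_def] by measurable
  have z: "\<zeta> \<noteq> 0" using assms by auto
  have "avg R hN \<zeta> = avg R (\<lambda>p. ennreal (Nreg 0 p)) \<zeta>"
    unfolding avg_kern[OF borel_measurable_hN R] avg_kern[OF measurable_compose[OF m measurable_ennreal] R]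
  proof (rule nn_integral_cong)
    fix p show "hN (hmult \<zeta> p) * ennreal (kern R p / wmass) = ennreal (Nreg 0 (hmult \<zeta> p)) * ennreal (kern R p / wmass)"
    proof (cases "hrho p < R")
      case True
      hence "hmult \<zeta> p \<noteq> 0" using assms(2) by (intro hmult_nonzero) simp
      thus ?thesis by (simp add: hN_real Nreg_0)
    qed (simp add: kern_eq_0 R)
  qed
  also have "\<dots> = ennreal ((LINT p|lborel. Nreg 0 (hmult \<zeta> p) * kern R p) / wmass)"
    using Nreg_horiz_C2[of 0] m
    by (intro avg_real[OF _ sub]) (auto simp: horiz_C2_def R Nreg_0)
  also have "\<dots> = hN \<zeta>"
    unfolding Nreg_0_mean_eq[OF R assms(2)] using wmass_pos z by (simp add: hN_real Nreg_0)
  finally show ?thesis .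
qed (simp add: avg_0)

subsection \<open>A uniform bound for the averages\<close>

lemma emeasure_hrho_less:
  assumes "0 < R"
  shows "emeasure lborel {p. hrho p < R} = ennreal (R ^ 4) * emeasure lborel {p. hrho p < 1}"
proof -
  have m: "{p. hrho p < r} \<in> sets borel" for r by measurable
  have "emeasure lborel {p. hrho p < R} = ennreal (R ^ 4) * (\<integral>\<^sup>+p. indicator {p. hrho p < R} (hdil R p) \<partial>lborel)"
    using nn_integral_hdil[of "indicator {p. hrho p < R}" R] assms m by simp
  also have "(\<integral>\<^sup>+p. indicator {p. hrho p < R} (hdil R p) \<partial>lborel) = (\<integral>\<^sup>+p. indicator {p. hrho p < 1} p \<partial>lborel)"
    by (rule nn_integral_cong) (use assms in \<open>auto simp: indicator_def hrho_hdil\<close>)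
  finally show ?thesis using m by simp
qed

lemma emeasure_hrho_less_finite: "emeasure lborel {p. hrho p < 1} < \<infinity>"
proof -
  have "emeasure lborel {p. hrho p < 1} \<le> emeasure lborel (hbox 1)"
  proof (rule emeasure_mono)
    show "{p. hrho p < 1} \<subseteq> hbox 1" using hrho_le_imp_hbox less_imp_le by blast
  qed (simp add: hbox_def)
  also have "\<dots> < \<infinity>" unfolding hbox_def by (rule emeasure_lborel_cbox_finite)
  finally show ?thesis .
qed

text \<open>On the shell \<open>2\<^sup>-\<^sup>k\<^sup>-\<^sup>1 \<le> \<rho> < 2\<^sup>-\<^sup>k\<close> the function \<open>\<rho>\<^sup>-\<^sup>2\<close> is at most \<open>4\<^sup>k\<^sup>+\<^sup>1\<close>, while the volume is at most a
  constant times \<open>16\<^sup>-\<^sup>k\<close>.\<close>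

lemma nn_integral_hN_ball: "(\<integral>\<^sup>+p. hN p * indicator {p. hrho p < 1} p \<partial>lborel) < \<infinity>"
proof -
  define v where "v = emeasure lborel {p. hrho p < 1}"
  have m: "{p. hrho p < r} \<in> sets borel" for r by measurable
  define B where "B k = {p. hrho p < (1/2) ^ k}" for k :: nat
  have Bm [measurable]: "B k \<in> sets borel" for k unfolding B_def by (rule m)
  have pw: "hN p * indicator {p. hrho p < 1} p \<le> (\<Sum>k. ennreal (4 ^ (k + 1)) * indicator (B k) p)" if p: "p \<noteq> 0" for p
  proof (cases "hrho p < 1")
    case True
    have pos: "0 < hrho p" by (rule hrho_pos[OF p])
    then obtain n where "(1/2) ^ n < hrho p" using real_arch_pow_inv[of "hrho p" "1/2"] by auto
    hence ex: "\<exists>n. (1/2) ^ n \<le> hrho p" by (auto intro: less_imp_le)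
    define n where "n = (LEAST n. (1/2) ^ n \<le> hrho p)"
    have n: "(1/2) ^ n \<le> hrho p" unfolding n_def by (rule LeastI_ex[OF ex])
    have "n \<noteq> 0" using n True by (cases n) auto
    then obtain k where k: "n = Suc k" by (cases n) auto
    have "\<not> (1/2) ^ k \<le> hrho p" using not_less_Least[of k "\<lambda>n. (1/2) ^ n \<le> hrho p"] k unfolding n_def by simp
    hence inB: "p \<in> B k" by (simp add: B_def)
    have "((1/2) ^ n)\<^sup>2 \<le> (hrho p)\<^sup>2" using n by (intro power_mono) auto
    moreover have "((1/2::real) ^ n)\<^sup>2 = 1 / 4 ^ n" by (simp add: power_divide flip: power_mult power_mult_distrib) (simp add: power_mult mult.commute[of n])
    ultimately have "1 / 4 ^ n \<le> (hrho p)\<^sup>2" by simp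
    hence "1 / (hrho p)\<^sup>2 \<le> 4 ^ n" using pos by (simp add: divide_le_eq mult.commute)
    hence "hN p \<le> ennreal (4 ^ (k + 1)) * indicator (B k) p"
      using p inB k by (simp add: hN_real ennreal_leI)
    also have "\<dots> \<le> (\<Sum>k. ennreal (4 ^ (k + 1)) * indicator (B k) p)"
    proof -
      have "f k \<le> suminf f" for f :: "nat \<Rightarrow> ennreal"
        using sum_le_suminf[of f "{k}"] by (simp add: summableI)
      from this[of "\<lambda>k. ennreal (4 ^ (k + 1)) * indicator (B k) p"] show ?thesis .
    qed
    finally show ?thesis using True by simp
  qed simp
  have "(\<integral>\<^sup>+p. hN p * indicator {p. hrho p < 1} p \<partial>lborel) \<le>
      (\<integral>\<^sup>+p. (\<Sum>k. ennreal (4 ^ (k + 1)) * indicator (B k) p) \<partial>lborel)"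
    by (rule nn_integral_mono_AE) (use pw in \<open>auto intro: eventually_mono[OF AE_lborel_singleton[of 0]] simp del: split_paired_All\<close>)
  also have "\<dots> = (\<Sum>k. \<integral>\<^sup>+p. ennreal (4 ^ (k + 1)) * indicator (B k) p \<partial>lborel)"
    by (rule nn_integral_suminf) measurable
  also have "\<dots> = (\<Sum>k. ennreal (4 * (1/4) ^ k) * v)"
  proof (rule arg_cong[where f = suminf], rule ext)
    fix k :: nat
    have "(\<integral>\<^sup>+p. ennreal (4 ^ (k + 1)) * indicator (B k) p \<partial>lborel) = ennreal (4 ^ (k + 1)) * emeasure lborel (B k)"
      by (subst nn_integral_cmult) auto
    also have "\<dots> = ennreal (4 ^ (k + 1)) * (ennreal (((1/2) ^ k) ^ 4) * v)"
      unfolding B_def v_def by (subst emeasure_hrho_less) auto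
    also have "\<dots> = ennreal (4 ^ (k + 1) * ((1/2) ^ k) ^ 4) * v"
      by (simp add: ennreal_mult mult.assoc)
    also have "4 ^ (k + 1) * ((1/2) ^ k) ^ 4 = 4 * (1/4::real) ^ k"
    proof -
      have "((1/2::real) ^ k) ^ 4 = (1/16) ^ k" by (simp add: power_divide flip: power_mult) (simp add: power_mult mult.commute[of k])
      thus ?thesis by (simp flip: power_mult_distrib)
    qed
    finally show "(\<integral>\<^sup>+p. ennreal (4 ^ (k + 1)) * indicator (B k) p \<partial>lborel) = ennreal (4 * (1/4) ^ k) * v" .
  qed
  also have "\<dots> = (\<Sum>k. ennreal (4 * (1/4) ^ k)) * v" by simp
  also have "\<dots> < \<infinity>"
  proof -
    have "summable (\<lambda>k. 4 * (1/4::real) ^ k)" by (intro summable_mult summable_geometric) simp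
    hence "(\<Sum>k. ennreal (4 * (1/4) ^ k)) \<noteq> top" by (simp add: ennreal_suminf_neq_top)
    thus ?thesis using emeasure_hrho_less_finite unfolding v_def
      by (simp add: ennreal_mult_less_top less_top)
  qed
  finally show ?thesis .
qed

lemma wker_bound: "wker p \<le> 2"
proof (cases "hrho p < 1")
  case True
  have z: "zsq p \<le> 1" using zsq_le_hrho[of p] True power_le_one[of "hrho p" 2] by simp
  define x where "x = 1 - hquart p"
  have x: "0 < x" "x \<le> 1" using hrho_less_iff[of 1 p] True by (simp_all add: x_def)
  have "0 \<le> 1 / x" using x by simp
  hence "(1 / x)\<^sup>2 / 2 \<le> exp (1 / x)" using exp_lower_Taylor_quadratic[of "1 / x"] by linarith
  hence "flat_exp 2 x \<le> 2" using x by (simp add: flat_exp_def exp_minus field_simps)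
  hence "wker p \<le> 1 * 2" unfolding wker_def gprof_def x_def[symmetric]
    using z by (intro mult_mono) auto
  thus ?thesis by simp
qed (simp add: wker_eq_0)

text \<open>By homogeneity the radius may be taken to be \<open>1\<close>. Then the part of the integral near the pole is at
  most an integral of \<open>\<rho>\<^sup>-\<^sup>2\<close> over the unit ball, wherever the pole is, and elsewhere \<open>\<rho>\<^sup>-\<^sup>2 \<le> 1\<close>.\<close>

lemma avg_hN_bound: "\<exists>C. \<forall>R \<zeta>. 0 < R \<longrightarrow> avg R hN \<zeta> \<le> ennreal (C / R\<^sup>2)"
proof -
  define I where "I = (\<integral>\<^sup>+p. hN p * indicator {p. hrho p < 1} p \<partial>lborel)"
  define W where "W = 2 / wmass"
  define C where "C = enn2real (ennreal W * I + 1)"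
  have W: "0 \<le> W" using wmass_pos by (simp add: W_def)
  have fin: "ennreal W * I + 1 < \<infinity>"
    using nn_integral_hN_ball unfolding I_def by (simp add: ennreal_mult_less_top less_top)
  hence C: "ennreal W * I + 1 = ennreal C" by (simp add: C_def)
  have one: "avg 1 hN \<zeta> \<le> ennreal C" for \<zeta>
  proof -
    have "avg 1 hN \<zeta> \<le> (\<integral>\<^sup>+p. ennreal W * (hN (hmult \<zeta> p) * indicator {p. hrho p < 1} (hmult \<zeta> p)) +
        ennreal (wker p / wmass) \<partial>lborel)"
      unfolding avg_def
    proof (rule nn_integral_mono)
      fix p
      define q where "q = hmult \<zeta> (hdil 1 p)"
      have le: "ennreal (wker p / wmass) \<le> ennreal W"
        unfolding W_def by (intro ennreal_leI divide_right_mono wker_bound) (use wmass_pos in simp)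
      have "hN q * ennreal (wker p / wmass) \<le> ennreal W * (hN q * indicator {p. hrho p < 1} q) + ennreal (wker p / wmass)"
      proof (cases "hrho q < 1")
        case True
        have "hN q * ennreal (wker p / wmass) \<le> hN q * ennreal W" by (rule mult_left_mono[OF le]) simp
        thus ?thesis using True by (simp add: mult.commute add_increasing2)
      next
        case False
        hence "q \<noteq> 0" by auto
        moreover have "1 / (hrho q)\<^sup>2 \<le> 1"
          using one_le_power[of "hrho q" 2] False by (simp add: divide_le_eq)
        ultimately have "hN q \<le> 1" by (simp add: hN_real)
        hence "hN q * ennreal (wker p / wmass) \<le> 1 * ennreal (wker p / wmass)" by (rule mult_right_mono) simp
        thus ?thesis using False by simp
      qed
      thus "hN (hmult \<zeta> (hdil 1 p)) * ennreal (wker p / wmass) \<le> ennreal W * (hN (hmult \<zeta> p) * indicator {p. hrho p < 1} (hmult \<zeta> p)) +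
        ennreal (wker p / wmass)" by (simp add: q_def)
    qed
    also have "\<dots> = ennreal W * (\<integral>\<^sup>+p. hN (hmult \<zeta> p) * indicator {p. hrho p < 1} (hmult \<zeta> p) \<partial>lborel) + 1"
      by (subst nn_integral_add, measurable, subst nn_integral_cmult, measurable) (simp add: nn_integral_weight)
    also have "(\<integral>\<^sup>+p. hN (hmult \<zeta> p) * indicator {p. hrho p < 1} (hmult \<zeta> p) \<partial>lborel) = I"
      unfolding I_def by (rule nn_integral_hmult_left[of "\<lambda>p. hN p * indicator {p. hrho p < 1} p"]) measurable
    finally show ?thesis using C by simp
  qed
  have "avg R hN \<zeta> \<le> ennreal (C / R\<^sup>2)" if R: "0 < R" for R \<zeta>
  proof -
    define \<zeta>' where "\<zeta>' = hdil (1 / R) \<zeta>"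
    have z: "\<zeta> = hdil R \<zeta>'" using R by (simp add: \<zeta>'_def hdil_hdil)
    have sc: "hN (hdil R q) = ennreal (1 / R\<^sup>2) * hN q" for q
    proof (cases "q = 0")
      case True thus ?thesis using R by (simp add: hN_def ennreal_mult_top)
    next
      case False
      hence "hdil R q \<noteq> 0" using R hrho_hdil[of R q] hrho_pos[of q] by (metis abs_of_pos hrho_0 mult_pos_pos less_irrefl)
      thus ?thesis using False R by (simp add: hN_real hrho_hdil ennreal_mult[symmetric] power_mult_distrib)
    qed
    have "avg R hN \<zeta> = ennreal (1 / R\<^sup>2) * avg 1 hN \<zeta>'"
      unfolding avg_def z hdil_hmult[symmetric] sc mult.assoc hdil_1 by (rule nn_integral_cmult) measurable
    also have "\<dots> \<le> ennreal (1 / R\<^sup>2) * ennreal C" by (rule mult_left_mono[OF one]) simp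
    also have "\<dots> = ennreal (C / R\<^sup>2)" by (simp add: ennreal_mult[symmetric] C_def)
    finally show ?thesis .
  qed
  thus ?thesis by blast
qed

section \<open>A symmetric Green function from a walk on balls\<close>

locale heis_domain =
  fixes \<Omega> :: "heis set"
  assumes open_dom: "open \<Omega>" and bounded_dom: "bounded \<Omega>" and nonempty_dom: "\<Omega> \<noteq> {}"
begin

lemma compl_nonempty: "- \<Omega> \<noteq> {}"
proof
  assume "- \<Omega> = {}"
  hence "\<Omega> = UNIV" by auto
  thus False using bounded_dom not_bounded_UNIV by auto
qed

text \<open>Half the distance to the complement: around a point of the domain the closed ball of this radius stays
  inside, and elsewhere the radius is \<open>0\<close>, so that the walk stops there.\<close>

definition rad :: "heis \<Rightarrow> real" where "rad \<zeta> = (INF b\<in>- \<Omega>. hdist \<zeta> b) / 2"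

lemma rad_le: "b \<notin> \<Omega> \<Longrightarrow> 2 * rad \<zeta> \<le> hdist \<zeta> b"
  unfolding rad_def by (simp, rule cINF_lower) (auto intro!: bdd_belowI[of _ 0])

lemma rad_ge: "(\<And>b. b \<notin> \<Omega> \<Longrightarrow> c \<le> hdist \<zeta> b) \<Longrightarrow> c \<le> 2 * rad \<zeta>"
  unfolding rad_def by (simp, rule cINF_greatest[OF compl_nonempty]) auto

lemma rad_nonneg [simp]: "0 \<le> rad \<zeta>"
  using rad_ge[of 0 \<zeta>] by simp

lemma rad_eq_0: "\<zeta> \<notin> \<Omega> \<Longrightarrow> rad \<zeta> = 0"
  using rad_le[of \<zeta> \<zeta>] rad_nonneg[of \<zeta>] by simp

lemma rad_lipschitz: "2 * rad \<zeta> \<le> 2 * rad \<eta> + hdist \<zeta> \<eta>"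
proof -
  have "2 * rad \<zeta> - hdist \<zeta> \<eta> \<le> 2 * rad \<eta>"
  proof (rule rad_ge)
    fix b assume "b \<notin> \<Omega>"
    thus "2 * rad \<zeta> - hdist \<zeta> \<eta> \<le> hdist \<eta> b"
      using rad_le[of b \<zeta>] hdist_triangle[of \<zeta> b \<eta>] by linarith
  qed
  thus ?thesis by simp
qed

lemma rad_pos: assumes "\<zeta> \<in> \<Omega>" shows "0 < rad \<zeta>"
proof -
  obtain R where R: "0 < R" "{q. hdist \<zeta> q \<le> R} \<subseteq> \<Omega>"
    using open_contains_hcball[OF open_dom assms] .
  have "R \<le> 2 * rad \<zeta>"
  proof (rule rad_ge)
    fix b assume "b \<notin> \<Omega>"
    thus "R \<le> hdist \<zeta> b" using R(2) by force
  qed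
  thus ?thesis using R(1) by simp
qed

lemma in_dom: "hdist \<zeta> \<eta> < 2 * rad \<zeta> \<Longrightarrow> \<eta> \<in> \<Omega>"
  using rad_le[of \<eta> \<zeta>] by force

lemma rad_ball: "\<xi> \<in> \<Omega> \<Longrightarrow> s \<le> rad \<xi> \<Longrightarrow> {p. hrho p \<le> s} \<subseteq> hmult \<xi> -` \<Omega>"
proof
  fix p assume "\<xi> \<in> \<Omega>" "s \<le> rad \<xi>" "p \<in> {p. hrho p \<le> s}"
  hence "hdist \<xi> (hmult \<xi> p) < 2 * rad \<xi>" using rad_pos[of \<xi>] by simp
  thus "p \<in> hmult \<xi> -` \<Omega>" using in_dom by blast
qed

lemma step_in_dom: "\<zeta> \<in> \<Omega> \<Longrightarrow> hrho p < 1 \<Longrightarrow> hmult \<zeta> (hdil (rad \<zeta>) p) \<in> \<Omega>"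
proof (rule in_dom)
  assume "\<zeta> \<in> \<Omega>" "hrho p < 1"
  hence "rad \<zeta> * hrho p < rad \<zeta> * 2" using rad_pos by (intro mult_strict_left_mono) auto
  thus "hdist \<zeta> (hmult \<zeta> (hdil (rad \<zeta>) p)) < 2 * rad \<zeta>" by (simp add: hrho_hdil mult.commute)
qed

lemma continuous_on_rad [continuous_intros]:
  assumes "continuous_on S f" shows "continuous_on S (\<lambda>x. rad (f x))"
proof -
  have "rad \<zeta> \<le> rad \<eta> + hdist \<zeta> \<eta>" for \<zeta> \<eta>
    using rad_lipschitz[of \<zeta> \<eta>] hdist_nonneg[of \<zeta> \<eta>] by linarith
  hence "continuous_on UNIV rad" by (rule continuous_on_hdist_lipschitz)
  thus ?thesis using assms by (rule continuous_on_compose2) auto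
qed

text \<open>One step of the random walk, as an operator on functions: the mean of \<open>f\<close> after a step from \<open>\<zeta>\<close>.\<close>

definition walk :: "(heis \<Rightarrow> ennreal) \<Rightarrow> heis \<Rightarrow> ennreal" where "walk f \<zeta> = avg (rad \<zeta>) f \<zeta>"

lemma walk_out: "\<zeta> \<notin> \<Omega> \<Longrightarrow> walk f \<zeta> = f \<zeta>" by (simp add: walk_def rad_eq_0 avg_0)

lemma walk_mono: "(\<And>\<eta>. \<eta> \<in> \<Omega> \<Longrightarrow> f \<eta> \<le> g \<eta>) \<Longrightarrow> \<zeta> \<in> \<Omega> \<Longrightarrow> walk f \<zeta> \<le> walk g \<zeta>"
  unfolding walk_def by (rule avg_mono) (simp add: step_in_dom)

lemma walkn_mono:
  "(\<And>\<eta>. \<eta> \<in> \<Omega> \<Longrightarrow> f \<eta> \<le> g \<eta>) \<Longrightarrow> \<zeta> \<in> \<Omega> \<Longrightarrow> (walk ^^ n) f \<zeta> \<le> (walk ^^ n) g \<zeta>"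
  by (induction n arbitrary: \<zeta>) (auto intro: walk_mono)

lemma walkn_cong:
  "(\<And>\<eta>. \<eta> \<in> \<Omega> \<Longrightarrow> f \<eta> = g \<eta>) \<Longrightarrow> \<zeta> \<in> \<Omega> \<Longrightarrow> (walk ^^ n) f \<zeta> = (walk ^^ n) g \<zeta>"
  by (intro antisym walkn_mono) auto

lemma walkn_fixed:
  assumes "\<And>\<eta>. \<eta> \<in> \<Omega> \<Longrightarrow> walk f \<eta> = f \<eta>" "\<zeta> \<in> \<Omega>"
  shows "(walk ^^ n) f \<zeta> = f \<zeta>"
  using assms(2)
proof (induction n arbitrary: \<zeta>)
  case (Suc n)
  have "(walk ^^ Suc n) f \<zeta> = walk ((walk ^^ n) f) \<zeta>" by simp
  also have "\<dots> = walk f \<zeta>" by (intro antisym walk_mono) (auto simp: Suc)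
  finally show ?case using assms(1)[OF Suc.prems] by simp
qed simp

lemma measurable_step [measurable]: "(\<lambda>x. hmult (fst x) (hdil (rad (fst x)) (snd x))) \<in> borel_measurable borel"
  by (intro borel_measurable_continuous_onI continuous_intros)

lemma measurable_walk_pair:
  assumes f: "(\<lambda>x. f (fst x) (snd x)) \<in> borel_measurable (borel :: (heis \<times> 'a::euclidean_space) measure)"
  shows "(\<lambda>x. walk (\<lambda>\<eta>. f \<eta> (snd x)) (fst x)) \<in> borel_measurable (borel :: (heis \<times> 'a) measure)"
proof -
  have "(\<lambda>y::(heis \<times> 'a) \<times> heis. (hmult (fst (fst y)) (hdil (rad (fst (fst y))) (snd y)), snd (fst y)))
      \<in> borel_measurable borel"
    by (intro borel_measurable_continuous_onI continuous_intros)
  from measurable_compose[OF this f] have [measurable]: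
    "(\<lambda>y::(heis \<times> 'a) \<times> heis. f (hmult (fst (fst y)) (hdil (rad (fst (fst y))) (snd y))) (snd (fst y)))
      \<in> borel_measurable borel" by simp
  have [measurable]: "(\<lambda>y::(heis \<times> 'a) \<times> heis. wker (snd y)) \<in> borel_measurable borel"
    by (intro borel_measurable_continuous_onI continuous_intros)
  have "(\<lambda>y::(heis \<times> 'a) \<times> heis. f (hmult (fst (fst y)) (hdil (rad (fst (fst y))) (snd y))) (snd (fst y)) *
     ennreal (wker (snd y) / wmass)) \<in> borel_measurable borel" by measurable
  note m = this
  have "(\<lambda>(x, p). f (hmult (fst x) (hdil (rad (fst x)) p)) (snd x) * ennreal (wker p / wmass))
     \<in> borel_measurable ((borel :: (heis \<times> 'a) measure) \<Otimes>\<^sub>M lborel)"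
  proof -
    have "sets ((borel :: (heis \<times> 'a) measure) \<Otimes>\<^sub>M (lborel :: heis measure)) = sets borel"
      by (subst borel_prod[symmetric]) (rule sets_pair_measure_cong; simp)
    from measurable_cong_sets[OF this refl] show ?thesis
      unfolding case_prod_beta using m by blast
  qed
  thus ?thesis unfolding walk_def avg_def by (rule lborel.borel_measurable_nn_integral)
qed

lemma measurable_walk [measurable]:
  assumes "f \<in> borel_measurable borel"
  shows "walk f \<in> borel_measurable borel"
proof -
  have "(fst :: heis \<times> real \<Rightarrow> heis) \<in> borel_measurable borel"
    by (intro borel_measurable_continuous_onI continuous_intros)
  from measurable_compose[OF this assms]
  have "(\<lambda>x. f (fst x)) \<in> borel_measurable (borel :: (heis \<times> real) measure)" .
  from measurable_walk_pair[of "\<lambda>\<eta> _. f \<eta>", OF this]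
  have m: "(\<lambda>x. walk f (fst x)) \<in> borel_measurable (borel :: (heis \<times> real) measure)" by simp
  have "(\<lambda>\<zeta>::heis. (\<zeta>, 0::real)) \<in> borel_measurable borel"
    by (intro borel_measurable_continuous_onI continuous_intros)
  from measurable_compose[OF this m] show ?thesis by simp
qed

lemma measurable_walkn [measurable]:
  "f \<in> borel_measurable borel \<Longrightarrow> (walk ^^ n) f \<in> borel_measurable borel"
  by (induction n) auto

lemma walk_add:
  "f \<in> borel_measurable borel \<Longrightarrow> g \<in> borel_measurable borel \<Longrightarrow>
    walk (\<lambda>\<eta>. f \<eta> + g \<eta>) \<zeta> = walk f \<zeta> + walk g \<zeta>"
  unfolding walk_def by (rule avg_add)

lemma walk_cmult: "f \<in> borel_measurable borel \<Longrightarrow> walk (\<lambda>\<eta>. c * f \<eta>) \<zeta> = c * walk f \<zeta>"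
  unfolding walk_def by (rule avg_cmult)

lemma walk_const: "walk (\<lambda>_. c) \<zeta> = c"
  unfolding walk_def by (rule avg_const)

lemma walkn_add:
  assumes "f \<in> borel_measurable borel" "g \<in> borel_measurable borel"
  shows "(walk ^^ n) (\<lambda>\<eta>. f \<eta> + g \<eta>) \<zeta> = (walk ^^ n) f \<zeta> + (walk ^^ n) g \<zeta>"
proof (induction n arbitrary: \<zeta>)
  case (Suc n)
  hence "(walk ^^ n) (\<lambda>\<eta>. f \<eta> + g \<eta>) = (\<lambda>\<zeta>. (walk ^^ n) f \<zeta> + (walk ^^ n) g \<zeta>)" by blast
  thus ?case using assms by (simp add: walk_add)
qed simp

lemma walkn_cmult:
  assumes "f \<in> borel_measurable borel"
  shows "(walk ^^ n) (\<lambda>\<eta>. c * f \<eta>) \<zeta> = c * (walk ^^ n) f \<zeta>"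
proof (induction n arbitrary: \<zeta>)
  case (Suc n)
  hence "(walk ^^ n) (\<lambda>\<eta>. c * f \<eta>) = (\<lambda>\<zeta>. c * (walk ^^ n) f \<zeta>)" by blast
  thus ?case using assms by (simp add: walk_cmult)
qed simp

lemma walkn_const: "(walk ^^ n) (\<lambda>_. c) \<zeta> = c"
proof (induction n arbitrary: \<zeta>)
  case (Suc n)
  hence "(walk ^^ n) (\<lambda>_. c) = (\<lambda>_. c)" by blast
  thus ?case by (simp add: walk_const)
qed simp

subsection \<open>The walk leaves every compact subset\<close>

definition rad_sq :: "heis \<Rightarrow> ennreal" where "rad_sq \<zeta> = ennreal ((rad \<zeta>)\<^sup>2)"

definition zmass :: real where "zmass = (LINT p|lborel. zsq p * wker p) / wmass"

lemma borel_measurable_rad_sq [measurable]: "rad_sq \<in> borel_measurable borel"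
  unfolding rad_sq_def[abs_def]
  by (intro measurable_compose[OF _ measurable_ennreal] borel_measurable_continuous_onI continuous_intros)

lemma integrable_weighted:
  assumes "continuous_on UNIV (f :: heis \<Rightarrow> real)"
  shows "integrable lborel (\<lambda>p. f p * wker p)"
  by (rule integrable_cutoff(1)[OF open_UNIV _ assms, of 1])
     (auto intro!: continuous_intros simp: wker_eq_0)

lemma zmass_pos: "0 < zmass"
  unfolding zmass_def
proof (intro divide_pos_pos wmass_pos integral_pos_heis[of _ 1 "(1/2, 0, 0)"])
  show "0 < zsq (1/2, 0, 0) * wker (1/2, 0, 0)"
    by (simp add: wker_def zsq_def hquart_def gprof_def flat_exp_pos power2_eq_square)
qed (auto intro!: continuous_intros simp: wker_eq_0)

lemma integral_odd_weight: "(LINT p|lborel. (a * fst p + b * fst (snd p)) * wker p) = 0"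
proof -
  define T :: "heis \<Rightarrow> heis" where "T p = (- fst p, - fst (snd p), snd (snd p))" for p
  have [measurable]: "T \<in> borel_measurable borel"
    unfolding T_def[abs_def] by (intro borel_measurable_continuous_onI continuous_intros)
  define f :: "heis \<Rightarrow> real" where "f p = (a * fst p + b * fst (snd p)) * wker p" for p
  have f: "f \<in> borel_measurable borel"
    unfolding f_def[abs_def] by (intro borel_measurable_continuous_onI continuous_intros)
  have "(LINT p|lborel. f p) = 1 * (LINT p|lborel. f (T p))"
  proof (rule integral_substitution[OF _ _ _ f])
    show "ennreal 1 * (\<integral>\<^sup>+p. h (T p) \<partial>lborel) = (\<integral>\<^sup>+p. h p \<partial>lborel)"
      if "h \<in> borel_measurable borel" for h :: "heis \<Rightarrow> ennreal"
      using nn_integral_triangular[OF that, of "-1" "-1" 1 0 0 0 0 0] by (simp add: T_def)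
  qed simp_all
  moreover have "f (T p) = - f p" for p
    by (simp add: f_def T_def wker_def zsq_def hquart_def algebra_simps)
  ultimately show ?thesis by (simp add: f_def[abs_def])
qed

text \<open>The cross terms are odd in \<open>z\<close> and average to \<open>0\<close>.\<close>

lemma avg_zsq: "avg R (\<lambda>p. ennreal (zsq p)) \<eta> = ennreal (zsq \<eta> + zmass * R\<^sup>2)"
proof -
  define u where "u p = zsq (hmult \<eta> (hdil R p))" for p
  have u: "u p * wker p = zsq \<eta> * wker p + ((2 * R * fst \<eta>) * fst p + (2 * R * fst (snd \<eta>)) * fst (snd p)) * wker p
      + R\<^sup>2 * (zsq p * wker p)" for p
    unfolding u_def by (simp add: zsq_def hmult_eq hdil_def algebra_simps power2_eq_square)
  have i: "integrable lborel (\<lambda>p. zsq \<eta> * wker p)"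
    "integrable lborel (\<lambda>p. ((2 * R * fst \<eta>) * fst p + (2 * R * fst (snd \<eta>)) * fst (snd p)) * wker p)"
    "integrable lborel (\<lambda>p. R\<^sup>2 * (zsq p * wker p))" "integrable lborel (\<lambda>p. u p * wker p)"
    unfolding u_def
    by (intro integrable_weighted integrable_mult_right continuous_intros)+
  have "(LINT p|lborel. u p * wker p) = zsq \<eta> * wmass + R\<^sup>2 * (LINT p|lborel. zsq p * wker p)"
    unfolding u using i integral_odd_weight[of "2 * R * fst \<eta>" "2 * R * fst (snd \<eta>)"] by (simp add: wmass_def)
  hence I: "(LINT p|lborel. u p * wker p / wmass) = zsq \<eta> + zmass * R\<^sup>2"
    using wmass_pos by (simp add: zmass_def field_simps)
  have "avg R (\<lambda>p. ennreal (zsq p)) \<eta> = (\<integral>\<^sup>+p. ennreal (u p * wker p / wmass) \<partial>lborel)"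
    unfolding avg_def u_def using wmass_pos by (simp add: ennreal_mult[symmetric])
  also have "\<dots> = ennreal (LINT p|lborel. u p * wker p / wmass)"
    using i(4) wmass_pos by (intro nn_integral_eq_integral) (auto simp: u_def)
  finally show ?thesis using I by simp
qed

text \<open>Each step raises the mean of \<open>|z|\<^sup>2\<close> by a multiple of the squared radius. Since \<open>|z|\<^sup>2\<close> is bounded on the
  domain, the expected squared radii are summable: the walk leaves every compact subset.\<close>

lemma walkn_rad_sq_tendsto_0:
  assumes \<zeta>: "\<zeta> \<in> \<Omega>"
  shows "(\<lambda>n. (walk ^^ n) rad_sq \<zeta>) \<longlonglongrightarrow> 0"
proof -
  have "bounded (zsq ` closure \<Omega>)"
    using bounded_dom by (intro compact_imp_bounded compact_continuous_image continuous_intros) (simp add: compact_closure)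
  then obtain M where M: "\<And>p. p \<in> \<Omega> \<Longrightarrow> zsq p \<le> M"
    unfolding bounded_iff using closure_subset[of \<Omega>] by (auto simp del: split_paired_All)
  \<comment> \<open>Counting down from a bound for \<open>|z|\<^sup>2\<close> keeps all terms nonnegative.\<close>
  define q where "q p = ennreal (M - zsq p)" for p
  have [measurable]: "q \<in> borel_measurable borel" unfolding q_def[abs_def] by measurable
  have step: "q \<eta> = walk q \<eta> + ennreal zmass * rad_sq \<eta>" if \<eta>: "\<eta> \<in> \<Omega>" for \<eta>
  proof -
    have "walk (\<lambda>p. q p + ennreal (zsq p)) \<eta> = walk (\<lambda>_. ennreal M) \<eta>"
    proof (intro antisym walk_mono \<eta>)
      have "q p + ennreal (zsq p) = ennreal M" if "p \<in> \<Omega>" for p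
        using M[OF that] by (simp add: q_def flip: ennreal_plus)
      thus "p \<in> \<Omega> \<Longrightarrow> q p + ennreal (zsq p) \<le> ennreal M" "p \<in> \<Omega> \<Longrightarrow> ennreal M \<le> q p + ennreal (zsq p)" for p by simp_all
    qed
    hence "walk q \<eta> + (ennreal (zsq \<eta>) + ennreal zmass * rad_sq \<eta>) = ennreal M"
      using zmass_pos by (simp add: walk_add) (simp add: walk_def avg_zsq avg_const rad_sq_def ennreal_mult)
    also have "\<dots> = q \<eta> + ennreal (zsq \<eta>)"
      using M[OF \<eta>] by (simp add: q_def flip: ennreal_plus)
    finally have "ennreal (zsq \<eta>) + q \<eta> = ennreal (zsq \<eta>) + (walk q \<eta> + ennreal zmass * rad_sq \<eta>)"
      by (simp add: ac_simps)
    thus ?thesis by (simp add: ennreal_add_left_cancel)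
  qed
  have tele: "q \<zeta> = (walk ^^ n) q \<zeta> + ennreal zmass * (\<Sum>j<n. (walk ^^ j) rad_sq \<zeta>)" for n
  proof (induction n)
    case (Suc n)
    have "(walk ^^ n) q \<zeta> = (walk ^^ n) (\<lambda>\<eta>. walk q \<eta> + ennreal zmass * rad_sq \<eta>) \<zeta>"
      by (rule walkn_cong[OF step \<zeta>])
    also have "\<dots> = (walk ^^ Suc n) q \<zeta> + ennreal zmass * (walk ^^ n) rad_sq \<zeta>"
      by (subst walkn_add, measurable) (simp add: walkn_cmult funpow_swap1)
    finally show ?case using Suc.IH by (simp add: distrib_left ac_simps)
  qed simp
  define a where "a n = ennreal zmass * (walk ^^ n) rad_sq \<zeta>" for n
  have le: "(\<Sum>j<n. a j) \<le> q \<zeta>" for n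
    by (subst tele[of n]) (simp add: a_def sum_distrib_left add_increasing)
  have fin: "a n < top" for n
  proof -
    have "a n \<le> (\<Sum>j<Suc n. a j)" by simp
    also have "\<dots> \<le> q \<zeta>" by (rule le)
    finally show ?thesis by (rule le_less_trans) (simp add: q_def)
  qed
  have "(\<Sum>n. a n) \<le> q \<zeta>" by (rule suminf_le_const[OF summableI le])
  hence "(\<Sum>n. ennreal (enn2real (a n))) \<noteq> top"
    using fin by (auto simp: q_def top_unique)
  hence "summable (\<lambda>n. enn2real (a n))" by (intro summable_suminf_not_top) auto
  hence "(\<lambda>n. ennreal (enn2real (a n))) \<longlonglongrightarrow> ennreal 0"
    by (intro tendsto_ennrealI summable_LIMSEQ_zero)
  hence "(\<lambda>n. a n) \<longlonglongrightarrow> 0" using fin by simp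
  hence "(\<lambda>n. ennreal (1 / zmass) * a n) \<longlonglongrightarrow> ennreal (1 / zmass) * 0"
    by (intro tendsto_mult_ennreal tendsto_const) auto
  moreover have "ennreal (1 / zmass) * a n = (walk ^^ n) rad_sq \<zeta>" for n
    using zmass_pos by (simp add: a_def mult.assoc[symmetric] ennreal_mult[symmetric])
  ultimately show ?thesis by simp
qed

end

context heis_domain begin

subsection \<open>The limit of the walk\<close>

text \<open>The fundamental solution with pole \<open>\<xi>\<close>, up to \<open>8\<pi>\<close>.\<close>

definition pole :: "heis \<Rightarrow> heis \<Rightarrow> ennreal" where "pole \<xi> \<eta> = hN (hmult (hinv \<xi>) \<eta>)"

definition iter :: "nat \<Rightarrow> heis \<Rightarrow> heis \<Rightarrow> ennreal" where "iter n \<zeta> \<xi> = (walk ^^ n) (pole \<xi>) \<zeta>"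

text \<open>The limit of the means of the fundamental solution with pole \<open>\<xi>\<close> along the walk from \<open>\<zeta>\<close>. As a
  function of \<open>\<xi>\<close> it is the potential of the unit mass at \<open>\<zeta>\<close> swept out to the boundary.\<close>

definition swept :: "heis \<Rightarrow> heis \<Rightarrow> ennreal" where "swept \<zeta> \<xi> = (INF n. iter n \<zeta> \<xi>)"

lemma borel_measurable_pole [measurable]: "pole \<xi> \<in> borel_measurable borel"
  unfolding pole_def[abs_def] by measurable

lemma pole_sym: "pole \<xi> \<eta> = pole \<eta> \<xi>"
  unfolding pole_def by (metis hN_hinv hinv_mult hinv_hinv)

lemma pole_real: "\<eta> \<noteq> \<xi> \<Longrightarrow> pole \<xi> \<eta> = ennreal (1 / (hdist \<xi> \<eta>)\<^sup>2)"
  unfolding pole_def hdist_def by (rule hN_real) (metis hinv_hmult(1) hmult_hinv_cancel(2) hmult_zero(2))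

lemma avg_pole: "avg R (pole \<xi>) \<zeta> = avg R hN (hmult (hinv \<xi>) \<zeta>)"
  unfolding pole_def[abs_def] by (rule avg_left)

lemma avg_pole_le: "0 \<le> R \<Longrightarrow> avg R (pole \<xi>) \<zeta> \<le> pole \<xi> \<zeta>"
  unfolding avg_pole by (simp add: pole_def avg_hN_le)

lemma avg_pole_eq: "0 \<le> R \<Longrightarrow> R < hdist \<xi> \<zeta> \<Longrightarrow> avg R (pole \<xi>) \<zeta> = pole \<xi> \<zeta>"
  unfolding avg_pole by (simp add: pole_def avg_hN_eq hdist_def)

lemma walk_pole_out:
  assumes "\<xi> \<notin> \<Omega>" "\<zeta> \<in> \<Omega>" shows "walk (pole \<xi>) \<zeta> = pole \<xi> \<zeta>"
  unfolding walk_def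
  by (rule avg_pole_eq) (use rad_le[OF assms(1), of \<zeta>] rad_pos[OF assms(2)] hdist_sym[of \<xi> \<zeta>] in auto)

lemma iter_Suc_le: "iter (Suc n) \<zeta> \<xi> \<le> iter n \<zeta> \<xi>"
proof (cases "\<zeta> \<in> \<Omega>")
  case True
  have "iter (Suc n) \<zeta> \<xi> = (walk ^^ n) (walk (pole \<xi>)) \<zeta>" by (simp add: iter_def funpow_swap1)
  also have "\<dots> \<le> iter n \<zeta> \<xi>"
    unfolding iter_def by (rule walkn_mono[OF _ True]) (simp add: walk_def avg_pole_le)
  finally show ?thesis .
qed (simp add: iter_def walk_out)

lemma iter_decseq: "decseq (\<lambda>n. iter n \<zeta> \<xi>)"
  by (rule decseq_SucI) (rule iter_Suc_le)

lemma iter_tendsto: "(\<lambda>n. iter n \<zeta> \<xi>) \<longlonglongrightarrow> swept \<zeta> \<xi>"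
  unfolding swept_def by (rule LIMSEQ_INF[OF iter_decseq])

lemma swept_le_pole: "swept \<zeta> \<xi> \<le> pole \<xi> \<zeta>"
  unfolding swept_def by (rule INF_lower2[of 0]) (simp_all add: iter_def)

lemma swept_out:
  assumes "\<xi> \<notin> \<Omega>" "\<zeta> \<in> \<Omega>" shows "swept \<zeta> \<xi> = pole \<xi> \<zeta>"
proof -
  have "iter n \<zeta> \<xi> = pole \<xi> \<zeta>" for n
    unfolding iter_def by (rule walkn_fixed[OF walk_pole_out[OF assms(1)] assms(2)])
  thus ?thesis by (simp add: swept_def)
qed

lemma iter_1_bound:
  assumes "\<zeta> \<in> \<Omega>"
  obtains B where "\<And>\<xi>. iter 1 \<zeta> \<xi> \<le> ennreal B"
proof -
  obtain C where C: "\<And>R \<zeta>. 0 < R \<Longrightarrow> avg R hN \<zeta> \<le> ennreal (C / R\<^sup>2)" using avg_hN_bound by blast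
  show ?thesis
    by (rule that[of "C / (rad \<zeta>)\<^sup>2"]) (simp add: iter_def walk_def avg_pole C rad_pos assms)
qed

lemma swept_bound:
  assumes "\<zeta> \<in> \<Omega>"
  obtains B where "\<And>\<xi>. swept \<zeta> \<xi> \<le> ennreal B"
proof -
  obtain B where B: "\<And>\<xi>. iter 1 \<zeta> \<xi> \<le> ennreal B" using iter_1_bound[OF assms] by blast
  show ?thesis by (rule that[of B]) (use B in \<open>auto simp: swept_def intro: INF_lower2\<close>)
qed

lemma measurable_iter_pair: "(\<lambda>x. iter n (fst x) (snd x)) \<in> borel_measurable (borel :: (heis \<times> heis) measure)"
proof (induction n)
  case 0
  have "(\<lambda>x::heis \<times> heis. hmult (hinv (snd x)) (fst x)) \<in> borel_measurable borel"
    by (intro borel_measurable_continuous_onI continuous_intros)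
  from measurable_compose[OF this borel_measurable_hN] show ?case by (simp add: iter_def pole_def)
next
  case (Suc n)
  have "iter (Suc n) \<zeta> \<xi> = walk (\<lambda>\<eta>. iter n \<eta> \<xi>) \<zeta>" for \<zeta> \<xi> by (simp add: iter_def)
  thus ?case using measurable_walk_pair[OF Suc] by simp
qed

lemma measurable_iter [measurable]: "iter n \<zeta> \<in> borel_measurable borel"
proof -
  have "(\<lambda>\<xi>. (\<zeta>, \<xi>)) \<in> borel_measurable (borel :: heis measure)"
    by (intro borel_measurable_continuous_onI continuous_intros)
  from measurable_compose[OF this measurable_iter_pair] show ?thesis by simp
qed

lemma measurable_swept [measurable]: "swept \<zeta> \<in> borel_measurable borel"
  unfolding swept_def[abs_def] by measurable

text \<open>Averaging in the pole commutes with walking from the starting point, by Fubini.\<close>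

lemma avg_iter: "avg s (iter n \<zeta>) \<xi> = (walk ^^ n) (\<lambda>\<eta>. avg s (pole \<eta>) \<xi>) \<zeta>"
proof (induction n arbitrary: \<zeta>)
  case 0
  show ?case by (simp add: iter_def avg_def pole_sym)
next
  case (Suc n)
  define f where "f p p' = iter n (hmult \<zeta> (hdil (rad \<zeta>) p)) (hmult \<xi> (hdil s p')) *
     ennreal (wker p / wmass) * ennreal (wker p' / wmass)" for p p'
  have m: "(\<lambda>(p, p'). f p p') \<in> borel_measurable (lborel \<Otimes>\<^sub>M lborel)"
  proof -
    have "(\<lambda>y::heis \<times> heis. (hmult \<zeta> (hdil (rad \<zeta>) (fst y)), hmult \<xi> (hdil s (snd y)))) \<in> borel_measurable borel"
      by (intro borel_measurable_continuous_onI continuous_intros)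
    from measurable_compose[OF this measurable_iter_pair] have [measurable]:
      "(\<lambda>y. iter n (hmult \<zeta> (hdil (rad \<zeta>) (fst y))) (hmult \<xi> (hdil s (snd y)))) \<in> borel_measurable borel" by simp
    have [measurable]: "(\<lambda>y::heis \<times> heis. wker (fst y)) \<in> borel_measurable borel"
      "(\<lambda>y::heis \<times> heis. wker (snd y)) \<in> borel_measurable borel"
      by (intro borel_measurable_continuous_onI continuous_intros)+
    have "(\<lambda>y. f (fst y) (snd y)) \<in> borel_measurable borel" unfolding f_def by measurable
    thus ?thesis by (simp add: lborel_prod case_prod_beta)
  qed
  have "avg s (iter (Suc n) \<zeta>) \<xi> = (\<integral>\<^sup>+p'. (\<integral>\<^sup>+p. iter n (hmult \<zeta> (hdil (rad \<zeta>) p)) (hmult \<xi> (hdil s p')) *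
     ennreal (wker p / wmass) \<partial>lborel) * ennreal (wker p' / wmass) \<partial>lborel)"
    by (simp add: avg_def iter_def walk_def)
  also have "\<dots> = (\<integral>\<^sup>+p'. \<integral>\<^sup>+p. f p p' \<partial>lborel \<partial>lborel)"
  proof (rule nn_integral_cong)
    fix p'
    have "(\<lambda>\<eta>. (\<eta>, hmult \<xi> (hdil s p'))) \<in> borel_measurable (borel :: heis measure)"
      by (intro borel_measurable_continuous_onI continuous_intros)
    from measurable_compose[OF this measurable_iter_pair]
    have [measurable]: "(\<lambda>\<eta>. iter n \<eta> (hmult \<xi> (hdil s p'))) \<in> borel_measurable borel" by simp
    show "(\<integral>\<^sup>+p. iter n (hmult \<zeta> (hdil (rad \<zeta>) p)) (hmult \<xi> (hdil s p')) * ennreal (wker p / wmass) \<partial>lborel) *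
       ennreal (wker p' / wmass) = (\<integral>\<^sup>+p. f p p' \<partial>lborel)"
      unfolding f_def by (rule nn_integral_multc[symmetric]) measurable
  qed
  also have "\<dots> = (\<integral>\<^sup>+p. \<integral>\<^sup>+p'. f p p' \<partial>lborel \<partial>lborel)"
    by (rule lborel_pair.Fubini'[OF m])
  also have "\<dots> = (\<integral>\<^sup>+p. avg s (iter n (hmult \<zeta> (hdil (rad \<zeta>) p))) \<xi> * ennreal (wker p / wmass) \<partial>lborel)"
    unfolding avg_def f_def
    by (subst nn_integral_multc[symmetric], measurable) (simp add: mult_ac)
  also have "\<dots> = walk (\<lambda>\<eta>. avg s (iter n \<eta>) \<xi>) \<zeta>" by (simp add: walk_def avg_def[of "rad \<zeta>"])
  finally show ?case by (simp add: Suc)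
qed

text \<open>The pole averaged over one step is bounded by a multiple of the inverse squared step radius, and from
  far away the ball around \<open>\<xi>\<close> is out of reach in one step. So after one step the localized pole is at most a
  multiple of the squared radius, whose mean along the walk tends to \<open>0\<close>.\<close>

lemma walkn_near_pole:
  assumes \<zeta>: "\<zeta> \<in> \<Omega>" and \<xi>: "\<xi> \<in> \<Omega>" and s: "s \<le> rad \<xi>"
  defines "D \<equiv> \<lambda>\<eta>. pole \<xi> \<eta> * indicator {\<eta>. hdist \<xi> \<eta> \<le> s} \<eta>"
  shows "(\<lambda>n. (walk ^^ n) D \<zeta>) \<longlonglongrightarrow> 0"
proof -
  obtain C where C: "\<And>R \<zeta>. 0 < R \<Longrightarrow> avg R hN \<zeta> \<le> ennreal (C / R\<^sup>2)" using avg_hN_bound by blast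
  \<comment> \<open>Only points with \<open>rad \<xi> \<le> 3 rad \<eta>\<close> reach the ball around \<open>\<xi>\<close>; there \<open>1 / (rad \<eta>)\<^sup>2\<close> is at most
    \<open>3\<^sup>4 (rad \<eta>)\<^sup>2 / (rad \<xi>)\<^sup>4\<close>.\<close>
  define K where "K = \<bar>C\<bar> * 81 / rad \<xi> ^ 4"
  have K: "0 \<le> K" by (simp add: K_def)
  have le: "walk D \<eta> \<le> ennreal K * rad_sq \<eta>" if \<eta>: "\<eta> \<in> \<Omega>" for \<eta>
  proof (cases "rad \<xi> \<le> 3 * rad \<eta>")
    case True
    have pos: "0 < rad \<eta>" "0 < rad \<xi>" using rad_pos \<eta> \<xi> by auto
    have "walk D \<eta> \<le> walk (pole \<xi>) \<eta>"
      by (rule walk_mono[OF _ \<eta>]) (simp add: D_def indicator_def)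
    also have "\<dots> \<le> ennreal (C / (rad \<eta>)\<^sup>2)" unfolding walk_def avg_pole by (rule C[OF pos(1)])
    also have "\<dots> \<le> ennreal (K * (rad \<eta>)\<^sup>2)"
    proof (rule ennreal_leI)
      have "rad \<xi> ^ 4 \<le> (3 * rad \<eta>) ^ 4" using True by (intro power_mono) auto
      hence "rad \<xi> ^ 4 \<le> 81 * rad \<eta> ^ 4" by (simp add: power_mult_distrib)
      hence "\<bar>C\<bar> * rad \<xi> ^ 4 \<le> \<bar>C\<bar> * (81 * rad \<eta> ^ 4)" by (intro mult_left_mono) auto
      hence "\<bar>C\<bar> / (rad \<eta>)\<^sup>2 \<le> K * (rad \<eta>)\<^sup>2"
        using pos by (simp add: K_def field_simps power2_eq_square eval_nat_numeral)
      moreover have "C / (rad \<eta>)\<^sup>2 \<le> \<bar>C\<bar> / (rad \<eta>)\<^sup>2" by (intro divide_right_mono) auto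
      ultimately show "C / (rad \<eta>)\<^sup>2 \<le> K * (rad \<eta>)\<^sup>2" by linarith
    qed
    finally show ?thesis using K by (simp add: rad_sq_def ennreal_mult)
  next
    case False
    have "walk D \<eta> = avg (rad \<eta>) (\<lambda>_. 0) \<eta>"
      unfolding walk_def
    proof (rule avg_cong)
      fix p assume p: "hrho p < 1"
      define q where "q = hmult \<eta> (hdil (rad \<eta>) p)"
      have "rad \<eta> * hrho p \<le> rad \<eta> * 1" using p by (intro mult_left_mono) auto
      hence "hdist \<eta> q \<le> rad \<eta>" by (simp add: q_def hrho_hdil)
      moreover have "2 * rad \<xi> \<le> 2 * rad \<eta> + hdist \<xi> \<eta>" by (rule rad_lipschitz)
      moreover have "hdist \<xi> \<eta> \<le> hdist \<xi> q + hdist q \<eta>" by (rule hdist_triangle)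
      ultimately have "s < hdist \<xi> q" using False s hdist_sym[of \<eta> q] by linarith
      thus "D (hmult \<eta> (hdil (rad \<eta>) p)) = 0" by (simp add: D_def q_def)
    qed
    thus ?thesis by (simp add: avg_const)
  qed
  have "(\<lambda>n. ennreal K * (walk ^^ n) rad_sq \<zeta>) \<longlonglongrightarrow> ennreal K * 0"
    by (intro tendsto_mult_ennreal tendsto_const walkn_rad_sq_tendsto_0[OF \<zeta>]) auto
  hence lim: "(\<lambda>n. ennreal K * (walk ^^ n) rad_sq \<zeta>) \<longlonglongrightarrow> 0" by simp
  have "(\<lambda>n. (walk ^^ Suc n) D \<zeta>) \<longlonglongrightarrow> 0"
  proof (rule tendsto_sandwich[OF _ _ tendsto_const lim])
    have "(walk ^^ Suc n) D \<zeta> \<le> ennreal K * (walk ^^ n) rad_sq \<zeta>" for n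
    proof -
      have "(walk ^^ Suc n) D \<zeta> = (walk ^^ n) (walk D) \<zeta>" by (simp add: funpow_swap1)
      also have "\<dots> \<le> (walk ^^ n) (\<lambda>\<eta>. ennreal K * rad_sq \<eta>) \<zeta>" by (rule walkn_mono[OF le \<zeta>])
      finally show ?thesis by (simp add: walkn_cmult)
    qed
    thus "\<forall>\<^sub>F n in sequentially. (walk ^^ Suc n) D \<zeta> \<le> ennreal K * (walk ^^ n) rad_sq \<zeta>" by simp
  qed simp
  thus ?thesis by (rule LIMSEQ_imp_Suc)
qed

text \<open>Each iterate is a superposition of poles. A pole at distance more than \<open>s\<close> from \<open>\<xi>\<close> is preserved by the
  average, and the contribution of the nearer ones tends to \<open>0\<close> along the walk.\<close>

lemma avg_swept:
  assumes \<zeta>: "\<zeta> \<in> \<Omega>" and \<xi>: "\<xi> \<in> \<Omega>" and s: "0 \<le> s" "s \<le> rad \<xi>"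
  shows "avg s (swept \<zeta>) \<xi> = swept \<zeta> \<xi>"
proof -
  obtain B where B: "\<And>\<xi>. iter 1 \<zeta> \<xi> \<le> ennreal B" using iter_1_bound[OF \<zeta>] by blast
  \<comment> \<open>The averaged pole \<open>m\<close> and the part \<open>D\<close> of the pole near \<open>\<xi>\<close> satisfy \<open>m \<le> pole \<le> m + D\<close>.\<close>
  define m where "m \<eta> = avg s (pole \<eta>) \<xi>" for \<eta>
  have m_eq: "m \<eta> = avg s hN (hmult (hinv \<eta>) \<xi>)" for \<eta> by (simp add: m_def avg_pole)
  define D where "D \<eta> = pole \<xi> \<eta> * indicator {\<eta>. hdist \<xi> \<eta> \<le> s} \<eta>" for \<eta>
  have [measurable]: "{\<eta>. hdist \<xi> \<eta> \<le> s} \<in> sets borel"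
    by (intro borel_closed closed_Collect_le continuous_intros)
  have mD [measurable]: "D \<in> borel_measurable borel" unfolding D_def[abs_def] by measurable
  have mm [measurable]: "m \<in> borel_measurable borel"
  proof -
    have "(\<lambda>y. hmult (hmult (hinv (fst y)) \<xi>) (hdil s (snd y))) \<in> borel_measurable (borel :: (heis \<times> heis) measure)"
      by (intro borel_measurable_continuous_onI continuous_intros)
    from measurable_compose[OF this borel_measurable_hN]
    have [measurable]: "(\<lambda>y. hN (hmult (hmult (hinv (fst y)) \<xi>) (hdil s (snd y)))) \<in> borel_measurable (borel :: (heis \<times> heis) measure)" .
    have [measurable]: "(\<lambda>y::heis \<times> heis. wker (snd y)) \<in> borel_measurable borel"
      by (intro borel_measurable_continuous_onI continuous_intros)
    have "(\<lambda>y::heis \<times> heis. hN (hmult (hmult (hinv (fst y)) \<xi>) (hdil s (snd y))) * ennreal (wker (snd y) / wmass)) \<in> borel_measurable borel"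
      by measurable
    hence "(\<lambda>(\<eta>, p). hN (hmult (hmult (hinv \<eta>) \<xi>) (hdil s p)) * ennreal (wker p / wmass)) \<in> borel_measurable (lborel \<Otimes>\<^sub>M lborel)"
      by (simp add: lborel_prod case_prod_beta)
    from lborel.borel_measurable_nn_integral[OF this] show ?thesis
      unfolding m_eq[abs_def] avg_def by simp
  qed
  define J where "J n = avg s (iter n \<zeta>) \<xi>" for n
  have J: "J n = (walk ^^ n) m \<zeta>" for n unfolding J_def m_def by (rule avg_iter)
  have INF_mult: "(INF n. X n) * c = (INF n. X n * c)" if "decseq X" "c < top" for X :: "nat \<Rightarrow> ennreal" and c
  proof (cases "c = 0")
    case False
    have "(\<lambda>n. X n * c) \<longlonglongrightarrow> (INF n. X n) * c"
      using that False by (intro tendsto_mult_ennreal LIMSEQ_INF tendsto_const) auto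
    moreover have "(\<lambda>n. X n * c) \<longlonglongrightarrow> (INF n. X n * c)"
      using that(1) by (intro LIMSEQ_INF) (auto simp: decseq_def intro: mult_right_mono)
    ultimately show ?thesis by (rule LIMSEQ_unique)
  qed simp
  have "avg s (swept \<zeta>) \<xi> = (\<integral>\<^sup>+p. (INF n. iter n \<zeta> (hmult \<xi> (hdil s p)) * ennreal (wker p / wmass)) \<partial>lborel)"
    unfolding avg_def swept_def by (intro nn_integral_cong INF_mult iter_decseq) simp
  also have "\<dots> = (INF n. J n)"
    unfolding J_def avg_def
  proof (rule nn_integral_monotone_convergence_INF_AE)
    show "AE p in lborel. iter (Suc n) \<zeta> (hmult \<xi> (hdil s p)) * ennreal (wker p / wmass) \<le>
        iter n \<zeta> (hmult \<xi> (hdil s p)) * ennreal (wker p / wmass)" for n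
      by (intro AE_I2 mult_right_mono iter_Suc_le) simp
    show "(\<lambda>p. iter n \<zeta> (hmult \<xi> (hdil s p)) * ennreal (wker p / wmass)) \<in> borel_measurable lborel" for n
      by measurable
    have "avg s (iter 1 \<zeta>) \<xi> \<le> avg s (\<lambda>_. ennreal B) \<xi>" by (rule avg_mono[OF B])
    thus "(\<integral>\<^sup>+p. iter 1 \<zeta> (hmult \<xi> (hdil s p)) * ennreal (wker p / wmass) \<partial>lborel) < \<infinity>"
      by (simp add: avg_const) (simp add: avg_def le_less_trans)
  qed
  finally have avg_eq: "avg s (swept \<zeta>) \<xi> = (INF n. J n)" .
  have "decseq J" unfolding J_def by (intro decseq_SucI avg_mono iter_Suc_le)
  hence lim: "J \<longlonglongrightarrow> avg s (swept \<zeta>) \<xi>" unfolding avg_eq by (rule LIMSEQ_INF)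
  have mle: "m \<eta> \<le> pole \<xi> \<eta>" for \<eta>
    unfolding m_def by (subst pole_sym) (rule avg_pole_le[OF s(1)])
  have mge: "pole \<xi> \<eta> \<le> m \<eta> + D \<eta>" for \<eta>
  proof (cases "hdist \<xi> \<eta> \<le> s")
    case True thus ?thesis by (simp add: D_def add_increasing)
  next
    case False
    hence "m \<eta> = pole \<eta> \<xi>"
      unfolding m_def by (intro avg_pole_eq s(1)) (use hdist_sym[of \<xi> \<eta>] in simp)
    thus ?thesis using pole_sym[of \<eta> \<xi>] by simp
  qed
  show ?thesis
  proof (rule antisym)
    show "avg s (swept \<zeta>) \<xi> \<le> swept \<zeta> \<xi>"
    proof (rule LIMSEQ_le[OF lim iter_tendsto], intro exI allI impI)
      show "J n \<le> iter n \<zeta> \<xi>" for n unfolding J iter_def by (rule walkn_mono[OF mle \<zeta>])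
    qed
    have "(\<lambda>n. J n + (walk ^^ n) D \<zeta>) \<longlonglongrightarrow> avg s (swept \<zeta>) \<xi> + 0"
      unfolding D_def[abs_def] by (intro tendsto_add lim walkn_near_pole \<zeta> \<xi> s(2))
    hence lim2: "(\<lambda>n. J n + (walk ^^ n) D \<zeta>) \<longlonglongrightarrow> avg s (swept \<zeta>) \<xi>" by simp
    show "swept \<zeta> \<xi> \<le> avg s (swept \<zeta>) \<xi>"
    proof (rule LIMSEQ_le[OF iter_tendsto lim2], intro exI allI impI)
      fix n
      have "iter n \<zeta> \<xi> \<le> (walk ^^ n) (\<lambda>\<eta>. m \<eta> + D \<eta>) \<zeta>"
        unfolding iter_def by (rule walkn_mono[OF mge \<zeta>])
      thus "iter n \<zeta> \<xi> \<le> J n + (walk ^^ n) D \<zeta>" unfolding J walkn_add[OF mm mD] .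
    qed
  qed
qed

text \<open>In its second variable the limit is invariant under the walk and lies below the pole \<open>\<zeta>\<close>; iterating the
  walk in that variable bounds it by the limit with the two points exchanged.\<close>

lemma swept_sym:
  assumes "\<zeta> \<in> \<Omega>" "\<xi> \<in> \<Omega>"
  shows "swept \<zeta> \<xi> = swept \<xi> \<zeta>"
proof -
  have le: "swept \<zeta> \<xi> \<le> swept \<xi> \<zeta>" if \<zeta>: "\<zeta> \<in> \<Omega>" and \<xi>: "\<xi> \<in> \<Omega>" for \<zeta> \<xi>
    unfolding swept_def[of \<xi>]
  proof (rule INF_greatest)
    fix n
    have "swept \<zeta> \<xi> = (walk ^^ n) (swept \<zeta>) \<xi>"
      by (rule walkn_fixed[symmetric, OF _ \<xi>]) (simp add: walk_def avg_swept \<zeta>)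
    also have "\<dots> \<le> iter n \<xi> \<zeta>"
      unfolding iter_def by (rule walkn_mono[OF _ \<xi>]) (metis pole_sym swept_le_pole)
    finally show "swept \<zeta> \<xi> \<le> iter n \<xi> \<zeta>" .
  qed
  show ?thesis using assms by (intro antisym le)
qed

subsection \<open>Boundary values\<close>

text \<open>The barrier \<open>r\<^sup>-\<^sup>2 - \<rho>(\<eta>\<^sup>-\<^sup>1\<xi>)\<^sup>-\<^sup>2\<close> of an exterior ball is invariant under the walk because its pole
  lies outside the domain. A lower bound of the pole by a multiple of it therefore survives all
  iterations. Symmetry turns this into a statement about the second variable.\<close>

lemma swept_barrier:
  assumes \<zeta>: "\<zeta> \<in> \<Omega>" and \<eta>: "hball \<eta> r \<inter> \<Omega> = {}" and r: "0 < r" and C: "0 \<le> C"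
    and near: "\<And>\<xi>. \<xi> \<in> \<Omega> \<Longrightarrow> \<xi> \<noteq> \<zeta> \<Longrightarrow> a + C * (1 / (hdist \<eta> \<xi>)\<^sup>2 - 1 / r\<^sup>2) \<le> 1 / (hdist \<zeta> \<xi>)\<^sup>2"
    and a: "0 \<le> a" and \<xi>: "\<xi> \<in> \<Omega>"
  shows "a + C * (1 / (hdist \<eta> \<xi>)\<^sup>2 - 1 / r\<^sup>2) \<le> enn2real (swept \<zeta> \<xi>)"
proof -
  have "\<eta> \<in> hball \<eta> r" using r by (simp add: hball_def)
  hence \<eta>_out: "\<eta> \<notin> \<Omega>" using \<eta> by blast
  have ne: "\<eta> \<noteq> \<xi>'" if "\<xi>' \<in> \<Omega>" for \<xi>' using that \<eta>_out by auto
  have pw: "ennreal a + ennreal C * pole \<eta> \<xi>' \<le> pole \<zeta> \<xi>' + ennreal (C / r\<^sup>2)" if x: "\<xi>' \<in> \<Omega>" for \<xi>'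
  proof (cases "\<xi>' = \<zeta>")
    case True thus ?thesis by (simp add: pole_def hN_def)
  next
    case False
    have "ennreal a + ennreal C * pole \<eta> \<xi>' = ennreal (a + C * (1 / (hdist \<eta> \<xi>')\<^sup>2))"
      using a C ne[OF x] by (simp add: pole_real ennreal_mult[symmetric] ennreal_plus[symmetric] del: ennreal_plus)
    also have "\<dots> \<le> ennreal (1 / (hdist \<zeta> \<xi>')\<^sup>2 + C / r\<^sup>2)"
      using near[OF x False] by (intro ennreal_leI) (simp add: algebra_simps)
    also have "\<dots> = pole \<zeta> \<xi>' + ennreal (C / r\<^sup>2)"
      using C False by (simp add: pole_real)
    finally show ?thesis .
  qed
  have le: "ennreal a + ennreal C * pole \<eta> \<xi> \<le> iter n \<xi> \<zeta> + ennreal (C / r\<^sup>2)" for n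
  proof -
    have "ennreal a + ennreal C * pole \<eta> \<xi> = (walk ^^ n) (\<lambda>\<xi>. ennreal a + ennreal C * pole \<eta> \<xi>) \<xi>"
      by (simp add: walkn_add walkn_const walkn_cmult walkn_fixed[OF walk_pole_out[OF \<eta>_out] \<xi>])
    also have "\<dots> \<le> (walk ^^ n) (\<lambda>\<xi>. pole \<zeta> \<xi> + ennreal (C / r\<^sup>2)) \<xi>"
      by (rule walkn_mono[OF pw \<xi>])
    also have "\<dots> = iter n \<xi> \<zeta> + ennreal (C / r\<^sup>2)"
      by (simp add: walkn_add walkn_const iter_def)
    finally show ?thesis .
  qed
  have 1: "ennreal a + ennreal C * pole \<eta> \<xi> \<le> swept \<xi> \<zeta> + ennreal (C / r\<^sup>2)"
    by (rule LIMSEQ_le_const[OF tendsto_add[OF iter_tendsto tendsto_const]]) (use le in auto)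
  obtain B where B: "\<And>\<xi>'. swept \<xi> \<xi>' \<le> ennreal B" using swept_bound[OF \<xi>] by blast
  have "swept \<xi> \<zeta> < top" by (rule le_less_trans[OF B]) simp
  hence "swept \<xi> \<zeta> = ennreal (enn2real (swept \<xi> \<zeta>))" by simp
  hence rhs: "swept \<xi> \<zeta> + ennreal (C / r\<^sup>2) = ennreal (enn2real (swept \<xi> \<zeta>) + C / r\<^sup>2)"
    using C by (metis divide_nonneg_nonneg enn2real_nonneg ennreal_plus zero_le_power2)
  have lhs: "ennreal a + ennreal C * pole \<eta> \<xi> = ennreal (a + C * (1 / (hdist \<eta> \<xi>)\<^sup>2))"
    using a C ne[OF \<xi>] by (simp add: pole_real ennreal_mult[symmetric] ennreal_plus[symmetric] del: ennreal_plus)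
  have "a + C * (1 / (hdist \<eta> \<xi>)\<^sup>2) \<le> enn2real (swept \<xi> \<zeta>) + C / r\<^sup>2"
    using 1 C unfolding lhs rhs by (subst (asm) ennreal_le_iff) auto
  thus ?thesis by (simp add: swept_sym[OF \<zeta> \<xi>] algebra_simps)
qed

end

section \<open>Calculus of \<open>C\<^sup>k\<close> functions\<close>

lemma Ck_on_cong:
  assumes "open S" "\<And>p. p \<in> S \<Longrightarrow> f p = g p"
  shows "Ck_on k S f \<longleftrightarrow> Ck_on k S g"
proof -
  have "Ck_on k S g" if "Ck_on k S f" "\<And>p. p \<in> S \<Longrightarrow> f p = g p" for f g :: "'a \<Rightarrow> real"
    using that
  proof (induction k arbitrary: f g)
    case 0
    thus ?case using continuous_on_cong[of S S f g] by simp
  next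
    case (Suc k)
    have d: "(g has_derivative frechet_derivative f (at p)) (at p)" if p: "p \<in> S" for p
    proof (rule has_derivative_transform_within_open[OF _ assms(1) p])
      show "(f has_derivative frechet_derivative f (at p)) (at p)"
        using Suc.prems p by (simp flip: frechet_derivative_works)
    qed (rule Suc.prems)
    have "Ck_on k S (\<lambda>p. frechet_derivative g (at p) b)" if b: "b \<in> Basis" for b
    proof (rule Suc.IH[of "\<lambda>p. frechet_derivative f (at p) b"])
      show "Ck_on k S (\<lambda>p. frechet_derivative f (at p) b)" using Suc.prems b by simp
      show "frechet_derivative f (at p) b = frechet_derivative g (at p) b" if "p \<in> S" for p
        using frechet_derivative_at[OF d[OF that]] by simp
    qed
    thus ?case using d by (auto simp: differentiable_def)
  qed
  from this[of f g] this[of g f] show ?thesis using assms(2) by auto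
qed

lemma Ck_on_SucI:
  assumes S: "open S" and d: "\<And>p. p \<in> S \<Longrightarrow> (f has_derivative D p) (at p)"
    and k: "\<And>b. b \<in> Basis \<Longrightarrow> Ck_on k S (\<lambda>p. D p b)"
  shows "Ck_on (Suc k) S f"
proof -
  have "Ck_on k S (\<lambda>p. frechet_derivative f (at p) b)" if "b \<in> Basis" for b
    by (subst Ck_on_cong[OF S, of _ "\<lambda>p. D p b"]) (use k that frechet_derivative_at[OF d] in auto)
  thus ?thesis using d by (auto simp: differentiable_def)
qed

lemma Ck_on_SucD:
  assumes "Ck_on (Suc k) S f"
  shows "p \<in> S \<Longrightarrow> (f has_derivative frechet_derivative f (at p)) (at p)"
    and "b \<in> Basis \<Longrightarrow> Ck_on k S (\<lambda>p. frechet_derivative f (at p) b)"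
  using assms by (auto simp flip: frechet_derivative_works)

lemma Ck_on_lower: "Ck_on (Suc k) S f \<Longrightarrow> Ck_on k S f"
proof (induction k arbitrary: f)
  case 0
  thus ?case by (auto intro: differentiable_imp_continuous_on differentiable_at_imp_differentiable_on)
next
  case (Suc k)
  thus ?case by (metis Ck_on.simps(2))
qed

lemma Ck_on_subset: "Ck_on k S f \<Longrightarrow> T \<subseteq> S \<Longrightarrow> Ck_on k T f"
  by (induction k arbitrary: f) (auto intro: continuous_on_subset)

lemma Ck_on_imp_continuous: "Ck_on k S f \<Longrightarrow> continuous_on S f"
  by (induction k) (use Ck_on_lower in auto)

lemma Ck_on_local:
  assumes "\<And>p. p \<in> S \<Longrightarrow> \<exists>V. open V \<and> p \<in> V \<and> Ck_on k V f"
  shows "Ck_on k S f"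
  using assms
proof (induction k arbitrary: f)
  case 0
  have "isCont f p" if "p \<in> S" for p
    using 0[OF that] by (auto simp: continuous_on_eq_continuous_at)
  thus ?case by (simp add: continuous_at_imp_continuous_on)
next
  case (Suc k)
  have "Ck_on k S (\<lambda>p. frechet_derivative f (at p) b)" if "b \<in> Basis" for b
    by (rule Suc.IH) (use Suc.prems that in fastforce)
  thus ?case using Suc.prems by fastforce
qed

lemma Ck_on_const: "Ck_on k S (\<lambda>_. c)"
proof (induction k arbitrary: c)
  case (Suc k)
  have "frechet_derivative (\<lambda>_::'a. c) (at p) b = 0" for p b
    using frechet_derivative_at[OF has_derivative_const[of c "at p"]] by metis
  thus ?case using Suc by simp
qed simp

lemma Ck_on_linear:
  assumes "bounded_linear f" shows "Ck_on k UNIV f"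
proof (cases k)
  case 0 thus ?thesis using linear_continuous_on[OF assms] by simp
next
  case (Suc j)
  show ?thesis unfolding Suc
    by (rule Ck_on_SucI[of _ _ "\<lambda>_. f"]) (auto intro: bounded_linear_imp_has_derivative assms Ck_on_const)
qed

lemma Ck_on_add:
  assumes "open S" shows "Ck_on k S f \<Longrightarrow> Ck_on k S g \<Longrightarrow> Ck_on k S (\<lambda>p. f p + g p)"
proof (induction k arbitrary: f g)
  case (Suc k)
  show ?case
    by (rule Ck_on_SucI[OF assms has_derivative_add[OF Ck_on_SucD(1)[OF Suc.prems(1)] Ck_on_SucD(1)[OF Suc.prems(2)]]])
       (auto intro: Suc.IH Ck_on_SucD(2)[OF Suc.prems(1)] Ck_on_SucD(2)[OF Suc.prems(2)])
qed (simp add: continuous_on_add)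

lemma Ck_on_mult:
  assumes "open S" shows "Ck_on k S f \<Longrightarrow> Ck_on k S g \<Longrightarrow> Ck_on k S (\<lambda>p. f p * g p)"
proof (induction k arbitrary: f g)
  case (Suc k)
  show ?case
    by (rule Ck_on_SucI[OF assms has_derivative_mult[OF Ck_on_SucD(1)[OF Suc.prems(1)] Ck_on_SucD(1)[OF Suc.prems(2)]]])
       (auto intro!: Suc.IH Ck_on_add[OF assms] Ck_on_lower[OF Suc.prems(1)] Ck_on_lower[OF Suc.prems(2)]
         Ck_on_SucD(2)[OF Suc.prems(1)] Ck_on_SucD(2)[OF Suc.prems(2)])
qed (simp add: continuous_on_mult)

lemma Ck_on_minus: "open S \<Longrightarrow> Ck_on k S f \<Longrightarrow> Ck_on k S (\<lambda>p. - f p)"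
  using Ck_on_mult[OF _ Ck_on_const[of k S "- 1"], of f] by simp

lemma Ck_on_diff: "open S \<Longrightarrow> Ck_on k S f \<Longrightarrow> Ck_on k S g \<Longrightarrow> Ck_on k S (\<lambda>p. f p - g p)"
  using Ck_on_add[OF _ _ Ck_on_minus, of S k f g] by simp

lemma Ck_on_flat_exp:
  assumes "open S" shows "Ck_on k S f \<Longrightarrow> Ck_on k S (\<lambda>p. flat_exp m (f p))"
proof (induction k arbitrary: m)
  case 0
  thus ?case by (simp add: continuous_on_flat_exp)
next
  case (Suc k)
  show ?case
  proof (rule Ck_on_SucI[OF assms, where D = "\<lambda>p h. (flat_exp (m + 2) (f p) +
      - real m * flat_exp (m + 1) (f p)) * frechet_derivative f (at p) h"])
    fix p assume "p \<in> S"
    show "((\<lambda>p. flat_exp m (f p)) has_derivative (\<lambda>h. (flat_exp (m + 2) (f p) + - real m * flat_exp (m + 1) (f p)) *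
        frechet_derivative f (at p) h)) (at p)"
      using has_derivative_compose[OF Ck_on_SucD(1)[OF Suc.prems \<open>p \<in> S\<close>] flat_exp_deriv[unfolded has_field_derivative_def, of m]]
      by (simp add: algebra_simps)
  next
    show "Ck_on k S (\<lambda>p. (flat_exp (m + 2) (f p) + - real m * flat_exp (m + 1) (f p)) * frechet_derivative f (at p) b)"
      if "b \<in> Basis" for b
      by (intro Ck_on_mult Ck_on_add Suc.IH Ck_on_const Ck_on_lower[OF Suc.prems] Ck_on_SucD(2)[OF Suc.prems that] assms)
  qed
qed

lemma bounded_linear_coord:
  "bounded_linear (\<lambda>p::heis. fst p)" "bounded_linear (\<lambda>p::heis. fst (snd p))" "bounded_linear (\<lambda>p::heis. snd (snd p))"
  by (auto intro: bounded_linear_fst bounded_linear_snd bounded_linear_compose)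

lemma Ck_on_hquart_left:
  "Ck_on k UNIV (\<lambda>x. zsq (hmult (hinv (fst x)) (snd x)))" "Ck_on k UNIV (\<lambda>x. hquart (hmult (hinv (fst x)) (snd x)))"
proof -
  note lin = bounded_linear_coord[THEN bounded_linear_compose, OF bounded_linear_fst]
     bounded_linear_coord[THEN bounded_linear_compose, OF bounded_linear_snd]
  note c = lin[THEN Ck_on_linear]
  note intros = Ck_on_add[OF open_UNIV] Ck_on_mult[OF open_UNIV] Ck_on_minus[OF open_UNIV]
    Ck_on_diff[OF open_UNIV] Ck_on_const c
  show 1: "Ck_on k UNIV (\<lambda>x. zsq (hmult (hinv (fst x)) (snd x)))"
    unfolding zsq_def hmult_eq hinv_eq fst_conv snd_conv power2_eq_square
    by (intro intros)
  have 2: "Ck_on k UNIV (\<lambda>x. snd (snd (hmult (hinv (fst x)) (snd x))))"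
    unfolding hmult_eq hinv_eq fst_conv snd_conv
    by (intro intros)
  show "Ck_on k UNIV (\<lambda>x. hquart (hmult (hinv (fst x)) (snd x)))"
    unfolding hquart_def power2_eq_square by (intro intros 1 2)
qed

lemma Ck_on_kern_left:
  "Ck_on k UNIV (\<lambda>x. kern s (hmult (hinv (fst x)) (snd x)))"
proof -
  note intros = Ck_on_add[OF open_UNIV] Ck_on_mult[OF open_UNIV] Ck_on_const Ck_on_hquart_left
    Ck_on_flat_exp[OF open_UNIV]
  have "(\<lambda>x. kern s (hmult (hinv (fst x)) (snd x))) = (\<lambda>x. zsq (hmult (hinv (fst x)) (snd x)) *
     flat_exp 2 (1 + (- 1 / s ^ 4) * hquart (hmult (hinv (fst x)) (snd x))) * (1 / s ^ 6))"
    by (simp add: kern_def gprof_def fun_eq_iff)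
  thus ?thesis by (simp only:) (intro intros)
qed

text \<open>Differentiation under the integral sign in all orders at once: the partial derivatives in the first
  variable are again of the same form.\<close>

lemma Ck_on_integral:
  fixes \<kappa> :: "'a::euclidean_space \<times> 'b::euclidean_space \<Rightarrow> real"
  assumes h: "continuous_on (cbox a b) h"
  shows "Ck_on k UNIV \<kappa> \<Longrightarrow> Ck_on k UNIV (\<lambda>x. integral (cbox a b) (\<lambda>y. h y * \<kappa> (x, y)))"
proof (induction k arbitrary: \<kappa>)
  case 0
  have "continuous_on (UNIV \<times> cbox a b) (\<lambda>(x, y). h y * \<kappa> (x, y))"
    unfolding case_prod_beta using 0
    by (intro continuous_on_mult continuous_on_compose2[OF h continuous_on_snd[OF continuous_on_id]])
       (auto intro: continuous_on_subset)
  thus ?case by (simp add: integral_continuous_on_param)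
next
  case (Suc k)
  define D where "D x y b = frechet_derivative \<kappa> (at (x, y)) (b, 0)" for x y b
  have der: "(\<kappa> has_derivative frechet_derivative \<kappa> (at z)) (at z)" for z
    by (rule Ck_on_SucD(1)[OF Suc.prems]) simp
  have derx: "((\<lambda>x. h y * \<kappa> (x, y)) has_derivative (\<lambda>v. h y * D x y v)) (at x)" for x y
  proof -
    have "((\<lambda>x. (x, y)) has_derivative (\<lambda>v. (v, 0))) (at x)" by (auto intro!: derivative_eq_intros)
    from has_derivative_compose[OF this der] show ?thesis
      unfolding D_def by (rule has_derivative_mult_right)
  qed
  have bl: "bounded_linear (\<lambda>v. h y * D x y v)" for x y
    by (rule has_derivative_bounded_linear[OF derx])
  define fx where "fx x y = Blinfun (\<lambda>v. h y * D x y v)" for x y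
  have fx: "blinfun_apply (fx x y) = (\<lambda>v. h y * D x y v)" for x y
    unfolding fx_def by (rule bounded_linear_Blinfun_apply[OF bl])
  have Dk: "Ck_on k UNIV (\<lambda>z. D (fst z) (snd z) v)" if "v \<in> Basis" for v
    using Ck_on_SucD(2)[OF Suc.prems, of "(v, 0)"] that by (simp add: D_def Basis_prod_def)
  have cont: "continuous_on (UNIV \<times> cbox a b) (\<lambda>(x, y). fx x y)"
  proof (rule continuous_on_blinfun_componentwise)
    fix v :: 'a assume v: "v \<in> Basis"
    have "continuous_on (UNIV \<times> cbox a b) (\<lambda>z. h (snd z) * D (fst z) (snd z) v)"
      using Ck_on_imp_continuous[OF Dk[OF v]]
      by (intro continuous_on_mult continuous_on_compose2[OF h continuous_on_snd[OF continuous_on_id]])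
         (auto intro: continuous_on_subset)
    thus "continuous_on (UNIV \<times> cbox a b) (\<lambda>z. blinfun_apply (case z of (x, y) \<Rightarrow> fx x y) v)"
      by (simp add: case_prod_beta fx)
  qed
  have "((\<lambda>x. integral (cbox a b) (\<lambda>y. h y * \<kappa> (x, y))) has_derivative
      blinfun_apply (integral (cbox a b) (fx x))) (at x)" for x
  proof -
    have "((\<lambda>x. integral (cbox a b) (\<lambda>y. h y * \<kappa> (x, y))) has_derivative
        blinfun_apply (integral (cbox a b) (fx x))) (at x within UNIV)"
    proof (rule leibniz_rule[OF _ _ cont])
      show "((\<lambda>x. h y * \<kappa> (x, y)) has_derivative blinfun_apply (fx x y)) (at x within UNIV)" for x y
        unfolding fx by (simp add: derx)
      show "(\<lambda>y. h y * \<kappa> (x, y)) integrable_on cbox a b" for x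
      proof (rule integrable_continuous, intro continuous_on_mult h)
        show "continuous_on (cbox a b) (\<lambda>y. \<kappa> (x, y))"
          by (rule continuous_on_compose2[OF Ck_on_imp_continuous[OF Suc.prems]]) (auto intro!: continuous_intros)
      qed
    qed auto
    thus ?thesis by simp
  qed
  moreover have "blinfun_apply (integral (cbox a b) (fx x)) v = integral (cbox a b) (\<lambda>y. h y * D x y v)" for x v
  proof -
    have "continuous_on (cbox a b) (fx x)"
    proof -
      have "continuous_on (cbox a b) (\<lambda>y. (x, y))" by (intro continuous_intros)
      moreover have "(\<lambda>y. (x, y)) ` cbox a b \<subseteq> UNIV \<times> cbox a b" by auto
      ultimately show ?thesis using continuous_on_compose2[OF cont, of "cbox a b" "\<lambda>y. (x, y)"] by simp
    qed
    hence "fx x integrable_on cbox a b" by (rule integrable_continuous)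
    from integral_linear[OF this blinfun.bounded_linear_left[of v]] show ?thesis by (simp add: o_def fx)
  qed
  ultimately show ?case
    by (intro Ck_on_SucI[of _ _ "\<lambda>x. blinfun_apply (integral (cbox a b) (fx x))"])
       (use Suc.IH[OF Dk] in auto)
qed

subsection \<open>Horizontal derivatives of differentiable functions\<close>

text \<open>The left-invariant field generated by \<open>v\<close> at the point \<open>p\<close>; for the two basis vectors it gives \<open>X\<close> and
  \<open>Y\<close>.\<close>

definition hfield :: "heis \<Rightarrow> heis \<Rightarrow> heis" where
  "hfield v p = (fst v, fst (snd v), 2 * (fst v * fst (snd p) - fst (snd v) * fst p))"

definition hdir :: "heis \<Rightarrow> (heis \<Rightarrow> real) \<Rightarrow> heis \<Rightarrow> real" where
  "hdir v u p = frechet_derivative u (at p) (hfield v p)"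

lemma hX_eq: "hX u p = hdir e1 u p" and hY_eq: "hY u p = hdir e2 u p"
  by (cases p, simp add: hdir_def hfield_def e1_def e2_def)+

lemma hlaplace_eq: "hlaplace u p = hdir e1 (hdir e1 u) p + hdir e2 (hdir e2 u) p"
  unfolding hlaplace_def hX_eq[abs_def] hY_eq[abs_def] hX_eq hY_eq by simp

lemma hmult_eq_line: "snd (snd v) = 0 \<Longrightarrow> hmult p (h *\<^sub>R v) = p + h *\<^sub>R hfield v p"
  by (cases p; cases v) (simp add: hmult_eq hfield_def algebra_simps)

lemma has_hderiv_hdir:
  assumes "snd (snd v) = 0" "u differentiable (at p)"
  shows "has_hderiv v u (hdir v u p) p"
proof -
  have u: "(u has_derivative frechet_derivative u (at p)) (at (p + 0 *\<^sub>R hfield v p))"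
    using assms(2) by (simp flip: frechet_derivative_works)
  have "((\<lambda>h. p + h *\<^sub>R hfield v p) has_derivative (\<lambda>h. h *\<^sub>R hfield v p)) (at 0)"
    by (auto intro!: derivative_eq_intros)
  from has_derivative_compose[OF this u]
  have "((\<lambda>h. u (p + h *\<^sub>R hfield v p)) has_derivative (\<lambda>h. frechet_derivative u (at p) (h *\<^sub>R hfield v p))) (at 0)" .
  moreover have "frechet_derivative u (at p) (h *\<^sub>R hfield v p) = hdir v u p * h" for h
    using linear_scale[OF linear_frechet_derivative[OF assms(2)]] by (simp add: hdir_def mult.commute)
  ultimately show ?thesis
    unfolding has_hderiv_def hmult_eq_line[OF assms(1)] has_field_derivative_def by simp
qed

lemma Ck_on_hdir:
  assumes S: "open S" and u: "Ck_on (Suc k) S u"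
  shows "Ck_on k S (hdir v u)"
proof -
  have dec: "hdir v u p = fst v * frechet_derivative u (at p) (1, 0, 0) + fst (snd v) * frechet_derivative u (at p) (0, 1, 0) +
     (2 * fst v * fst (snd p) + (- 2 * fst (snd v)) * fst p) * frechet_derivative u (at p) (0, 0, 1)" if "p \<in> S" for p
  proof -
    have lin: "linear (frechet_derivative u (at p))" using u that by (simp add: linear_frechet_derivative)
    have "hfield v p = fst v *\<^sub>R (1, 0, 0) + fst (snd v) *\<^sub>R (0, 1, 0) +
       (2 * fst v * fst (snd p) + (- 2 * fst (snd v)) * fst p) *\<^sub>R (0, 0, 1)"
      by (simp add: hfield_def)
    thus ?thesis unfolding hdir_def by (simp only: linear_add[OF lin] linear_scale[OF lin] real_scaleR_def)
  qed
  have B: "(1, 0, 0) \<in> (Basis :: heis set)" "(0, 1, 0) \<in> (Basis :: heis set)" "(0, 0, 1) \<in> (Basis :: heis set)"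
    by (auto simp: Basis_prod_def zero_prod_def)
  have c: "Ck_on k S (\<lambda>p. fst p)" "Ck_on k S (\<lambda>p. fst (snd p))"
    using bounded_linear_coord[THEN Ck_on_linear, THEN Ck_on_subset] by auto
  show ?thesis
    by (subst Ck_on_cong[OF S dec], assumption)
       (intro Ck_on_add[OF S] Ck_on_mult[OF S] Ck_on_const c B[THEN Ck_on_SucD(2)[OF u]])
qed

lemma Ck_on_2_horiz_C2:
  assumes S: "open S" and u: "Ck_on 2 S u"
  shows "horiz_C2 S u (\<lambda>v. hdir v u) (\<lambda>v. hdir v (hdir v u))"
proof -
  have u': "Ck_on (Suc 1) S u" "Ck_on (Suc (Suc 0)) S u" using u by (simp_all add: numeral_2_eq_2)
  have 1: "Ck_on (Suc 0) S (hdir v u)" for v using Ck_on_hdir[OF S u'(2)] .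
  have 2: "Ck_on 0 S (hdir v (hdir v u))" for v using Ck_on_hdir[OF S 1] .
  show ?thesis unfolding horiz_C2_def
  proof (intro conjI ballI S)
    show "continuous_on S u" using Ck_on_imp_continuous[OF u] .
    fix v assume v: "v \<in> {e1, e2}"
    show "continuous_on S (hdir v u)" "continuous_on S (hdir v (hdir v u))"
      using 1 2 Ck_on_imp_continuous by blast+
    fix p assume p: "p \<in> S"
    show "has_hderiv v u (hdir v u p) p"
      by (rule has_hderiv_hdir[OF horizontal_e[OF v]]) (use u'(1) p in simp)
    show "has_hderiv v (hdir v u) (hdir v (hdir v u) p) p"
      by (rule has_hderiv_hdir[OF horizontal_e[OF v]]) (use 1 p in simp)
  qed
qed

section \<open>Solving the Dirichlet problem\<close>

context heis_domain begin

definition sol :: "heis \<Rightarrow> heis \<Rightarrow> real" where "sol \<zeta> \<xi> = enn2real (swept \<zeta> \<xi>)"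

lemma sol_ennreal: assumes "\<zeta> \<in> \<Omega>" shows "ennreal (sol \<zeta> \<xi>) = swept \<zeta> \<xi>"
proof -
  obtain B where B: "\<And>\<xi>. swept \<zeta> \<xi> \<le> ennreal B" using swept_bound[OF assms] by blast
  have "swept \<zeta> \<xi> < top" by (rule le_less_trans[OF B]) simp
  thus ?thesis by (simp add: sol_def)
qed

lemma sol_nonneg [simp]: "0 \<le> sol \<zeta> \<xi>" by (simp add: sol_def)

lemma measurable_sol [measurable]: "sol \<zeta> \<in> borel_measurable borel"
  unfolding sol_def[abs_def] by measurable

lemma rad_ge_quarter:
  assumes "hdist \<xi>0 \<xi> \<le> rad \<xi>0 / 4"
  shows "rad \<xi>0 / 4 \<le> rad \<xi>"
  using rad_lipschitz[of \<xi>0 \<xi>] assms rad_nonneg[of \<xi>0] by linarith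

lemma swept_kern:
  assumes "\<zeta> \<in> \<Omega>" "\<xi> \<in> \<Omega>" "0 < s" "s \<le> rad \<xi>"
  shows "swept \<zeta> \<xi> = (\<integral>\<^sup>+\<eta>. swept \<zeta> \<eta> * ennreal (kern s (hmult (hinv \<xi>) \<eta>) / wmass) \<partial>lborel)"
proof -
  have [measurable]: "kern s \<in> borel_measurable borel"
    using assms by (intro borel_measurable_continuous_onI continuous_intros)
  have "swept \<zeta> \<xi> = avg s (swept \<zeta>) \<xi>" by (rule avg_swept[symmetric]) (use assms in auto)
  also have "\<dots> = (\<integral>\<^sup>+p. swept \<zeta> (hmult \<xi> p) * ennreal (kern s p / wmass) \<partial>lborel)"
    by (rule avg_kern) (use assms in auto)
  also have "\<dots> = (\<integral>\<^sup>+p. swept \<zeta> (hmult \<xi> (hmult (hinv \<xi>) p)) * ennreal (kern s (hmult (hinv \<xi>) p) / wmass) \<partial>lborel)"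
    by (rule nn_integral_hmult_left[symmetric]) measurable
  finally show ?thesis by simp
qed

lemma kern_le: "0 < s \<Longrightarrow> kern s p \<le> 2 / s ^ 4"
  using wker_bound[of "hdil (1 / s) p"] kern_hdil[of s "hdil (1 / s) p"] by (simp add: hdil_hdil field_simps)

text \<open>Near a point the mean value property holds with one fixed radius, so the function is locally the
  convolution of a bounded function with a continuous kernel.\<close>

lemma continuous_on_sol:
  assumes \<zeta>: "\<zeta> \<in> \<Omega>"
  shows "continuous_on \<Omega> (sol \<zeta>)"
proof (rule continuous_at_imp_continuous_on, rule ballI)
  fix \<xi>0 assume \<xi>0: "\<xi>0 \<in> \<Omega>"
  define s where "s = rad \<xi>0 / 4"
  have s: "0 < s" using rad_pos[OF \<xi>0] by (simp add: s_def)
  obtain B where B: "\<And>\<xi>. swept \<zeta> \<xi> \<le> ennreal B" using swept_bound[OF \<zeta>] by blast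
  define W where "W = 2 / s ^ 4 / wmass"
  define w where "w \<eta> = ennreal B * ennreal W * indicator {\<eta>. hdist \<xi>0 \<eta> \<le> 2 * s} \<eta>" for \<eta>
  have comp: "compact {\<eta>. hdist \<xi>0 \<eta> \<le> 2 * s}" by (rule compact_hcball)
  hence Km [measurable]: "{\<eta>. hdist \<xi>0 \<eta> \<le> 2 * s} \<in> sets borel" by (intro borel_compact)
  have wfin: "(\<integral>\<^sup>+\<eta>. w \<eta> \<partial>lborel) < \<infinity>"
    unfolding w_def using emeasure_compact_finite[OF comp]
    by (subst nn_integral_cmult) (auto simp: ennreal_mult_less_top)
  have in_dom: "\<xi> \<in> \<Omega> \<and> s \<le> rad \<xi>" if "hdist \<xi>0 \<xi> \<le> s" for \<xi>
    using rad_ge_quarter[of \<xi>0 \<xi>] that s rad_eq_0[of \<xi>] unfolding s_def by force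
  have ks [measurable]: "kern s \<in> borel_measurable borel"
    using s by (intro borel_measurable_continuous_onI continuous_intros)
  have "sol \<zeta> \<midarrow>\<xi>0\<rightarrow> sol \<zeta> \<xi>0"
    unfolding LIMSEQ_SEQ_conv[symmetric]
  proof (intro allI impI)
    fix X assume X: "(\<forall>n. X n \<noteq> \<xi>0) \<and> X \<longlonglongrightarrow> \<xi>0"
    have "continuous_on UNIV (\<lambda>\<xi>. hdist \<xi>0 \<xi>)" by (intro continuous_intros)
    hence "(\<lambda>n. hdist \<xi>0 (X n)) \<longlonglongrightarrow> hdist \<xi>0 \<xi>0"
      using X by (intro continuous_on_tendsto_compose[of UNIV "\<lambda>\<xi>. hdist \<xi>0 \<xi>"]) auto
    hence "\<forall>\<^sub>F n in sequentially. hdist \<xi>0 (X n) < s" using s by (intro order_tendstoD(2)) auto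
    then obtain N where N: "\<And>n. n \<ge> N \<Longrightarrow> hdist \<xi>0 (X n) < s" unfolding eventually_sequentially by blast
    define Y where "Y n = X (n + N)" for n
    have Yd: "hdist \<xi>0 (Y n) \<le> s" for n using N[of "n + N"] by (simp add: Y_def)
    have Y: "Y \<longlonglongrightarrow> \<xi>0" unfolding Y_def using X by (intro LIMSEQ_ignore_initial_segment) simp
    have "(\<lambda>n. \<integral>\<^sup>+\<eta>. swept \<zeta> \<eta> * ennreal (kern s (hmult (hinv (Y n)) \<eta>) / wmass) \<partial>lborel) \<longlonglongrightarrow>
        (\<integral>\<^sup>+\<eta>. swept \<zeta> \<eta> * ennreal (kern s (hmult (hinv \<xi>0) \<eta>) / wmass) \<partial>lborel)"
    proof (rule nn_integral_dominated_convergence[where w = w])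
      show "AE \<eta> in lborel. swept \<zeta> \<eta> * ennreal (kern s (hmult (hinv (Y n)) \<eta>) / wmass) \<le> w \<eta>" for n
      proof (rule AE_I2)
        fix \<eta>
        show "swept \<zeta> \<eta> * ennreal (kern s (hmult (hinv (Y n)) \<eta>) / wmass) \<le> w \<eta>"
        proof (cases "hdist \<xi>0 \<eta> \<le> 2 * s")
          case True
          have "ennreal (kern s (hmult (hinv (Y n)) \<eta>) / wmass) \<le> ennreal W"
            unfolding W_def using wmass_pos by (intro ennreal_leI divide_right_mono kern_le s) simp
          thus ?thesis using True B by (simp add: w_def mult_mono)
        next
          case False
          hence "s \<le> hrho (hmult (hinv (Y n)) \<eta>)"
            using hdist_triangle[of \<xi>0 \<eta> "Y n"] Yd[of n] by (simp add: hdist_def[of "Y n"])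
          thus ?thesis using s by (simp add: kern_eq_0)
        qed
      qed
      show "AE \<eta> in lborel. (\<lambda>n. swept \<zeta> \<eta> * ennreal (kern s (hmult (hinv (Y n)) \<eta>) / wmass)) \<longlonglongrightarrow>
          swept \<zeta> \<eta> * ennreal (kern s (hmult (hinv \<xi>0) \<eta>) / wmass)"
      proof (rule AE_I2)
        fix \<eta>
        have "continuous_on UNIV (\<lambda>\<xi>. kern s (hmult (hinv \<xi>) \<eta>) / wmass)"
          using s wmass_pos by (intro continuous_intros) auto
        hence "(\<lambda>n. kern s (hmult (hinv (Y n)) \<eta>) / wmass) \<longlonglongrightarrow> kern s (hmult (hinv \<xi>0) \<eta>) / wmass"
          using Y by (intro continuous_on_tendsto_compose[of UNIV "\<lambda>\<xi>. kern s (hmult (hinv \<xi>) \<eta>) / wmass"]) auto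
        moreover have "swept \<zeta> \<eta> \<noteq> top" using B[of \<eta>] by (auto simp: top_unique)
        ultimately show "(\<lambda>n. swept \<zeta> \<eta> * ennreal (kern s (hmult (hinv (Y n)) \<eta>) / wmass)) \<longlonglongrightarrow>
          swept \<zeta> \<eta> * ennreal (kern s (hmult (hinv \<xi>0) \<eta>) / wmass)"
          by (intro tendsto_mult_ennreal tendsto_const tendsto_ennrealI) auto
      qed
    qed (use wfin in \<open>auto simp: w_def[abs_def]\<close>)
    moreover have "(\<integral>\<^sup>+\<eta>. swept \<zeta> \<eta> * ennreal (kern s (hmult (hinv \<xi>) \<eta>) / wmass) \<partial>lborel) = swept \<zeta> \<xi>"
      if "hdist \<xi>0 \<xi> \<le> s" for \<xi>
      using swept_kern[OF \<zeta> _ s, of \<xi>] in_dom[OF that] by simp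
    ultimately have "(\<lambda>n. swept \<zeta> (Y n)) \<longlonglongrightarrow> swept \<zeta> \<xi>0" using Yd s by simp
    hence "(\<lambda>n. ennreal (sol \<zeta> (Y n))) \<longlonglongrightarrow> ennreal (sol \<zeta> \<xi>0)" by (simp add: sol_ennreal \<zeta>)
    hence "(\<lambda>n. sol \<zeta> (Y n)) \<longlonglongrightarrow> sol \<zeta> \<xi>0" by (subst (asm) tendsto_ennreal_iff) auto
    thus "(\<lambda>n. sol \<zeta> (X n)) \<longlonglongrightarrow> sol \<zeta> \<xi>0" unfolding Y_def by (rule LIMSEQ_offset)
  qed
  thus "isCont (sol \<zeta>) \<xi>0" by (simp add: isCont_def)
qed

lemma sol_mean:
  assumes \<zeta>: "\<zeta> \<in> \<Omega>" and \<xi>: "\<xi> \<in> \<Omega>" and s: "0 < s" "s \<le> rad \<xi>"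
  shows "(LINT p|lborel. sol \<zeta> (hmult \<xi> p) * kern s p) = sol \<zeta> \<xi> * wmass"
proof -
  have "ennreal ((LINT p|lborel. sol \<zeta> (hmult \<xi> p) * kern s p) / wmass) = avg s (\<lambda>p. ennreal (sol \<zeta> p)) \<xi>"
  proof (rule avg_real[symmetric, OF open_dom _ continuous_on_sol[OF \<zeta>]])
    show "{p. hrho p \<le> s} \<subseteq> hmult \<xi> -` \<Omega>" by (rule rad_ball[OF \<xi> s(2)])
  qed (use s in auto)
  also have "\<dots> = ennreal (sol \<zeta> \<xi>)"
    using avg_swept[OF \<zeta> \<xi>, of s] s by (simp add: sol_ennreal[OF \<zeta>])
  finally have "(LINT p|lborel. sol \<zeta> (hmult \<xi> p) * kern s p) / wmass = sol \<zeta> \<xi>"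
    using wmass_pos by (subst (asm) ennreal_inj) (auto intro!: divide_nonneg_pos)
  thus ?thesis using wmass_pos by (simp add: field_simps)
qed

text \<open>Smoothness is inherited from the kernel: a small ball fits in a box inside the domain, and over the
  box the integral can be differentiated.\<close>

lemma Ck_on_sol:
  assumes \<zeta>: "\<zeta> \<in> \<Omega>"
  shows "Ck_on k \<Omega> (sol \<zeta>)"
proof (rule Ck_on_local)
  fix \<xi>0 assume \<xi>0: "\<xi>0 \<in> \<Omega>"
  obtain a b where ab: "cbox a b \<subseteq> \<Omega>" "\<xi>0 \<in> box a b"
    using open_contains_cbox[OF open_dom \<xi>0] by (metis (no_types, lifting))
  obtain R where R: "0 < R" "{q. hdist \<xi>0 q \<le> R} \<subseteq> box a b"
    using open_contains_hcball[OF open_box ab(2)] .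
  define s where "s = min (R / 2) (rad \<xi>0 / 4)"
  have s: "0 < s" "2 * s \<le> R" "s \<le> rad \<xi>0 / 4" using R(1) rad_pos[OF \<xi>0] by (auto simp: s_def)
  define V where "V = hball \<xi>0 s"
  have V: "open V" "\<xi>0 \<in> V" using s by (simp_all add: V_def open_hball) (simp add: hball_def)
  have rep: "sol \<zeta> \<xi> = integral (cbox a b) (\<lambda>\<eta>. sol \<zeta> \<eta> * kern s (hmult (hinv \<xi>) \<eta>)) * (1 / wmass)" if \<xi>V: "\<xi> \<in> V" for \<xi>
  proof -
    have d: "hdist \<xi>0 \<xi> < s" using \<xi>V by (simp add: V_def hball_def)
    have rad: "s \<le> rad \<xi>" using rad_ge_quarter[of \<xi>0 \<xi>] d s by simp
    hence \<xi>: "\<xi> \<in> \<Omega>" using rad_eq_0[of \<xi>] s by force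
    define f where "f \<eta> = sol \<zeta> \<eta> * kern s (hmult (hinv \<xi>) \<eta>)" for \<eta>
    have far: "f \<eta> = 0" if "\<eta> \<notin> {q. hdist \<xi>0 q \<le> R}" for \<eta>
    proof -
      have "s \<le> hdist \<xi> \<eta>" using that hdist_triangle[of \<xi>0 \<eta> \<xi>] d s by simp
      thus ?thesis using s by (simp add: f_def hdist_def kern_eq_0)
    qed
    have ck: "continuous_on S (\<lambda>\<eta>. kern s (hmult (hinv \<xi>) \<eta>))" for S
      using s by (intro continuous_intros)
    have cf: "continuous_on UNIV f"
    proof (rule continuous_on_extend_0[OF open_dom _ _ _ far])
      show "closed {q. hdist \<xi>0 q \<le> R}" by (rule compact_imp_closed[OF compact_hcball])
      show "{q. hdist \<xi>0 q \<le> R} \<subseteq> \<Omega>" using R(2) ab(1) box_subset_cbox by blast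
      show "continuous_on \<Omega> f" unfolding f_def by (intro continuous_on_mult continuous_on_sol \<zeta> ck)
    qed
    have fm: "f \<in> borel_measurable borel" by (rule borel_measurable_continuous_onI[OF cf])
    have "integrable lborel (\<lambda>\<eta>. indicat_real {q. hdist \<xi>0 q \<le> R} \<eta> *\<^sub>R f \<eta>)"
      by (rule borel_integrable_compact[OF compact_hcball continuous_on_subset[OF cf]]) simp
    moreover have "(\<lambda>\<eta>. indicat_real {q. hdist \<xi>0 q \<le> R} \<eta> *\<^sub>R f \<eta>) = f"
    proof
      show "indicat_real {q. hdist \<xi>0 q \<le> R} \<eta> *\<^sub>R f \<eta> = f \<eta>" for \<eta>
        using far[of \<eta>] by (cases "\<eta> \<in> {q. hdist \<xi>0 q \<le> R}") simp_all
    qed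
    ultimately have "integrable lborel f" by simp
    hence "integral UNIV f = (LINT \<eta>|lborel. f \<eta>)" by (rule integral_lborel)
    moreover have "integral (cbox a b) f = integral UNIV f"
    proof (rule integral_spike_set)
      have "{x \<in> UNIV - cbox a b. f x \<noteq> 0} = {}" "{x \<in> cbox a b - UNIV. f x \<noteq> 0} = {}"
        using far R(2) box_subset_cbox[of a b] by blast+
      thus "negligible {x \<in> cbox a b - UNIV. f x \<noteq> 0}" "negligible {x \<in> UNIV - cbox a b. f x \<noteq> 0}"
        by (simp_all only: negligible_empty)
    qed
    moreover have "(LINT \<eta>|lborel. f \<eta>) = (LINT p|lborel. f (hmult \<xi> p))"
      by (rule integral_hmult_left[OF fm, symmetric])
    moreover have "(LINT p|lborel. f (hmult \<xi> p)) = sol \<zeta> \<xi> * wmass"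
      using sol_mean[OF \<zeta> \<xi> s(1) rad] by (simp add: f_def)
    ultimately have "integral (cbox a b) f = sol \<zeta> \<xi> * wmass" by simp
    thus ?thesis using wmass_pos unfolding f_def[abs_def] by simp
  qed
  have "Ck_on k UNIV (\<lambda>\<xi>. integral (cbox a b) (\<lambda>\<eta>. sol \<zeta> \<eta> * kern s (hmult (hinv (fst (\<xi>, \<eta>))) (snd (\<xi>, \<eta>)))))"
    by (rule Ck_on_integral[OF continuous_on_subset[OF continuous_on_sol[OF \<zeta>] ab(1)] Ck_on_kern_left])
  from Ck_on_subset[OF this subset_UNIV]
  have "Ck_on k V (\<lambda>\<xi>. integral (cbox a b) (\<lambda>\<eta>. sol \<zeta> \<eta> * kern s (hmult (hinv \<xi>) \<eta>)))"
    unfolding fst_conv snd_conv .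
  from Ck_on_mult[OF V(1) this Ck_on_const]
  have "Ck_on k V (\<lambda>\<xi>. integral (cbox a b) (\<lambda>\<eta>. sol \<zeta> \<eta> * kern s (hmult (hinv \<xi>) \<eta>)) * (1 / wmass))" .
  hence "Ck_on k V (sol \<zeta>)" by (subst Ck_on_cong[OF V(1) rep])
  thus "\<exists>V. open V \<and> \<xi>0 \<in> V \<and> Ck_on k V (sol \<zeta>)" using V by blast
qed

text \<open>The normalization \<open>1 / 8\<pi>\<close> of the fundamental solution.\<close>

definition Hsol :: "heis \<Rightarrow> heis \<Rightarrow> real" where "Hsol \<zeta> \<xi> = sol \<zeta> \<xi> * (1 / (8 * pi))"

lemma hlaplace_Hsol:
  assumes \<zeta>: "\<zeta> \<in> \<Omega>" and \<xi>: "\<xi> \<in> \<Omega>"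
  shows "hlaplace (Hsol \<zeta>) \<xi> = 0"
proof -
  have C: "Ck_on 2 \<Omega> (Hsol \<zeta>)"
    unfolding Hsol_def[abs_def] by (intro Ck_on_mult Ck_on_const open_dom Ck_on_sol \<zeta>)
  note h = horiz_C2_left[OF Ck_on_2_horiz_C2[OF open_dom C], of \<xi>]
  have "hdir e1 (hdir e1 (Hsol \<zeta>)) (hmult \<xi> 0) + hdir e2 (hdir e2 (Hsol \<zeta>)) (hmult \<xi> 0) = 0"
  proof (rule mean_imp_harmonic[OF h, of "rad \<xi>"])
    show "0 < rad \<xi>" by (rule rad_pos[OF \<xi>])
    show "{p. hrho p \<le> rad \<xi>} \<subseteq> hmult \<xi> -` \<Omega>" by (rule rad_ball[OF \<xi> order_refl])
    show "(LINT p|lborel. Hsol \<zeta> (hmult \<xi> p) * kern R p) = Hsol \<zeta> \<xi> * wmass" if "0 < R" "R < rad \<xi>" for R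
    proof -
      have "(LINT p|lborel. Hsol \<zeta> (hmult \<xi> p) * kern R p) = (LINT p|lborel. (1 / (8 * pi)) * (sol \<zeta> (hmult \<xi> p) * kern R p))"
        by (simp add: Hsol_def)
      also have "\<dots> = (1 / (8 * pi)) * (sol \<zeta> \<xi> * wmass)"
        unfolding integral_mult_right_zero using sol_mean[OF \<zeta> \<xi>, of R] that by simp
      finally show ?thesis by (simp add: Hsol_def)
    qed
  qed
  thus ?thesis by (simp add: hlaplace_eq)
qed

lemma sol_le: "\<zeta> \<in> \<Omega> \<Longrightarrow> \<xi> \<noteq> \<zeta> \<Longrightarrow> sol \<zeta> \<xi> \<le> 1 / (hdist \<zeta> \<xi>)\<^sup>2"
proof -
  assume "\<zeta> \<in> \<Omega>" "\<xi> \<noteq> \<zeta>"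
  hence "ennreal (sol \<zeta> \<xi>) \<le> ennreal (1 / (hdist \<zeta> \<xi>)\<^sup>2)"
    using swept_le_pole[of \<zeta> \<xi>] hdist_sym[of \<zeta> \<xi>] by (simp add: sol_ennreal pole_real)
  thus ?thesis by (simp add: ennreal_le_iff)
qed

lemma sol_out: "\<zeta> \<in> \<Omega> \<Longrightarrow> \<xi> \<notin> \<Omega> \<Longrightarrow> sol \<zeta> \<xi> = 1 / (hdist \<zeta> \<xi>)\<^sup>2"
proof -
  assume a: "\<zeta> \<in> \<Omega>" "\<xi> \<notin> \<Omega>"
  hence "\<zeta> \<noteq> \<xi>" by auto
  thus ?thesis using a hdist_sym[of \<zeta> \<xi>] by (simp add: sol_def swept_out pole_real)
qed

lemma frontier_hball: "b \<in> frontier (hball \<eta> r) \<Longrightarrow> hdist \<eta> b = r"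
proof -
  assume b: "b \<in> frontier (hball \<eta> r)"
  have "closure (hball \<eta> r) \<subseteq> {q. hdist \<eta> q \<le> r}"
    by (rule closure_minimal) (auto simp: hball_def intro!: closed_Collect_le continuous_intros)
  moreover have "interior (hball \<eta> r) = hball \<eta> r" by (rule interior_open[OF open_hball])
  ultimately have "hdist \<eta> b \<le> r" "\<not> hdist \<eta> b < r"
    using b unfolding frontier_def hball_def by auto
  thus ?thesis by simp
qed

text \<open>A small exterior ball touching at \<open>b\<close> may touch the domain elsewhere, but only within twice its radius
  of \<open>b\<close>, where the boundary data are still close to their value at \<open>b\<close>. Beyond that distance the barrier is
  bounded below by a fixed multiple of \<open>r\<^sup>-\<^sup>2\<close>.\<close>

lemma sol_boundary_lower:
  assumes ext: "uniform_exterior_ball \<Omega>" and \<zeta>: "\<zeta> \<in> \<Omega>" and b: "b \<in> frontier \<Omega>"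
    and a: "0 \<le> a" "a < a'" "a' < 1 / (hdist \<zeta> b)\<^sup>2"
  shows "\<forall>\<^sub>F \<xi> in at b within \<Omega>. a < sol \<zeta> \<xi>"
proof -
  have b_out: "b \<notin> \<Omega>" using b open_dom by (simp add: frontier_def interior_open)
  have db: "0 < hdist \<zeta> b" by (rule hdist_pos) (use \<zeta> b_out in auto)
  have "open {\<xi>. a' * (hdist \<zeta> \<xi>)\<^sup>2 < 1}" by (intro open_Collect_less continuous_intros)
  moreover have "a' * (hdist \<zeta> b)\<^sup>2 < 1"
    using a(3) pos_less_divide_eq[of "(hdist \<zeta> b)\<^sup>2" a' 1] zero_less_power[OF db, of 2] by blast
  hence "b \<in> {\<xi>. a' * (hdist \<zeta> \<xi>)\<^sup>2 < 1}" by simp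
  ultimately obtain \<delta> where \<delta>: "0 < \<delta>" "{\<xi>. hdist b \<xi> \<le> \<delta>} \<subseteq> {\<xi>. a' * (hdist \<zeta> \<xi>)\<^sup>2 < 1}"
    using open_contains_hcball by blast
  obtain r0 where r0: "0 < r0" "\<And>r. 0 < r \<Longrightarrow> r \<le> r0 \<Longrightarrow> \<exists>\<eta>. hball \<eta> r \<inter> \<Omega> = {} \<and> b \<in> frontier (hball \<eta> r)"
    using ext b unfolding uniform_exterior_ball_def by blast
  define r where "r = min r0 (\<delta> / 4)"
  have r: "0 < r" "r \<le> r0" "4 * r \<le> \<delta>" using r0(1) \<delta>(1) by (auto simp: r_def)
  obtain \<eta> where \<eta>: "hball \<eta> r \<inter> \<Omega> = {}" "b \<in> frontier (hball \<eta> r)" using r0(2)[OF r(1,2)] by blast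
  have \<eta>b: "hdist \<eta> b = r" by (rule frontier_hball[OF \<eta>(2)])
  \<comment> \<open>At distance at least \<open>3r\<close> from \<open>\<eta>\<close> the barrier is at least \<open>8 / 9r\<^sup>2\<close>, so this multiple
    of it absorbs \<open>a'\<close>.\<close>
  define C where "C = 9 * r\<^sup>2 * a' / 8"
  have a': "0 \<le> a'" using a by simp
  have C: "0 \<le> C" using a' by (simp add: C_def)
  have far: "r \<le> hdist \<eta> \<xi>" if "\<xi> \<in> \<Omega>" for \<xi>
    using \<eta>(1) that unfolding hball_def by (metis (mono_tags, lifting) disjoint_iff mem_Collect_eq not_le)
  have near: "a' + C * (1 / (hdist \<eta> \<xi>)\<^sup>2 - 1 / r\<^sup>2) \<le> 1 / (hdist \<zeta> \<xi>)\<^sup>2" if \<xi>: "\<xi> \<in> \<Omega>" "\<xi> \<noteq> \<zeta>" for \<xi>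
  proof (cases "hdist b \<xi> \<le> \<delta>")
    case True
    hence "\<xi> \<in> {\<xi>. hdist b \<xi> \<le> \<delta>}" by simp
    from subsetD[OF \<delta>(2) this] have "a' * (hdist \<zeta> \<xi>)\<^sup>2 < 1" by simp
    moreover have "0 < hdist \<zeta> \<xi>" using \<xi> by (intro hdist_pos) auto
    ultimately have "a' \<le> 1 / (hdist \<zeta> \<xi>)\<^sup>2"
      using pos_le_divide_eq[of "(hdist \<zeta> \<xi>)\<^sup>2" a' 1] zero_less_power[of "hdist \<zeta> \<xi>" 2] by simp
    moreover have "1 / (hdist \<eta> \<xi>)\<^sup>2 \<le> 1 / r\<^sup>2"
      using far[OF \<xi>(1)] r by (intro divide_left_mono power_mono mult_pos_pos) auto
    hence "C * (1 / (hdist \<eta> \<xi>)\<^sup>2 - 1 / r\<^sup>2) \<le> 0" using C by (intro mult_nonneg_nonpos) auto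
    ultimately show ?thesis by linarith
  next
    case False
    hence "3 * r \<le> hdist \<eta> \<xi>" using hdist_triangle[of b \<xi> \<eta>] \<eta>b hdist_sym[of b \<eta>] r by simp
    hence "1 / (hdist \<eta> \<xi>)\<^sup>2 \<le> 1 / (3 * r)\<^sup>2"
      using r by (intro divide_left_mono power_mono mult_pos_pos) auto
    hence "C * (1 / (hdist \<eta> \<xi>)\<^sup>2 - 1 / r\<^sup>2) \<le> C * (1 / (3 * r)\<^sup>2 - 1 / r\<^sup>2)" using C by (intro mult_left_mono) auto
    also have "\<dots> = - a'" using r by (simp add: C_def field_simps power2_eq_square)
    finally have "a' + C * (1 / (hdist \<eta> \<xi>)\<^sup>2 - 1 / r\<^sup>2) \<le> 0" by simp
    thus ?thesis by (smt (verit) divide_nonneg_nonneg zero_le_power2)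
  qed
  have low: "a' + C * (1 / (hdist \<eta> \<xi>)\<^sup>2 - 1 / r\<^sup>2) \<le> sol \<zeta> \<xi>" if "\<xi> \<in> \<Omega>" for \<xi>
    unfolding sol_def by (rule swept_barrier[OF \<zeta> \<eta>(1) r(1) C near a' that])
  have ne: "\<eta> \<noteq> b" using \<eta>b r by auto
  have "continuous_on (- {\<eta>}) (\<lambda>\<xi>. a' + C * (1 / (hdist \<eta> \<xi>)\<^sup>2 - 1 / r\<^sup>2))"
    by (intro continuous_intros) auto
  moreover have "open (- {\<eta>})" by (rule open_Compl) simp
  ultimately have "isCont (\<lambda>\<xi>. a' + C * (1 / (hdist \<eta> \<xi>)\<^sup>2 - 1 / r\<^sup>2)) b"
    using ne by (simp add: continuous_on_eq_continuous_at)
  hence "((\<lambda>\<xi>. a' + C * (1 / (hdist \<eta> \<xi>)\<^sup>2 - 1 / r\<^sup>2)) \<longlongrightarrow> a') (at b)"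
    unfolding isCont_def \<eta>b by simp
  hence "\<forall>\<^sub>F \<xi> in at b. a < a' + C * (1 / (hdist \<eta> \<xi>)\<^sup>2 - 1 / r\<^sup>2)"
    using a(2) by (rule order_tendstoD(1))
  hence "\<forall>\<^sub>F \<xi> in at b within \<Omega>. a < a' + C * (1 / (hdist \<eta> \<xi>)\<^sup>2 - 1 / r\<^sup>2)"
    by (rule filter_leD[OF at_le[OF subset_UNIV]])
  moreover have "\<forall>\<^sub>F \<xi> in at b within \<Omega>. \<xi> \<in> \<Omega>" by (simp add: eventually_at_filter)
  ultimately show ?thesis by eventually_elim (use low in fastforce)
qed

lemma continuous_on_closure_sol:
  assumes ext: "uniform_exterior_ball \<Omega>" and \<zeta>: "\<zeta> \<in> \<Omega>"
  shows "continuous_on (closure \<Omega>) (sol \<zeta>)"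
  unfolding continuous_on_def
proof
  fix b assume b: "b \<in> closure \<Omega>"
  show "(sol \<zeta> \<longlongrightarrow> sol \<zeta> b) (at b within closure \<Omega>)"
  proof (cases "b \<in> \<Omega>")
    case True
    have "isCont (sol \<zeta>) b"
      using continuous_on_sol[OF \<zeta>] True open_dom by (simp add: continuous_on_eq_continuous_at)
    thus ?thesis by (simp add: isCont_def tendsto_within_subset[OF _ subset_UNIV])
  next
    case False
    have fb: "b \<in> frontier \<Omega>" using b False open_dom by (simp add: frontier_def interior_open)
    have ne: "\<zeta> \<noteq> b" using \<zeta> False by auto
    define g where "g \<xi> = 1 / (hdist \<zeta> \<xi>)\<^sup>2" for \<xi>
    have solb: "sol \<zeta> b = g b" using sol_out[OF \<zeta> False] by (simp add: g_def)
    have "continuous_on (- {\<zeta>}) g"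
      unfolding g_def by (intro continuous_intros) auto
    hence "isCont g b" using ne by (simp add: continuous_on_eq_continuous_at open_Compl)
    hence g: "(g \<longlongrightarrow> g b) (at b within closure \<Omega>)"
      by (simp add: isCont_def tendsto_within_subset[OF _ subset_UNIV])
    have evne: "\<forall>\<^sub>F \<xi> in at b within closure \<Omega>. \<xi> \<noteq> \<zeta>"
    proof -
      have "\<forall>\<^sub>F \<xi> in at b. \<xi> \<in> - {\<zeta>}" by (rule eventually_at_in_open') (use ne in \<open>auto simp: open_Compl\<close>)
      hence "\<forall>\<^sub>F \<xi> in at b within closure \<Omega>. \<xi> \<in> - {\<zeta>}" by (rule filter_leD[OF at_le[OF subset_UNIV]])
      thus ?thesis by eventually_elim simp
    qed
    have up: "sol \<zeta> \<xi> \<le> g \<xi>" if "\<xi> \<noteq> \<zeta>" for \<xi> using sol_le[OF \<zeta> that] by (simp add: g_def)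
    show ?thesis unfolding solb
    proof (rule order_tendstoI)
      fix a assume "g b < a"
      hence "\<forall>\<^sub>F \<xi> in at b within closure \<Omega>. g \<xi> < a" by (rule order_tendstoD(2)[OF g])
      thus "\<forall>\<^sub>F \<xi> in at b within closure \<Omega>. sol \<zeta> \<xi> < a"
        using evne by eventually_elim (use up in fastforce)
    next
      fix a assume a: "a < g b"
      have gb: "0 < g b" using ne by (simp add: g_def)
      define c where "c = max 0 a"
      have c: "0 \<le> c" "a \<le> c" "c < g b" using a gb by (auto simp: c_def)
      obtain c' where c': "c < c'" "c' < g b" using dense[OF c(3)] by blast
      have 1: "\<forall>\<^sub>F \<xi> in at b within \<Omega>. c < sol \<zeta> \<xi>"
        by (rule sol_boundary_lower[OF ext \<zeta> fb c(1) c'(1)]) (use c'(2) in \<open>simp add: g_def\<close>)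
      have 2: "\<forall>\<^sub>F \<xi> in at b within closure \<Omega>. c < g \<xi>" by (rule order_tendstoD(1)[OF g c(3)])
      have 3: "\<forall>\<^sub>F \<xi> in at b within closure \<Omega>. \<xi> \<in> \<Omega> \<longrightarrow> c < sol \<zeta> \<xi>"
        using 1 unfolding eventually_at_filter by eventually_elim auto
      show "\<forall>\<^sub>F \<xi> in at b within closure \<Omega>. a < sol \<zeta> \<xi>"
        using 2 3
      proof eventually_elim
        case (elim \<xi>)
        thus ?case using sol_out[OF \<zeta>, of \<xi>] c(2) by (cases "\<xi> \<in> \<Omega>") (auto simp: g_def)
      qed
    qed
  qed
qed

theorem dirichlet_solution_Hsol:
  assumes ext: "uniform_exterior_ball \<Omega>" and \<zeta>: "\<zeta> \<in> \<Omega>"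
  shows "dirichlet_solution \<Omega> (fund_sol \<zeta>) (Hsol \<zeta>)"
  unfolding dirichlet_solution_def
proof (intro conjI ballI)
  show "Ck_on 2 \<Omega> (Hsol \<zeta>)"
    unfolding Hsol_def[abs_def] by (intro Ck_on_mult Ck_on_const open_dom Ck_on_sol \<zeta>)
  show "continuous_on (closure \<Omega>) (Hsol \<zeta>)"
    unfolding Hsol_def[abs_def] by (intro continuous_on_mult continuous_on_const continuous_on_closure_sol assms)
  show "hlaplace (Hsol \<zeta>) p = 0" if "p \<in> \<Omega>" for p by (rule hlaplace_Hsol[OF \<zeta> that])
  show "Hsol \<zeta> p = fund_sol \<zeta> p" if "p \<in> frontier \<Omega>" for p
  proof -
    have "p \<notin> \<Omega>" using that open_dom by (simp add: frontier_def interior_open)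
    thus ?thesis using sol_out[OF \<zeta>, of p] by (simp add: Hsol_def fund_sol_def hdist_def)
  qed
qed

end

section \<open>The maximum principle\<close>

text \<open>Otherwise the first derivative, which vanishes at the maximum, is positive just to the right of it.\<close>

lemma second_derivative_at_max:
  fixes f f' :: "real \<Rightarrow> real"
  assumes d: "0 < d" and f: "\<And>h. \<bar>h\<bar> < d \<Longrightarrow> (f has_real_derivative f' h) (at h)"
    and f': "(f' has_real_derivative l) (at 0)" and max: "\<And>h. \<bar>h\<bar> < d \<Longrightarrow> f h \<le> f 0"
  shows "l \<le> 0"
proof (rule ccontr)
  assume "\<not> l \<le> 0"
  hence l: "0 < l" by simp
  have f0: "f' 0 = 0"
    by (rule DERIV_local_max[OF f[of 0] d]) (use d max in auto)
  obtain e where e: "0 < e" "\<And>h. 0 < h \<Longrightarrow> h < e \<Longrightarrow> f' 0 < f' (0 + h)"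
    using DERIV_pos_inc_right[OF f' l] by auto
  define h where "h = min d e / 2"
  have h: "0 < h" "h < d" "h < e" using d e(1) by (auto simp: h_def)
  have der: "(f has_real_derivative f' z) (at z)" if "0 \<le> z" "z \<le> h" for z
    by (rule f) (use that h in auto)
  obtain z where z: "0 < z" "z < h" "f h - f 0 = (h - 0) * f' z"
    using MVT2[OF h(1) der] by blast
  have "0 < f' z" using e(2)[of z] z h f0 by simp
  hence "0 < (h - 0) * f' z" using h by simp
  hence "f 0 < f h" using z(3) by linarith
  thus False using max[of h] h by simp
qed

lemma zsq_hderiv:
  assumes "snd (snd v) = 0"
  shows "has_hderiv v zsq (2 * (fst p * fst v + fst (snd p) * fst (snd v))) p"
    "has_hderiv v (\<lambda>p. 2 * (fst p * fst v + fst (snd p) * fst (snd v))) (2 * zsq v) p"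
  unfolding has_hderiv_def zsq_def hmult_eq using assms
  by (auto intro!: derivative_eq_intros simp: algebra_simps power2_eq_square)

lemma zsq_e: "zsq e1 = 1" "zsq e2 = 1" by (simp_all add: zsq_def e1_def e2_def)

text \<open>Adding \<open>\<epsilon>|z|\<^sup>2\<close> makes the sub-Laplacian strictly positive, which is impossible at an interior maximum:
  every horizontal line through it gives a nonpositive second derivative.\<close>

lemma max_principle:
  assumes u: "horiz_C2 \<Omega> u u1 u2" and bd: "bounded \<Omega>" and cont: "continuous_on (closure \<Omega>) u"
    and sub: "\<And>p. p \<in> \<Omega> \<Longrightarrow> 0 \<le> u2 e1 p + u2 e2 p"
    and fr: "\<And>p. p \<in> frontier \<Omega> \<Longrightarrow> u p \<le> M" and p0: "p0 \<in> \<Omega>"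
  shows "u p0 \<le> M"
proof (rule ccontr)
  assume "\<not> u p0 \<le> M"
  have open_\<Omega>: "open \<Omega>" using u by (simp add: horiz_C2_def)
  have K: "compact (closure \<Omega>)" using bd by (simp add: compact_closure)
  have "bounded (zsq ` closure \<Omega>)"
    by (intro compact_imp_bounded compact_continuous_image continuous_intros K)
  then obtain Z where Z: "\<And>p. p \<in> closure \<Omega> \<Longrightarrow> zsq p \<le> Z"
    unfolding bounded_iff by (auto simp del: split_paired_All)
  have Z0: "0 \<le> Z" using Z[of p0] p0 closure_subset[of \<Omega>] zsq_nonneg[of p0] by (meson order_trans subsetD)
  define \<epsilon> where "\<epsilon> = (u p0 - M) / 2 / (Z + 1)"
  have \<epsilon>: "0 < \<epsilon>" "\<epsilon> * Z < u p0 - M"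
  proof -
    show "0 < \<epsilon>" using \<open>\<not> u p0 \<le> M\<close> Z0 by (simp add: \<epsilon>_def)
    hence "\<epsilon> * Z \<le> \<epsilon> * (Z + 1)" by simp
    also have "\<dots> = (u p0 - M) / 2" unfolding \<epsilon>_def using Z0
      by (subst nonzero_eq_divide_eq[symmetric]) auto
    finally show "\<epsilon> * Z < u p0 - M" using \<open>\<not> u p0 \<le> M\<close> by simp
  qed
  define w where "w p = u p + \<epsilon> * zsq p" for p
  have "continuous_on (closure \<Omega>) w" unfolding w_def by (intro continuous_intros cont)
  moreover have "closure \<Omega> \<noteq> {}" using p0 closure_subset by blast
  ultimately obtain q where q: "q \<in> closure \<Omega>" "\<And>p. p \<in> closure \<Omega> \<Longrightarrow> w p \<le> w q"
    using continuous_attains_sup[OF K] by blast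
  have "q \<in> \<Omega>"
  proof (rule ccontr)
    assume "q \<notin> \<Omega>"
    hence "q \<in> frontier \<Omega>" using q(1) open_\<Omega> by (simp add: frontier_def interior_open)
    hence "w q \<le> M + \<epsilon> * Z" unfolding w_def using fr Z[OF q(1)] \<epsilon>(1) by (intro add_mono mult_left_mono) auto
    moreover have "u p0 \<le> w p0" using \<epsilon>(1) by (simp add: w_def)
    moreover have "w p0 \<le> w q" using q(2) p0 closure_subset[of \<Omega>] by blast
    ultimately show False using \<epsilon>(2) by linarith
  qed
  have le: "u2 v q + \<epsilon> * (2 * zsq v) \<le> 0" if v: "v \<in> {e1, e2}" for v
  proof -
    have hv: "snd (snd v) = 0" by (rule horizontal_e[OF v])
    have "open ((\<lambda>h. hmult q (h *\<^sub>R v)) -` \<Omega>)"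
      by (intro open_vimage open_\<Omega> continuous_intros)
    moreover have "0 \<in> (\<lambda>h. hmult q (h *\<^sub>R v)) -` \<Omega>" using \<open>q \<in> \<Omega>\<close> by simp
    ultimately obtain d where d: "0 < d" "ball 0 d \<subseteq> (\<lambda>h. hmult q (h *\<^sub>R v)) -` \<Omega>"
      using openE by blast
    have inO: "hmult q (h *\<^sub>R v) \<in> \<Omega>" if "\<bar>h\<bar> < d" for h
      using d(2) that by (auto simp: subset_iff dist_real_def)
    show ?thesis
    proof (rule second_derivative_at_max[OF d(1)])
      fix h :: real assume h: "\<bar>h\<bar> < d"
      define p where "p = hmult q (h *\<^sub>R v)"
      have "has_hderiv v u (u1 v p) p" using u v inO[OF h] unfolding horiz_C2_def p_def by blast
      from has_hderiv_along[OF hv this[unfolded p_def]] has_hderiv_along[OF hv zsq_hderiv(1)[OF hv], of q h]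
      show "((\<lambda>h. w (hmult q (h *\<^sub>R v))) has_real_derivative (u1 v (hmult q (h *\<^sub>R v)) +
          \<epsilon> * (2 * (fst (hmult q (h *\<^sub>R v)) * fst v + fst (snd (hmult q (h *\<^sub>R v))) * fst (snd v))))) (at h)"
        unfolding w_def by (intro DERIV_add DERIV_cmult[of _ _ _ _ \<epsilon>])
      have "hmult q (h *\<^sub>R v) \<in> closure \<Omega>" using inO[OF h] closure_subset by blast
      thus "w (hmult q (h *\<^sub>R v)) \<le> w (hmult q (0 *\<^sub>R v))" using q(2) by simp
    next
      have "has_hderiv v (u1 v) (u2 v q) q" using u v \<open>q \<in> \<Omega>\<close> unfolding horiz_C2_def by blast
      thus "((\<lambda>h. u1 v (hmult q (h *\<^sub>R v)) +
          \<epsilon> * (2 * (fst (hmult q (h *\<^sub>R v)) * fst v + fst (snd (hmult q (h *\<^sub>R v))) * fst (snd v))))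
         has_real_derivative u2 v q + \<epsilon> * (2 * zsq v)) (at 0)"
        using DERIV_cmult[OF zsq_hderiv(2)[OF hv, of q, unfolded has_hderiv_def], of \<epsilon>]
        unfolding has_hderiv_def by (rule DERIV_add)
    qed
  qed
  have "u2 e1 q + u2 e2 q + 4 * \<epsilon> \<le> 0" using le[of e1] le[of e2] by (simp add: zsq_e)
  thus False using sub[OF \<open>q \<in> \<Omega>\<close>] \<epsilon>(1) by linarith
qed

lemma horiz_C2_diff:
  assumes u: "horiz_C2 U u u1 u2" and w: "horiz_C2 U w w1 w2"
  shows "horiz_C2 U (\<lambda>p. u p - w p) (\<lambda>v p. u1 v p - w1 v p) (\<lambda>v p. u2 v p - w2 v p)"
  unfolding horiz_C2_def
proof (intro conjI ballI)
  show "open U" "continuous_on U (\<lambda>p. u p - w p)"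
    using u w by (auto simp: horiz_C2_def intro: continuous_on_diff)
  fix v assume v: "v \<in> {e1, e2}"
  show "continuous_on U (\<lambda>p. u1 v p - w1 v p)" "continuous_on U (\<lambda>p. u2 v p - w2 v p)"
    using u w v unfolding horiz_C2_def by (blast intro: continuous_on_diff)+
  fix p assume "p \<in> U"
  thus "has_hderiv v (\<lambda>p. u p - w p) (u1 v p - w1 v p) p"
    "has_hderiv v (\<lambda>p. u1 v p - w1 v p) (u2 v p - w2 v p) p"
    using u w v unfolding horiz_C2_def by (blast intro: has_hderiv_diff)+
qed

definition harmonic_to_boundary :: "heis set \<Rightarrow> (heis \<Rightarrow> real) \<Rightarrow> bool" where
  "harmonic_to_boundary \<Omega> u \<longleftrightarrow> continuous_on (closure \<Omega>) u \<and>
     (\<exists>u1 u2. horiz_C2 \<Omega> u u1 u2 \<and> (\<forall>p\<in>\<Omega>. u2 e1 p + u2 e2 p = 0))"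

lemma comparison:
  assumes "bounded \<Omega>" "harmonic_to_boundary \<Omega> u" "harmonic_to_boundary \<Omega> w"
    "\<And>p. p \<in> frontier \<Omega> \<Longrightarrow> u p \<le> w p + c" "p \<in> \<Omega>"
  shows "u p \<le> w p + c"
proof -
  obtain u1 u2 w1 w2 where u: "horiz_C2 \<Omega> u u1 u2" "\<And>p. p \<in> \<Omega> \<Longrightarrow> u2 e1 p + u2 e2 p = 0"
    and w: "horiz_C2 \<Omega> w w1 w2" "\<And>p. p \<in> \<Omega> \<Longrightarrow> w2 e1 p + w2 e2 p = 0"
    using assms(2,3) unfolding harmonic_to_boundary_def by blast
  have "u p - w p \<le> c"
  proof (rule max_principle[OF horiz_C2_diff[OF u(1) w(1)] assms(1) _ _ _ assms(5)])
    show "continuous_on (closure \<Omega>) (\<lambda>p. u p - w p)"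
      using assms(2,3) by (intro continuous_on_diff) (auto simp: harmonic_to_boundary_def)
    show "0 \<le> u2 e1 q - w2 e1 q + (u2 e2 q - w2 e2 q)" if "q \<in> \<Omega>" for q
      using u(2)[OF that] w(2)[OF that] by simp
    show "u q - w q \<le> c" if "q \<in> frontier \<Omega>" for q using assms(4)[OF that] by simp
  qed
  thus ?thesis by simp
qed

lemma harmonic_to_boundary_const: "open \<Omega> \<Longrightarrow> harmonic_to_boundary \<Omega> (\<lambda>_. c)"
  unfolding harmonic_to_boundary_def horiz_C2_def has_hderiv_def
  by (intro conjI exI[of _ "\<lambda>_ _. 0"]) auto

lemma dirichlet_solution_harmonic:
  assumes "open \<Omega>" "dirichlet_solution \<Omega> \<phi> u" shows "harmonic_to_boundary \<Omega> u"
  unfolding harmonic_to_boundary_def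
proof (intro conjI exI)
  show "horiz_C2 \<Omega> u (\<lambda>v. hdir v u) (\<lambda>v. hdir v (hdir v u))"
    using assms by (intro Ck_on_2_horiz_C2) (auto simp: dirichlet_solution_def)
qed (use assms in \<open>auto simp: dirichlet_solution_def hlaplace_eq\<close>)

lemma fund_sol_eq: "fund_sol \<xi> \<eta> = 1 / (8 * pi * (hdist \<xi> \<eta>)\<^sup>2)"
  by (simp add: fund_sol_def hdist_def)

lemma horiz_C2_cmult:
  assumes "horiz_C2 U u u1 u2"
  shows "horiz_C2 U (\<lambda>p. c * u p) (\<lambda>v p. c * u1 v p) (\<lambda>v p. c * u2 v p)"
  using assms unfolding horiz_C2_def has_hderiv_def
  by (auto intro!: continuous_on_mult continuous_on_const DERIV_cmult simp del: split_paired_All)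

lemma horiz_C2_subset: "horiz_C2 U u u1 u2 \<Longrightarrow> open V \<Longrightarrow> V \<subseteq> U \<Longrightarrow> horiz_C2 V u u1 u2"
  unfolding horiz_C2_def by (meson continuous_on_subset subsetD)

lemma harmonic_to_boundary_fund_sol:
  assumes "open \<Omega>" "\<eta> \<notin> closure \<Omega>"
  shows "harmonic_to_boundary \<Omega> (\<lambda>p. c * fund_sol \<eta> p)"
proof -
  define k where "k = c * (1 / (8 * pi))"
  have eq: "(\<lambda>p. c * fund_sol \<eta> p) = (\<lambda>p. k * Nreg 0 (hmult (hinv \<eta>) p))"
    by (simp add: fund_sol_eq Nreg_0 k_def hdist_def fun_eq_iff)
  have pos: "0 < sreg 0 (hmult (hinv \<eta>) p)" if "p \<in> closure \<Omega>" for p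
  proof -
    have "p \<noteq> \<eta>" using that assms by auto
    hence "hdist \<eta> p \<noteq> 0" by simp
    thus ?thesis unfolding hdist_def by (intro sreg_0_pos) simp
  qed
  have sub: "closure \<Omega> \<subseteq> hmult (hinv \<eta>) -` {p. 0 < sreg 0 p}" using pos by blast
  note h = horiz_C2_cmult[OF horiz_C2_left[OF Nreg_horiz_C2[of 0], of "hinv \<eta>"], of k]
  have "continuous_on (closure \<Omega>) (\<lambda>p. k * Nreg 0 (hmult (hinv \<eta>) p))"
    using h sub unfolding horiz_C2_def by (blast intro: continuous_on_subset)
  moreover have "\<Omega> \<subseteq> hmult (hinv \<eta>) -` {p. 0 < sreg 0 p}" using sub closure_subset by blast
  note horiz_C2_subset[OF h assms(1) this]
  moreover have "\<forall>p\<in>\<Omega>. k * Nreg2 0 e1 (hmult (hinv \<eta>) p) + k * Nreg2 0 e2 (hmult (hinv \<eta>) p) = 0"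
    using Nreg_laplace[OF pos] closure_subset[of \<Omega>] by (simp add: distrib_left[symmetric] subset_iff del: split_paired_All)
  ultimately show ?thesis unfolding eq harmonic_to_boundary_def by blast
qed

section \<open>The harmonic radius and its maximum\<close>

locale regular_domain = heis_domain +
  assumes exterior: "uniform_exterior_ball \<Omega>"
begin

text \<open>The regular part of the Green function on the diagonal; maximal radius means minimal \<open>hval\<close>.\<close>

definition hval :: "heis \<Rightarrow> real" where "hval \<xi> = harmonic_part \<Omega> \<xi> \<xi>"

lemma harmonic_part_solution:
  assumes "\<xi> \<in> \<Omega>" shows "dirichlet_solution \<Omega> (fund_sol \<xi>) (harmonic_part \<Omega> \<xi>)"
  unfolding harmonic_part_def
  by (rule someI[of "dirichlet_solution \<Omega> (fund_sol \<xi>)", OF dirichlet_solution_Hsol[OF exterior assms]])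

lemma harmonic_part_harmonic: "\<xi> \<in> \<Omega> \<Longrightarrow> harmonic_to_boundary \<Omega> (harmonic_part \<Omega> \<xi>)"
  by (rule dirichlet_solution_harmonic[OF open_dom harmonic_part_solution])

lemma harmonic_part_frontier: "\<xi> \<in> \<Omega> \<Longrightarrow> p \<in> frontier \<Omega> \<Longrightarrow> harmonic_part \<Omega> \<xi> p = fund_sol \<xi> p"
  using harmonic_part_solution by (simp add: dirichlet_solution_def)

lemma frontier_out: "p \<in> frontier \<Omega> \<Longrightarrow> p \<notin> \<Omega>"
  using open_dom by (simp add: frontier_def interior_open)

lemma frontier_hdist_pos: "\<xi> \<in> \<Omega> \<Longrightarrow> p \<in> frontier \<Omega> \<Longrightarrow> 0 < hdist \<xi> p"
  by (rule hdist_pos) (use frontier_out in blast)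

lemma frontier_nonempty: "frontier \<Omega> \<noteq> {}"
  using frontier_not_empty[OF nonempty_dom] compl_nonempty by auto

lemma compact_frontier: "compact (frontier \<Omega>)"
  by (rule compact_frontier_bounded[OF bounded_dom])

text \<open>The maximum principle against the smallest boundary value.\<close>

lemma hval_lower:
  assumes "\<xi> \<in> \<Omega>" "\<And>p. p \<in> frontier \<Omega> \<Longrightarrow> hdist \<xi> p \<le> S"
  shows "1 / (8 * pi * S\<^sup>2) \<le> hval \<xi>" "0 < S"
proof -
  note dpos = frontier_hdist_pos[OF assms(1)]
  obtain p0 where "p0 \<in> frontier \<Omega>" using frontier_nonempty by blast
  thus S: "0 < S" using dpos assms(2) by fastforce
  have "1 / (8 * pi * S\<^sup>2) \<le> harmonic_part \<Omega> \<xi> \<xi> + 0"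
  proof (rule comparison[OF bounded_dom harmonic_to_boundary_const[OF open_dom] harmonic_part_harmonic[OF assms(1)] _ assms(1)])
    fix p assume p: "p \<in> frontier \<Omega>"
    have "1 / (8 * pi * S\<^sup>2) \<le> 1 / (8 * pi * (hdist \<xi> p)\<^sup>2)"
      using assms(2)[OF p] dpos[OF p] S by (intro divide_left_mono mult_left_mono power_mono mult_pos_pos zero_less_power) auto
    thus "1 / (8 * pi * S\<^sup>2) \<le> harmonic_part \<Omega> \<xi> p + 0"
      by (simp add: harmonic_part_frontier[OF assms(1) p] fund_sol_eq)
  qed
  thus "1 / (8 * pi * S\<^sup>2) \<le> hval \<xi>" by (simp add: hval_def)
qed

lemma hdist_frontier_bounded: "bdd_above ((\<lambda>p. hdist \<xi> p) ` frontier \<Omega>)" "bdd_below ((\<lambda>p. hdist \<xi> p) ` frontier \<Omega>)"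
proof -
  have "bounded ((\<lambda>p. hdist \<xi> p) ` frontier \<Omega>)"
    by (intro compact_imp_bounded compact_continuous_image compact_frontier continuous_intros)
  thus "bdd_above ((\<lambda>p. hdist \<xi> p) ` frontier \<Omega>)" "bdd_below ((\<lambda>p. hdist \<xi> p) ` frontier \<Omega>)"
    by (simp_all add: bounded_imp_bdd_above bounded_imp_bdd_below)
qed

definition far :: "heis \<Rightarrow> real" where "far \<xi> = (SUP p\<in>frontier \<Omega>. hdist \<xi> p)"
definition near :: "heis \<Rightarrow> real" where "near \<xi> = (INF p\<in>frontier \<Omega>. hdist \<xi> p)"

lemma far_ge: "p \<in> frontier \<Omega> \<Longrightarrow> hdist \<xi> p \<le> far \<xi>"
  unfolding far_def by (rule cSUP_upper[OF _ hdist_frontier_bounded(1)])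

lemma near_le: "p \<in> frontier \<Omega> \<Longrightarrow> near \<xi> \<le> hdist \<xi> p"
  unfolding near_def by (rule cINF_lower[OF hdist_frontier_bounded(2)])

lemma near_pos: "\<xi> \<in> \<Omega> \<Longrightarrow> 0 < near \<xi>"
proof -
  assume \<xi>: "\<xi> \<in> \<Omega>"
  have "2 * rad \<xi> \<le> near \<xi>"
    unfolding near_def by (intro cINF_greatest frontier_nonempty rad_le frontier_out)
  thus ?thesis using rad_pos[OF \<xi>] by linarith
qed

lemma near_le_far: "near \<xi> \<le> far \<xi>"
  using frontier_nonempty near_le far_ge by (meson all_not_in_conv order_trans)

lemma continuous_far_near: "continuous_on S far" "continuous_on S near"
proof -
  have "far \<xi> \<le> far \<eta> + hdist \<xi> \<eta>" for \<xi> \<eta>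
    unfolding far_def[of \<xi>]
  proof (rule cSUP_least[OF frontier_nonempty])
    fix p assume "p \<in> frontier \<Omega>"
    thus "hdist \<xi> p \<le> far \<eta> + hdist \<xi> \<eta>" using far_ge[of p \<eta>] hdist_triangle[of \<xi> p \<eta>] by linarith
  qed
  thus "continuous_on S far" by (rule continuous_on_hdist_lipschitz)
  have "near \<xi> - hdist \<xi> \<eta> \<le> near \<eta>" for \<xi> \<eta>
    unfolding near_def[of \<eta>]
  proof (rule cINF_greatest[OF frontier_nonempty])
    fix p assume "p \<in> frontier \<Omega>"
    thus "near \<xi> - hdist \<xi> \<eta> \<le> hdist \<eta> p" using near_le[of p \<xi>] hdist_triangle[of \<xi> p \<eta>] by linarith
  qed
  hence "near \<xi> \<le> near \<eta> + hdist \<xi> \<eta>" for \<xi> \<eta> by (simp add: algebra_simps)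
  thus "continuous_on S near" by (rule continuous_on_hdist_lipschitz)
qed

lemma hval_pos: "\<xi> \<in> \<Omega> \<Longrightarrow> 0 < hval \<xi>"
proof -
  assume \<xi>: "\<xi> \<in> \<Omega>"
  have "0 < 1 / (8 * pi * (far \<xi>)\<^sup>2)" using hval_lower(2)[OF \<xi> far_ge] by simp
  thus ?thesis using hval_lower(1)[OF \<xi> far_ge] by linarith
qed

text \<open>At a boundary point at distance \<open>d\<close> take an exterior ball of radius \<open>d\<close>. Its center \<open>\<eta>\<close> is within
  \<open>2d\<close> of \<open>\<xi>\<close>, and distances from \<open>\<xi>\<close> to the boundary are at most three times those from \<open>\<eta>\<close>. So a ninth of the
  fundamental solution with pole \<open>\<eta>\<close> is a lower barrier, and at \<open>\<xi>\<close> it is at least \<open>1 / (9 \<cdot> 8\<pi> \<cdot> 4d\<^sup>2)\<close>.\<close>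

lemma hval_blow_up:
  obtains r0 where "0 < r0"
    "\<And>\<xi> b. \<xi> \<in> \<Omega> \<Longrightarrow> b \<in> frontier \<Omega> \<Longrightarrow> hdist \<xi> b \<le> r0 \<Longrightarrow> 1 / (288 * pi * (hdist \<xi> b)\<^sup>2) \<le> hval \<xi>"
proof -
  obtain r0 where r0: "0 < r0" "\<And>b r. b \<in> frontier \<Omega> \<Longrightarrow> 0 < r \<Longrightarrow> r \<le> r0 \<Longrightarrow>
      \<exists>\<eta>. hball \<eta> r \<inter> \<Omega> = {} \<and> b \<in> frontier (hball \<eta> r)"
    using exterior unfolding uniform_exterior_ball_def by blast
  show ?thesis
  proof (rule that[OF r0(1)])
    fix \<xi> b assume \<xi>: "\<xi> \<in> \<Omega>" and b: "b \<in> frontier \<Omega>" and le: "hdist \<xi> b \<le> r0"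
    define d where "d = hdist \<xi> b"
    have d: "0 < d" unfolding d_def by (rule frontier_hdist_pos[OF \<xi> b])
    obtain \<eta> where \<eta>: "hball \<eta> d \<inter> \<Omega> = {}" "b \<in> frontier (hball \<eta> d)"
      using r0(2)[OF b d] le by (auto simp: d_def)
    have \<eta>b: "hdist \<eta> b = d" by (rule frontier_hball[OF \<eta>(2)])
    have disj: "hball \<eta> d \<inter> closure \<Omega> = {}" using \<eta>(1) open_hball by (simp add: open_Int_closure_eq_empty)
    have far: "d \<le> hdist \<eta> p" if "p \<in> closure \<Omega>" for p
    proof (rule ccontr)
      assume "\<not> d \<le> hdist \<eta> p"
      hence "p \<in> hball \<eta> d" by (simp add: hball_def)
      thus False using disj that by blast
    qed
    have \<eta>_out: "\<eta> \<notin> closure \<Omega>" using far[of \<eta>] d by auto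
    have \<xi>\<eta>: "hdist \<xi> \<eta> \<le> 2 * d" using hdist_triangle[of \<xi> \<eta> b] \<eta>b hdist_sym[of b \<eta>] by (simp add: d_def)
    have "(1 / 9) * fund_sol \<eta> \<xi> \<le> harmonic_part \<Omega> \<xi> \<xi> + 0"
    proof (rule comparison[OF bounded_dom harmonic_to_boundary_fund_sol[OF open_dom \<eta>_out] harmonic_part_harmonic[OF \<xi>] _ \<xi>])
      fix p assume p: "p \<in> frontier \<Omega>"
      have dp: "d \<le> hdist \<eta> p" using far p by (simp add: frontier_def)
      have pos: "0 < hdist \<xi> p" by (rule frontier_hdist_pos[OF \<xi> p])
      have "hdist \<xi> p \<le> 3 * hdist \<eta> p" using hdist_triangle[of \<xi> p \<eta>] \<xi>\<eta> dp by linarith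
      hence "1 / (8 * pi * (3 * hdist \<eta> p)\<^sup>2) \<le> 1 / (8 * pi * (hdist \<xi> p)\<^sup>2)"
        using pos dp d by (intro divide_left_mono mult_left_mono power_mono mult_pos_pos zero_less_power) auto
      thus "(1 / 9) * fund_sol \<eta> p \<le> harmonic_part \<Omega> \<xi> p + 0"
        by (simp add: harmonic_part_frontier[OF \<xi> p] fund_sol_eq power_mult_distrib mult_ac)
    qed
    moreover have "1 / (8 * pi * (2 * d)\<^sup>2) \<le> fund_sol \<eta> \<xi>"
    proof -
      have "d \<le> hdist \<eta> \<xi>" using far \<xi> closure_subset by blast
      thus ?thesis unfolding fund_sol_eq using \<xi>\<eta> d hdist_sym[of \<xi> \<eta>]
        by (intro divide_left_mono mult_left_mono power_mono mult_pos_pos zero_less_power) auto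
    qed
    ultimately show "1 / (288 * pi * (hdist \<xi> b)\<^sup>2) \<le> hval \<xi>"
      by (simp add: hval_def d_def[symmetric] power_mult_distrib)
  qed
qed

text \<open>The boundary values depend uniformly continuously on the pole, and the maximum principle bounds the
  change of the harmonic part by the change of its boundary values.\<close>

lemma continuous_hval: "continuous_on \<Omega> hval"
proof (rule continuous_at_imp_continuous_on, rule ballI)
  fix \<xi>0 assume \<xi>0: "\<xi>0 \<in> \<Omega>"
  define K where "K = {q. hdist \<xi>0 q \<le> rad \<xi>0}"
  have K: "compact K" unfolding K_def by (rule compact_hcball)
  have KO: "K \<subseteq> \<Omega>"
  proof
    fix q assume "q \<in> K"
    hence "hdist \<xi>0 q < 2 * rad \<xi>0" using rad_pos[OF \<xi>0] by (simp add: K_def)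
    thus "q \<in> \<Omega>" by (rule in_dom)
  qed
  have "continuous_on (K \<times> frontier \<Omega>) (\<lambda>x. fund_sol (fst x) (snd x))"
    unfolding fund_sol_eq
  proof (intro continuous_intros ballI)
    fix x assume "x \<in> K \<times> frontier \<Omega>"
    hence "fst x \<noteq> snd x" using KO frontier_out by auto
    thus "8 * pi * (hdist (fst x) (snd x))\<^sup>2 \<noteq> 0" by simp
  qed
  hence unif: "uniformly_continuous_on (K \<times> frontier \<Omega>) (\<lambda>x. fund_sol (fst x) (snd x))"
    by (intro compact_uniformly_continuous compact_Times K compact_frontier)
  have cont0: "isCont (harmonic_part \<Omega> \<xi>0) \<xi>0"
  proof -
    have "continuous_on \<Omega> (harmonic_part \<Omega> \<xi>0)"
      using harmonic_part_harmonic[OF \<xi>0] closure_subset[of \<Omega>] continuous_on_subset unfolding harmonic_to_boundary_def by blast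
    thus ?thesis using open_dom \<xi>0 by (simp add: continuous_on_eq_continuous_at)
  qed
  have "((\<lambda>\<xi>. hval \<xi>) \<longlongrightarrow> hval \<xi>0) (at \<xi>0)"
  proof (rule tendstoI)
    fix e :: real assume e: "0 < e"
    obtain \<delta> where \<delta>: "0 < \<delta>" "\<And>x x'. x \<in> K \<times> frontier \<Omega> \<Longrightarrow> x' \<in> K \<times> frontier \<Omega> \<Longrightarrow> dist x' x < \<delta> \<Longrightarrow>
        dist (fund_sol (fst x') (snd x')) (fund_sol (fst x) (snd x)) < e / 2"
      using unif e unfolding uniformly_continuous_on_def by (metis half_gt_zero)
    have ev1: "\<forall>\<^sub>F \<xi> in at \<xi>0. dist \<xi> \<xi>0 < \<delta>"
      using \<delta>(1) by (auto simp: eventually_at)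
    have "open (hball \<xi>0 (rad \<xi>0))" "\<xi>0 \<in> hball \<xi>0 (rad \<xi>0)" using rad_pos[OF \<xi>0] open_hball by (auto simp: hball_def)
    hence ev2: "\<forall>\<^sub>F \<xi> in at \<xi>0. \<xi> \<in> hball \<xi>0 (rad \<xi>0)" by (rule eventually_at_in_open')
    have ev3: "\<forall>\<^sub>F \<xi> in at \<xi>0. dist (harmonic_part \<Omega> \<xi>0 \<xi>) (harmonic_part \<Omega> \<xi>0 \<xi>0) < e / 2"
      using cont0 e unfolding isCont_def by (intro tendstoD) auto
    show "\<forall>\<^sub>F \<xi> in at \<xi>0. dist (hval \<xi>) (hval \<xi>0) < e"
      using ev1 ev2 ev3
    proof eventually_elim
      case (elim \<xi>)
      have \<xi>K: "\<xi> \<in> K" "\<xi>0 \<in> K" using elim(2) rad_pos[OF \<xi>0] by (auto simp: K_def hball_def)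
      have \<xi>: "\<xi> \<in> \<Omega>" using \<xi>K KO by blast
      have close: "\<bar>fund_sol \<xi> p - fund_sol \<xi>0 p\<bar> < e / 2" if p: "p \<in> frontier \<Omega>" for p
        using \<delta>(2)[of "(\<xi>0, p)" "(\<xi>, p)"] \<xi>K p elim(1) by (simp add: dist_Pair_Pair dist_real_def)
      have "harmonic_part \<Omega> \<xi> \<xi> \<le> harmonic_part \<Omega> \<xi>0 \<xi> + e / 2"
      proof (rule comparison[OF bounded_dom harmonic_part_harmonic[OF \<xi>] harmonic_part_harmonic[OF \<xi>0] _ \<xi>])
        fix p assume p: "p \<in> frontier \<Omega>"
        show "harmonic_part \<Omega> \<xi> p \<le> harmonic_part \<Omega> \<xi>0 p + e / 2"
          using close[OF p] unfolding harmonic_part_frontier[OF \<xi> p] harmonic_part_frontier[OF \<xi>0 p] by linarith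
      qed
      moreover have "harmonic_part \<Omega> \<xi>0 \<xi> \<le> harmonic_part \<Omega> \<xi> \<xi> + e / 2"
      proof (rule comparison[OF bounded_dom harmonic_part_harmonic[OF \<xi>0] harmonic_part_harmonic[OF \<xi>] _ \<xi>])
        fix p assume p: "p \<in> frontier \<Omega>"
        show "harmonic_part \<Omega> \<xi>0 p \<le> harmonic_part \<Omega> \<xi> p + e / 2"
          using close[OF p] unfolding harmonic_part_frontier[OF \<xi> p] harmonic_part_frontier[OF \<xi>0 p] by linarith
      qed
      ultimately show ?case using elim(3) unfolding hval_def dist_real_def by linarith
    qed
  qed
  thus "isCont hval \<xi>0" by (simp add: isCont_def)
qed

lemma harmonic_radius_sq: "\<xi> \<in> \<Omega> \<Longrightarrow> (harmonic_radius \<Omega> \<xi>)\<^sup>2 = 1 / (8 * pi * hval \<xi>)"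
  using hval_pos[of \<xi>] by (simp add: harmonic_radius_def hval_def power_divide)

lemma harmonic_radius_le_iff:
  assumes "\<xi> \<in> \<Omega>" "\<eta> \<in> \<Omega>"
  shows "harmonic_radius \<Omega> \<eta> \<le> harmonic_radius \<Omega> \<xi> \<longleftrightarrow> hval \<xi> \<le> hval \<eta>"
proof -
  have p: "0 < sqrt (8 * pi * hval \<xi>)" "0 < sqrt (8 * pi * hval \<eta>)" using hval_pos assms by auto
  have "harmonic_radius \<Omega> \<eta> \<le> harmonic_radius \<Omega> \<xi> \<longleftrightarrow> sqrt (8 * pi * hval \<xi>) \<le> sqrt (8 * pi * hval \<eta>)"
    using p unfolding harmonic_radius_def hval_def[symmetric] by (simp add: divide_simps)
  thus ?thesis by simp
qed

text \<open>By the blow-up at the boundary, a sublevel set of \<open>hval\<close> keeps a positive distance from the boundary, so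
  the minimum is taken over a compact set.\<close>

lemma harmonic_centers_compact: "compact (harmonic_centers \<Omega>)" "harmonic_centers \<Omega> \<noteq> {}"
proof -
  obtain p0 where p0: "p0 \<in> \<Omega>" using nonempty_dom by blast
  obtain r0 where r0: "0 < r0" "\<And>\<xi> b. \<xi> \<in> \<Omega> \<Longrightarrow> b \<in> frontier \<Omega> \<Longrightarrow> hdist \<xi> b \<le> r0 \<Longrightarrow> 1 / (288 * pi * (hdist \<xi> b)\<^sup>2) \<le> hval \<xi>"
    using hval_blow_up by blast
  define m where "m = hval p0"
  have m: "0 < m" using hval_pos[OF p0] by (simp add: m_def)
  define c where "c = min r0 (1 / sqrt (288 * pi * m))"
  have c: "0 < c" "c \<le> r0" using r0(1) m by (auto simp: c_def)
  have c2: "c\<^sup>2 \<le> 1 / (288 * pi * m)"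
  proof -
    have "c\<^sup>2 \<le> (1 / sqrt (288 * pi * m))\<^sup>2" using c(1) by (intro power_mono) (auto simp: c_def)
    also have "\<dots> = 1 / (288 * pi * m)" using m by (simp add: power_divide)
    finally show ?thesis .
  qed
  define K where "K = {\<xi> \<in> closure \<Omega>. c \<le> near \<xi>}"
  have KO: "K \<subseteq> \<Omega>"
  proof
    fix \<xi> assume \<xi>: "\<xi> \<in> K"
    show "\<xi> \<in> \<Omega>"
    proof (rule ccontr)
      assume "\<xi> \<notin> \<Omega>"
      hence "\<xi> \<in> frontier \<Omega>" using \<xi> open_dom by (simp add: K_def frontier_def interior_open)
      from near_le[OF this, of \<xi>] show False using \<xi> c by (simp add: K_def)
    qed
  qed
  have "closed {\<xi>. c \<le> near \<xi>}" by (intro closed_Collect_le continuous_on_const continuous_far_near)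
  hence K: "compact K"
    unfolding K_def using bounded_dom by (simp add: Collect_conj_eq compact_Int_closed compact_closure)
  have low: "\<xi> \<in> K" if \<xi>: "\<xi> \<in> \<Omega>" "hval \<xi> \<le> m" for \<xi>
  proof -
    have "c \<le> hdist \<xi> b" if b: "b \<in> frontier \<Omega>" for b
    proof (rule ccontr)
      assume "\<not> c \<le> hdist \<xi> b"
      hence lt: "hdist \<xi> b < c" by simp
      have pos: "0 < hdist \<xi> b" by (rule frontier_hdist_pos[OF \<xi>(1) b])
      have "(hdist \<xi> b)\<^sup>2 < c\<^sup>2" using lt by (intro power_strict_mono) auto
      hence "(hdist \<xi> b)\<^sup>2 < 1 / (288 * pi * m)" using c2 by linarith
      hence "(hdist \<xi> b)\<^sup>2 * (288 * pi * m) < 1"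
        using pos_less_divide_eq[of "288 * pi * m" "(hdist \<xi> b)\<^sup>2" 1] m by simp
      hence "m * (288 * pi * (hdist \<xi> b)\<^sup>2) < 1" by (simp add: mult_ac)
      moreover have "0 < 288 * pi * (hdist \<xi> b)\<^sup>2" using pos by (intro mult_pos_pos zero_less_power) auto
      ultimately have "m < 1 / (288 * pi * (hdist \<xi> b)\<^sup>2)" by (simp only: pos_less_divide_eq)
      moreover have "1 / (288 * pi * (hdist \<xi> b)\<^sup>2) \<le> hval \<xi>" using r0(2)[OF \<xi>(1) b] lt c by simp
      ultimately show False using \<xi>(2) by linarith
    qed
    hence "c \<le> near \<xi>" unfolding near_def by (intro cINF_greatest frontier_nonempty)
    thus ?thesis using \<xi> closure_subset by (auto simp: K_def)
  qed
  have p0K: "p0 \<in> K" by (rule low[OF p0]) (simp add: m_def)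
  have contK: "continuous_on K hval" by (rule continuous_on_subset[OF continuous_hval KO])
  obtain q where q: "q \<in> K" "\<And>p. p \<in> K \<Longrightarrow> hval q \<le> hval p"
    using continuous_attains_inf[OF K _ contK] p0K by blast
  have qmin: "hval q \<le> hval p" if "p \<in> \<Omega>" for p
    using q(2)[of p] q(2)[OF p0K] low[OF that] by (cases "hval p \<le> m") (auto simp: m_def)
  have eq: "harmonic_centers \<Omega> = {\<xi> \<in> K. hval \<xi> \<le> hval q}"
  proof (intro set_eqI iffI)
    fix \<xi> assume a: "\<xi> \<in> harmonic_centers \<Omega>"
    hence \<xi>: "\<xi> \<in> \<Omega>" and "harmonic_radius \<Omega> q \<le> harmonic_radius \<Omega> \<xi>"
      using q(1) KO unfolding harmonic_centers_def by blast+
    hence le: "hval \<xi> \<le> hval q" using harmonic_radius_le_iff[of \<xi> q] q(1) KO by blast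
    thus "\<xi> \<in> {\<xi> \<in> K. hval \<xi> \<le> hval q}" using low[OF \<xi>] qmin[OF p0] by (simp add: m_def)
  next
    fix \<xi> assume a: "\<xi> \<in> {\<xi> \<in> K. hval \<xi> \<le> hval q}"
    hence \<xi>: "\<xi> \<in> \<Omega>" using KO by blast
    have "harmonic_radius \<Omega> \<eta> \<le> harmonic_radius \<Omega> \<xi>" if "\<eta> \<in> \<Omega>" for \<eta>
      using harmonic_radius_le_iff[OF \<xi> that] a qmin[OF that] by auto
    thus "\<xi> \<in> harmonic_centers \<Omega>" using \<xi> by (simp add: harmonic_centers_def)
  qed
  have "closed (K \<inter> hval -` {..hval q})"
    by (rule continuous_closed_preimage[OF contK compact_imp_closed[OF K]]) simp
  moreover have "K \<inter> hval -` {..hval q} = {\<xi> \<in> K. hval \<xi> \<le> hval q}" by auto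
  ultimately have "compact (K \<inter> {\<xi> \<in> K. hval \<xi> \<le> hval q})" using K by (intro compact_Int_closed) auto
  moreover have "K \<inter> {\<xi> \<in> K. hval \<xi> \<le> hval q} = {\<xi> \<in> K. hval \<xi> \<le> hval q}" by blast
  ultimately show "compact (harmonic_centers \<Omega>)" unfolding eq by simp
  show "harmonic_centers \<Omega> \<noteq> {}" unfolding eq using q(1) by blast
qed

lemma alpha_eq: "alpha \<Omega> \<xi> = far \<xi> / near \<xi>" by (simp add: alpha_def far_def near_def)

lemma optimal_center:
  obtains \<xi> where "\<xi> \<in> \<Omega>" "C_const \<Omega> = C_at \<Omega> \<xi>" "max_radius_sq \<Omega> = (harmonic_radius \<Omega> \<xi>)\<^sup>2"
proof -
  have sub: "harmonic_centers \<Omega> \<subseteq> \<Omega>" by (auto simp: harmonic_centers_def)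
  have "continuous_on (harmonic_centers \<Omega>) (C_at \<Omega>)"
    unfolding C_at_def[abs_def] alpha_eq
  proof (intro continuous_intros continuous_far_near ballI)
    fix \<xi> assume "\<xi> \<in> harmonic_centers \<Omega>"
    hence "0 < near \<xi>" using sub near_pos by blast
    thus "near \<xi> \<noteq> 0" by simp
  qed
  then obtain \<xi> where \<xi>: "\<xi> \<in> harmonic_centers \<Omega>" "\<And>\<eta>. \<eta> \<in> harmonic_centers \<Omega> \<Longrightarrow> C_at \<Omega> \<xi> \<le> C_at \<Omega> \<eta>"
    using continuous_attains_inf[OF harmonic_centers_compact] by blast
  have C: "C_const \<Omega> = C_at \<Omega> \<xi>"
    unfolding C_const_def by (rule Least_equality) (use \<xi> in auto)
  have in\<Omega>: "\<xi> \<in> \<Omega>" using \<xi>(1) sub by blast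
  have "max_radius_sq \<Omega> = (harmonic_radius \<Omega> \<xi>)\<^sup>2"
    unfolding max_radius_sq_def
  proof (rule Greatest_equality)
    show "(harmonic_radius \<Omega> \<xi>)\<^sup>2 \<in> (\<lambda>\<xi>. (harmonic_radius \<Omega> \<xi>)\<^sup>2) ` \<Omega>" using in\<Omega> by blast
    fix y assume "y \<in> (\<lambda>\<xi>. (harmonic_radius \<Omega> \<xi>)\<^sup>2) ` \<Omega>"
    then obtain \<eta> where \<eta>: "\<eta> \<in> \<Omega>" "y = (harmonic_radius \<Omega> \<eta>)\<^sup>2" by blast
    have le: "harmonic_radius \<Omega> \<eta> \<le> harmonic_radius \<Omega> \<xi>" using \<xi>(1) \<eta>(1) unfolding harmonic_centers_def by blast
    have "0 \<le> harmonic_radius \<Omega> \<eta>" using hval_pos[OF \<eta>(1)] by (simp add: harmonic_radius_def hval_def)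
    thus "y \<le> (harmonic_radius \<Omega> \<xi>)\<^sup>2" unfolding \<eta>(2) using le by (intro power_mono) auto
  qed
  thus ?thesis using that in\<Omega> C by blast
qed

lemma harmonic_radius_le_far:
  assumes "\<xi> \<in> \<Omega>"
  shows "(harmonic_radius \<Omega> \<xi>)\<^sup>2 \<le> (far \<xi>)\<^sup>2" "0 < (harmonic_radius \<Omega> \<xi>)\<^sup>2"
proof -
  have far: "0 < far \<xi>" by (rule hval_lower(2)[OF assms far_ge])
  have h: "0 < hval \<xi>" by (rule hval_pos[OF assms])
  have "1 \<le> hval \<xi> * (8 * pi * (far \<xi>)\<^sup>2)"
    using hval_lower(1)[OF assms far_ge] far by (simp add: divide_le_eq)
  thus "(harmonic_radius \<Omega> \<xi>)\<^sup>2 \<le> (far \<xi>)\<^sup>2"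
    unfolding harmonic_radius_sq[OF assms] using h by (simp add: divide_le_eq mult_ac)
  show "0 < (harmonic_radius \<Omega> \<xi>)\<^sup>2" unfolding harmonic_radius_sq[OF assms] using h by simp
qed

end

section \<open>The first positive zero of the Bessel function\<close>

definition bessel_coeff :: "nat \<Rightarrow> real" where
  "bessel_coeff k = (- 1) ^ k / (fact k * fact (k + 1))"

text \<open>The entire function with \<open>J\<^sub>1(x) = (x/2) g(x\<^sup>2/4)\<close>.\<close>

definition bessel_g :: "real \<Rightarrow> real" where "bessel_g q = (\<Sum>k. bessel_coeff k * q ^ k)"

lemma bessel_summable: "summable (\<lambda>k. bessel_coeff k * q ^ k)"
proof (rule summable_comparison_test'[of "\<lambda>k. inverse (fact k) * \<bar>q\<bar> ^ k" 0])
  show "summable (\<lambda>k. inverse (fact k) * \<bar>q\<bar> ^ k)" by (rule summable_exp)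
  fix k :: nat
  have "(fact k :: real) \<le> fact k * fact (k + 1)" using fact_ge_1[of "k + 1"] by (simp add: mult_le_cancel_left1)
  hence "\<bar>q\<bar> ^ k / (fact k * fact (k + 1)) \<le> \<bar>q\<bar> ^ k / fact k" by (intro divide_left_mono) auto
  thus "norm (bessel_coeff k * q ^ k) \<le> inverse (fact k) * \<bar>q\<bar> ^ k"
    by (simp add: bessel_coeff_def abs_mult power_abs divide_inverse mult_ac)
qed

lemma bessel_J_1_eq: "bessel_J 1 x = (x / 2) * bessel_g ((x / 2)\<^sup>2)"
proof -
  have "bessel_J 1 x = (\<Sum>k. (x / 2) * (bessel_coeff k * ((x / 2)\<^sup>2) ^ k))"
    unfolding bessel_J_def bessel_coeff_def
    by (intro arg_cong[where f = suminf] ext) (simp add: power_add power_mult[symmetric] mult_ac)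
  also have "\<dots> = (x / 2) * bessel_g ((x / 2)\<^sup>2)"
    unfolding bessel_g_def by (rule suminf_mult[OF bessel_summable])
  finally show ?thesis .
qed

lemma continuous_bessel_J: "continuous_on S (bessel_J 1)"
proof -
  have "isCont bessel_g q" for q
    unfolding bessel_g_def[abs_def]
    by (rule isCont_powser[of _ "\<bar>q\<bar> + 1"]) (auto intro: bessel_summable)
  hence "continuous_on UNIV bessel_g" by (simp add: continuous_at_imp_continuous_on)
  hence "continuous_on S (\<lambda>x. bessel_g ((x / 2)\<^sup>2))"
    by (rule continuous_on_compose2) (auto intro!: continuous_intros)
  hence "continuous_on S (\<lambda>x. (x / 2) * bessel_g ((x / 2)\<^sup>2))"
    by (intro continuous_intros) auto
  thus ?thesis by (simp add: bessel_J_1_eq[abs_def] del: One_nat_def)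
qed

text \<open>Two consecutive terms combine with the sign of the first one as soon as \<open>q < (k + 1)(k + 2)\<close>.\<close>

lemma bessel_pair:
  "bessel_coeff (Suc k) * q ^ Suc k = - (bessel_coeff k * q ^ k) * (q / ((real k + 1) * (real k + 2)))"
proof -
  have "(fact (Suc k) :: real) = (real k + 1) * fact k" "(fact (Suc k + 1) :: real) = (real k + 2) * fact (k + 1)"
    by (simp_all add: algebra_simps)
  thus ?thesis by (simp only: bessel_coeff_def) (simp add: divide_simps)
qed

lemma bessel_g_pos:
  assumes "0 < q" "q < 2" shows "0 < bessel_g q"
proof -
  have sums: "(\<lambda>n. \<Sum>k\<in>{n * 2..<n * 2 + 2}. bessel_coeff k * q ^ k) sums bessel_g q"
    unfolding bessel_g_def by (intro sums_group summable_sums bessel_summable) simp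
  have "0 < (\<Sum>k\<in>{n * 2..<n * 2 + 2}. bessel_coeff k * q ^ k)" for n
  proof -
    have "{n * 2..<n * 2 + 2} = {n * 2, Suc (n * 2)}" by auto
    hence "(\<Sum>k\<in>{n * 2..<n * 2 + 2}. bessel_coeff k * q ^ k) =
        bessel_coeff (n * 2) * q ^ (n * 2) * (1 - q / ((real (n * 2) + 1) * (real (n * 2) + 2)))"
      using bessel_pair[of "n * 2" q] by (simp add: algebra_simps)
    moreover have "0 < bessel_coeff (n * 2) * q ^ (n * 2)"
      using assms by (simp add: bessel_coeff_def)
    moreover have "q / ((real (n * 2) + 1) * (real (n * 2) + 2)) < 1"
    proof -
      have "1 * 2 \<le> (real (n * 2) + 1) * (real (n * 2) + 2)" by (intro mult_mono) auto
      thus ?thesis using assms by (simp add: divide_less_eq)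
    qed
    ultimately show ?thesis by simp
  qed
  from suminf_pos[OF sums_summable[OF sums] this] show ?thesis
    unfolding sums_unique[OF sums, symmetric] .
qed

text \<open>The first five terms sum to about \<open>-0.022\<close>, and the remaining terms pair up to nonpositive sums.\<close>

lemma bessel_g_4_neg: "bessel_g 4 < 0"
proof -
  define f where "f k = bessel_coeff k * (4::real) ^ k" for k
  have sum: "summable f" unfolding f_def by (rule bessel_summable)
  have s1: "(\<lambda>n. \<Sum>k\<in>{n * 2..<n * 2 + 2}. f (k + 5)) sums (\<Sum>k. f (k + 5))"
    by (intro sums_group summable_sums summable_ignore_initial_segment sum) simp
  have s2: "(\<Sum>k\<in>{n * 2..<n * 2 + 2}. f (k + 5)) \<le> 0" for n
  proof -
    have "{n * 2..<n * 2 + 2} = {n * 2, Suc (n * 2)}" by auto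
    hence "(\<Sum>k\<in>{n * 2..<n * 2 + 2}. f (k + 5)) =
        f (n * 2 + 5) * (1 - 4 / ((real (n * 2 + 5) + 1) * (real (n * 2 + 5) + 2)))"
      using bessel_pair[of "n * 2 + 5" 4] by (simp add: f_def algebra_simps)
    moreover have "f (n * 2 + 5) \<le> 0"
    proof -
      have "(-1::real) ^ (n * 2 + 5) = - 1" by simp
      thus ?thesis by (simp only: f_def bessel_coeff_def) (simp add: divide_nonpos_pos)
    qed
    moreover have "4 / ((real (n * 2 + 5) + 1) * (real (n * 2 + 5) + 2)) \<le> 1"
    proof -
      have "6 * 7 \<le> (real (n * 2 + 5) + 1) * (real (n * 2 + 5) + 2)" by (intro mult_mono) auto
      thus ?thesis by (simp add: divide_le_eq)
    qed
    ultimately show ?thesis by (simp add: mult_nonpos_nonneg)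
  qed
  have "(\<Sum>k. f (k + 5)) \<le> 0" by (rule sums_le[OF s2 s1 sums_zero])
  moreover have "bessel_g 4 = (\<Sum>k. f (k + 5)) + (\<Sum>k<5. f k)"
    unfolding bessel_g_def f_def[symmetric] by (rule suminf_split_initial_segment[OF sum])
  moreover have "(\<Sum>k<5. f k) < 0"
    by (simp add: f_def bessel_coeff_def eval_nat_numeral lessThan_Suc)
  ultimately show ?thesis by linarith
qed

text \<open>There is no zero in \<open>(0, \<surd>8)\<close> because the pairs are positive for \<open>x\<^sup>2/4 < 2\<close>, and there is one in \<open>[1, 4]\<close>
  by the change of sign; so a smallest zero exists and is at least \<open>\<surd>8\<close>.\<close>

lemma l11_bound: "8 \<le> l11\<^sup>2"
proof -
  define Z where "Z = {x. 0 < x \<and> bessel_J 1 x = 0}"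
  have low: "sqrt 8 \<le> x" if "x \<in> Z" for x
  proof (rule ccontr)
    assume "\<not> sqrt 8 \<le> x"
    moreover have x: "0 < x" "bessel_J 1 x = 0" using that by (auto simp: Z_def)
    ultimately have "x\<^sup>2 < (sqrt 8)\<^sup>2" by (intro power_strict_mono) auto
    hence "(x / 2)\<^sup>2 < 2" by (simp add: power_divide)
    hence "0 < bessel_g ((x / 2)\<^sup>2)" using x by (intro bessel_g_pos) auto
    thus False using x by (simp add: bessel_J_1_eq del: One_nat_def)
  qed
  have J1: "0 \<le> bessel_J 1 1" using bessel_g_pos[of "1/4"] by (simp add: bessel_J_1_eq power2_eq_square del: One_nat_def)
  have J4: "bessel_J 1 4 \<le> 0" using bessel_g_4_neg by (simp add: bessel_J_1_eq del: One_nat_def)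
  obtain z where z: "1 \<le> z" "z \<le> 4" "bessel_J 1 z = 0"
    using IVT2'[OF J4 J1 _ continuous_bessel_J] by auto
  define K where "K = {sqrt 8..4} \<inter> bessel_J 1 -` {0}"
  have "closed K" unfolding K_def by (intro continuous_closed_preimage continuous_bessel_J) auto
  hence "compact ({sqrt 8..4} \<inter> K)" by (intro compact_Int_closed) auto
  moreover have "{sqrt 8..4} \<inter> K = K" by (auto simp: K_def)
  ultimately have K: "compact K" by simp
  have zK: "z \<in> K" using z low[of z] by (auto simp: K_def Z_def)
  obtain m where m: "m \<in> K" "\<And>x. x \<in> K \<Longrightarrow> m \<le> x"
    using compact_attains_inf[OF K] zK by blast
  have s8: "0 < sqrt (8::real)" by simp
  have "l11 = m" unfolding l11_def
  proof (rule Least_equality)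
    have "sqrt 8 \<le> m" using m(1) by (simp add: K_def)
    hence "0 < m" using s8 by linarith
    thus "0 < m \<and> bessel_J 1 m = 0" using m(1) by (simp add: K_def)
    fix y assume y: "0 < y \<and> bessel_J 1 y = 0"
    have "m \<le> 4" using m(1) by (simp add: K_def)
    thus "m \<le> y" using low[of y] m(2)[of y] y by (cases "y \<le> 4") (auto simp: Z_def K_def)
  qed
  hence "sqrt 8 \<le> l11" using m(1) by (simp add: K_def)
  hence "(sqrt 8)\<^sup>2 \<le> l11\<^sup>2" using s8 by (intro power_mono) auto
  thus ?thesis by simp
qed

section \<open>A test function on a ball\<close>

text \<open>The homogeneous dimension is \<open>4\<close>, so in terms of \<open>\<rho>\<^sup>4\<close> the volume of balls is linear.\<close>

lemma measure_hquart_less: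
  assumes "0 \<le> \<tau>"
  shows "measure lborel {p. hquart p < \<tau>} = \<tau> * measure lborel {p. hrho p < 1}"
    "emeasure lborel {p. hquart p < \<tau>} < \<infinity>" "{p. hquart p < \<tau>} \<in> sets lborel"
proof -
  show "{p. hquart p < \<tau>} \<in> sets lborel" by measurable
  have "emeasure lborel {p. hquart p < \<tau>} = ennreal \<tau> * emeasure lborel {p. hrho p < 1}"
  proof (cases "\<tau> = 0")
    case True
    thus ?thesis by (simp add: not_less[THEN iffD2])
  next
    case False
    define R where "R = root 4 \<tau>"
    have R: "0 < R" "R ^ 4 = \<tau>" using False assms by (simp_all add: R_def)
    have "{p. hquart p < \<tau>} = {p. hrho p < R}" using hrho_less_iff[OF R(1)] R(2) by auto
    thus ?thesis using emeasure_hrho_less[OF R(1)] R(2) by simp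
  qed
  thus "measure lborel {p. hquart p < \<tau>} = \<tau> * measure lborel {p. hrho p < 1}"
    "emeasure lborel {p. hquart p < \<tau>} < \<infinity>"
    using assms emeasure_hrho_less_finite by (auto simp: measure_def enn2real_mult ennreal_mult_less_top)
qed

lemma integral_indicator_hquart:
  assumes "0 \<le> \<tau>"
  shows "integrable lborel (\<lambda>p. indicat_real {p. hquart p < \<tau>} p)"
    "(LINT p|lborel. indicat_real {p. hquart p < \<tau>} p) = \<tau> * measure lborel {p. hrho p < 1}"
  using measure_hquart_less[OF assms] by (auto simp: integrable_indicator_iff)

text \<open>With \<open>v = 1 / (1 - \<tau>)\<close> this says that \<open>v\<^sup>2 e\<^sup>-\<^sup>v\<close> is largest at \<open>v = 2\<close>.\<close>

lemma gprof_sq_le: "(gprof \<tau>)\<^sup>2 \<le> 16 * exp (- 4)"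
proof (cases "\<tau> < 1")
  case True
  define v where "v = 1 / (1 - \<tau>)"
  have v: "0 < v" using True by (simp add: v_def)
  have g: "gprof \<tau> = exp (- v) * v\<^sup>2" using True by (simp add: gprof_def flat_exp_def v_def power_divide)
  have "v / 2 \<le> exp (v / 2 - 1)" using exp_ge_add_one_self[of "v / 2 - 1"] by simp
  hence "(v / 2) ^ 4 \<le> exp (v / 2 - 1) ^ 4" using v by (intro power_mono) auto
  also have "\<dots> = exp (2 * v) * exp (- 4)"
    by (simp add: exp_of_nat_mult[symmetric] algebra_simps flip: exp_add)
  finally have "v ^ 4 \<le> 16 * (exp (2 * v) * exp (- 4))" by (simp add: power_divide)
  hence "exp (- (2 * v)) * v ^ 4 \<le> exp (- (2 * v)) * (16 * (exp (2 * v) * exp (- 4)))" by (intro mult_left_mono) auto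
  also have "\<dots> = 16 * exp (- 4)" by (simp add: mult.assoc[symmetric] exp_add[symmetric])
  finally show ?thesis by (simp add: g power_mult_distrib power_mult[symmetric] exp_of_nat_mult[symmetric])
next
  case False
  thus ?thesis by (simp add: prof_eq_0)
qed

text \<open>A sixteenth of the Dirichlet energy, and the squared \<open>L\<^sup>2\<close> norm, of the bump \<open>G(\<rho>\<^sup>4)\<close> on the unit
  ball; recall \<open>|\<nabla>\<rho>\<^sup>4|\<^sup>2 = 16|z|\<^sup>2\<rho>\<^sup>4\<close>.\<close>

definition bump_energy :: real where "bump_energy = (LINT p|lborel. (gprof (hquart p))\<^sup>2 * (zsq p * hquart p))"
definition bump_mass :: real where "bump_mass = (LINT p|lborel. (Gprof (hquart p))\<^sup>2)"

lemma zsq_hquart_le: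
  assumes "hquart p < \<tau>" "\<tau> ^ 3 \<le> a\<^sup>2" "0 \<le> a"
  shows "zsq p * hquart p \<le> a"
proof -
  have z: "(zsq p)\<^sup>2 \<le> hquart p" by (simp add: hquart_def)
  have "(zsq p * hquart p)\<^sup>2 = (zsq p)\<^sup>2 * (hquart p)\<^sup>2" by (simp add: power_mult_distrib)
  also have "\<dots> \<le> hquart p * (hquart p)\<^sup>2" using z by (intro mult_right_mono) auto
  also have "\<dots> = hquart p ^ 3" by (simp add: eval_nat_numeral)
  also have "\<dots> \<le> \<tau> ^ 3" using assms(1) by (intro power_mono) auto
  also have "\<dots> \<le> a\<^sup>2" by (rule assms(2))
  finally show ?thesis using assms(3) by (rule power2_le_imp_le)
qed

text \<open>With \<open>g\<^sup>2\<close> bounded by its maximum, the remaining factor \<open>|z|\<^sup>2\<rho>\<^sup>4 \<le> (\<rho>\<^sup>4)\<^sup>3\<^sup>/\<^sup>2\<close> is bounded by a step function on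
  five shells of equal volume.\<close>

lemma bump_energy_le: "bump_energy \<le> 16 * exp (- 4) * (2.524 / 5) * measure lborel {p. hrho p < 1}"
proof -
  define I where "I \<tau> p = indicat_real {p. hquart p < \<tau>} p" for \<tau> p
  \<comment> \<open>The values on the shells are \<open>0.09\<close>, \<open>0.253\<close>, \<open>0.465\<close>, \<open>0.716\<close> and \<open>1\<close>, upper bounds of \<open>(j/5)\<^sup>3\<^sup>/\<^sup>2\<close>
    with sum \<open>2.524\<close>; their differences are the coefficients.\<close>
  define S where "S p = I 1 p - 0.284 * I (4/5) p - 0.251 * I (3/5) p - 0.212 * I (2/5) p - 0.163 * I (1/5) p" for p
  note int = integral_indicator_hquart[folded I_def]
  have "(gprof (hquart p))\<^sup>2 * (zsq p * hquart p) \<le> 16 * exp (- 4) * S p" for p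
  proof -
    have "zsq p * hquart p \<le> S p" if lt: "hquart p < 1"
    proof -
      consider "hquart p < 1/5" | "1/5 \<le> hquart p" "hquart p < 2/5" | "2/5 \<le> hquart p" "hquart p < 3/5"
        | "3/5 \<le> hquart p" "hquart p < 4/5" | "4/5 \<le> hquart p" by linarith
      thus ?thesis
      proof cases
        case 1 thus ?thesis using zsq_hquart_le[of p "1/5" "0.09"] by (simp add: S_def I_def power2_eq_square power3_eq_cube)
      next
        case 2 thus ?thesis using zsq_hquart_le[of p "2/5" "0.253"] by (simp add: S_def I_def power2_eq_square power3_eq_cube)
      next
        case 3 thus ?thesis using zsq_hquart_le[of p "3/5" "0.465"] by (simp add: S_def I_def power2_eq_square power3_eq_cube)
      next
        case 4 thus ?thesis using zsq_hquart_le[of p "4/5" "0.716"] by (simp add: S_def I_def power2_eq_square power3_eq_cube)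
      next
        case 5 thus ?thesis using zsq_hquart_le[of p "1" "1"] lt by (simp add: S_def I_def power2_eq_square power3_eq_cube)
      qed
    qed
    hence "(gprof (hquart p))\<^sup>2 * (zsq p * hquart p) \<le> 16 * exp (- 4) * S p" if "hquart p < 1"
      using gprof_sq_le that by (intro mult_mono) auto
    moreover have "(gprof (hquart p))\<^sup>2 * (zsq p * hquart p) \<le> 16 * exp (- 4) * S p" if "1 \<le> hquart p"
      using that by (simp add: prof_eq_0 S_def I_def)
    ultimately show ?thesis by linarith
  qed
  hence "bump_energy \<le> (LINT p|lborel. 16 * exp (- 4) * S p)"
    unfolding bump_energy_def
  proof (intro integral_mono)
    show "integrable lborel (\<lambda>p. (gprof (hquart p))\<^sup>2 * (zsq p * hquart p))"
    proof -
      have "integrable lborel (\<lambda>p. (gprof (hquart p) * hquart p) * wker p)"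
        by (rule integrable_cutoff(1)[OF open_UNIV _ _ _ wker_eq_0]) (auto intro!: continuous_intros)
      moreover have "(gprof (hquart p) * hquart p) * wker p = (gprof (hquart p))\<^sup>2 * (zsq p * hquart p)" for p
        by (simp add: wker_def power2_eq_square)
      ultimately show ?thesis by simp
    qed
    show "integrable lborel (\<lambda>p. 16 * exp (- 4) * S p)"
      unfolding S_def by (intro integrable_mult_right Bochner_Integration.integrable_diff int) auto
  qed
  also have "\<dots> = 16 * exp (- 4) * (2.524 / 5) * measure lborel {p. hrho p < 1}"
    unfolding S_def using int by (simp add: algebra_simps)
  finally show ?thesis .
qed

text \<open>The bump is radially decreasing, so the two innermost shells, each with its outer value, already
  give enough.\<close>

lemma bump_mass_ge: "exp (- 4) * (5.9 / 5) * measure lborel {p. hrho p < 1} \<le> bump_mass"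
proof -
  define I where "I \<tau> p = indicat_real {p. hquart p < \<tau>} p" for \<tau> p
  define E1 E2 where "E1 = exp (- (5/2) :: real)" and "E2 = exp (- (10/3) :: real)"
  define S where "S p = (E1 - E2) * I (1/5) p + E2 * I (2/5) p" for p
  note int = integral_indicator_hquart[folded I_def]
  have E: "0 \<le> E2" by (simp add: E2_def)
  have G: "exp (- (2 / (1 - \<tau>))) \<le> (Gprof (hquart p))\<^sup>2" if "hquart p < \<tau>" "\<tau> < 1" for \<tau> p
  proof -
    have "1 / (1 - hquart p) \<le> 1 / (1 - \<tau>)" using that by (intro divide_left_mono mult_pos_pos) auto
    hence "exp (- (2 / (1 - \<tau>))) \<le> exp (- (2 / (1 - hquart p)))" by simp
    also have "\<dots> = (Gprof (hquart p))\<^sup>2"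
      using that by (simp add: Gprof_def flat_exp_def power2_eq_square exp_add[symmetric] add_divide_distrib[symmetric])
    finally show ?thesis .
  qed
  have le: "S p \<le> (Gprof (hquart p))\<^sup>2" for p
  proof -
    consider "hquart p < 1/5" | "1/5 \<le> hquart p" "hquart p < 2/5" | "2/5 \<le> hquart p" by linarith
    thus ?thesis
    proof cases
      case 1 thus ?thesis using G[of p "1/5"] by (simp add: S_def I_def E1_def)
    next
      case 2 thus ?thesis using G[of p "2/5"] by (simp add: S_def I_def E2_def)
    next
      case 3 thus ?thesis by (simp add: S_def I_def)
    qed
  qed
  have S: "(LINT p|lborel. S p) = (E1 + E2) / 5 * measure lborel {p. hrho p < 1}"
    unfolding S_def using int by (simp add: algebra_simps)
  have "(LINT p|lborel. S p) \<le> bump_mass"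
    unfolding bump_mass_def
  proof (intro integral_mono le)
    show "integrable lborel S" unfolding S_def by (intro Bochner_Integration.integrable_add integrable_mult_right int) auto
    have "integrable lborel (\<lambda>p. Gprof (hquart p) * Gprof (hquart p))"
      by (rule integrable_cutoff(1)[OF open_UNIV, of 1])
         (auto intro!: continuous_intros prof_eq_0 simp: hquart_div_ge_1[of 1, simplified])
    thus "integrable lborel (\<lambda>p. (Gprof (hquart p))\<^sup>2)" by (simp add: power2_eq_square)
  qed
  moreover have "exp (- 4) * 5.9 \<le> E1 + E2"
  proof -
    have "13/8 \<le> exp (1/2::real)" using exp_lower_Taylor_quadratic[of "1/2::real"] by (simp add: power2_eq_square)
    hence "(13/8) ^ 3 \<le> exp (1/2::real) ^ 3" by (intro power_mono) auto
    moreover have "exp (1/2::real) ^ 3 = exp (3/2)" by (simp add: exp_of_nat_mult[symmetric])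
    ultimately have 1: "4 \<le> exp (3/2::real)" by (simp add: power_divide)
    have "25/18 \<le> exp (1/3::real)" using exp_lower_Taylor_quadratic[of "1/3::real"] by (simp add: power2_eq_square)
    hence "(25/18) ^ 2 \<le> exp (1/3::real) ^ 2" by (intro power_mono) auto
    moreover have "exp (1/3::real) ^ 2 = exp (2/3)" by (simp add: exp_of_nat_mult[symmetric])
    ultimately have 2: "1.9 \<le> exp (2/3::real)" by (simp add: power_divide)
    have "E1 = exp (- 4) * exp (3/2)" "E2 = exp (- 4) * exp (2/3)"
      by (simp_all add: E1_def E2_def exp_add[symmetric])
    hence "E1 + E2 = exp (- 4) * (exp (3/2) + exp (2/3))" by (simp add: distrib_left)
    thus ?thesis using 1 2 by simp
  qed
  hence "exp (- 4) * 5.9 / 5 * measure lborel {p. hrho p < 1} \<le> (E1 + E2) / 5 * measure lborel {p. hrho p < 1}"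
    by (intro mult_right_mono divide_right_mono) auto
  ultimately show ?thesis using S by simp
qed

lemma bump_mass_pos: "0 < bump_mass"
  unfolding bump_mass_def
proof (rule integral_pos_heis[of _ 1 0])
  have "hquart 0 = 0" by (simp add: hquart_eq_0)
  thus "0 < (Gprof (hquart 0))\<^sup>2" by (simp add: Gprof_def flat_exp_def)
  show "(Gprof (hquart p))\<^sup>2 = 0" if "1 < hrho p" for p
    using hquart_div_ge_1[of 1 p] that by (simp add: prof_eq_0)
qed (auto intro!: continuous_intros)

lemma bump_energy_le_mass: "16 * bump_energy \<le> 110 * bump_mass"
proof -
  have "16 * bump_energy \<le> 16 * (16 * exp (- 4) * (2.524 / 5) * measure lborel {p. hrho p < 1})"
    using bump_energy_le by simp
  also have "\<dots> \<le> 110 * (exp (- 4) * (5.9 / 5) * measure lborel {p. hrho p < 1})"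
    by (simp add: mult.assoc[symmetric])
  also have "\<dots> \<le> 110 * bump_mass" using bump_mass_ge by simp
  finally show ?thesis .
qed

lemma Ck_on_hquart_translate: "Ck_on k UNIV (\<lambda>p. hquart (hmult a p))"
proof -
  note intros = Ck_on_add[OF open_UNIV] Ck_on_mult[OF open_UNIV] Ck_on_minus[OF open_UNIV]
    Ck_on_diff[OF open_UNIV] Ck_on_const bounded_linear_coord[THEN Ck_on_linear]
  show ?thesis
    unfolding hquart_def zsq_def hmult_eq fst_conv snd_conv power2_eq_square by (intro intros)
qed

lemma smooth_Psi_translate: "smooth_on UNIV (\<lambda>p. Psi R (hmult a p))"
proof -
  have eq: "(\<lambda>p. Psi R (hmult a p)) = (\<lambda>p. flat_exp 0 (1 - hquart (hmult a p) * (1 / R ^ 4)))"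
    by (simp add: Psi_def Gprof_def)
  show ?thesis unfolding smooth_on_def eq
    by (intro allI Ck_on_flat_exp Ck_on_diff Ck_on_mult Ck_on_const Ck_on_hquart_translate open_UNIV)
qed

text \<open>Reduces integrals over the domain to the whole space, where the substitution rules apply.\<close>

lemma lebesgue_on_integral:
  fixes f :: "heis \<Rightarrow> real"
  assumes "open \<Omega>" "continuous_on UNIV f" "\<And>p. p \<notin> \<Omega> \<Longrightarrow> f p = 0"
  shows "(LINT p|lebesgue_on \<Omega>. f p) = (LINT p|lborel. f p)"
    "integrable lborel f \<Longrightarrow> integrable (lebesgue_on \<Omega>) f"
    "f \<in> borel_measurable (lebesgue_on \<Omega>)"
proof -
  have f: "f \<in> borel_measurable lborel" using borel_measurable_continuous_onI[OF assms(2)] by simp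
  have \<Omega>: "\<Omega> \<inter> space lebesgue \<in> sets lebesgue" using assms(1) by simp
  have eq: "(\<lambda>p. indicat_real \<Omega> p *\<^sub>R f p) = f"
  proof
    show "indicat_real \<Omega> p *\<^sub>R f p = f p" for p using assms(3)[of p] by (cases "p \<in> \<Omega>") simp_all
  qed
  show "(LINT p|lebesgue_on \<Omega>. f p) = (LINT p|lborel. f p)"
    unfolding integral_restrict_space[OF \<Omega>] eq by (rule integral_completion[OF f])
  show "integrable (lebesgue_on \<Omega>) f" if "integrable lborel f"
    unfolding integrable_restrict_space[OF \<Omega>] eq using that integrable_completion[OF f] by simp
  show "f \<in> borel_measurable (lebesgue_on \<Omega>)"
    by (intro measurable_restrict_space1 measurable_completion f)
qed

text \<open>The radial bump, moved to the ball by a left translation and a dilation, is itself a test function;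
  its Rayleigh quotient scales with \<open>R\<^sup>-\<^sup>2\<close>.\<close>

lemma first_eigenvalue_le:
  assumes \<Omega>: "open \<Omega>" and R: "0 < R" and sub: "{p. hdist \<xi> p \<le> R} \<subseteq> \<Omega>"
  shows "first_eigenvalue \<Omega> \<le> 110 / R\<^sup>2"
proof -
  define \<phi> where "\<phi> p = Psi R (hmult (hinv \<xi>) p)" for p
  define L where "L p = hmult (hinv \<xi>) p" for p
  have smooth: "smooth_on UNIV \<phi>" unfolding \<phi>_def by (rule smooth_Psi_translate)
  have Ck: "Ck_on (Suc 0) UNIV \<phi>" using smooth unfolding smooth_on_def by blast
  have der: "hdir v \<phi> p = Psi1 R v (L p)" if v: "v \<in> {e1, e2}" for v p
  proof -
    have hv: "snd (snd v) = 0" by (rule horizontal_e[OF v])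
    have "has_hderiv v \<phi> (hdir v \<phi> p) p" by (rule has_hderiv_hdir[OF hv]) (use Ck in \<open>unfold Ck_on.simps, blast\<close>)
    moreover have "has_hderiv v \<phi> (Psi1 R v (L p)) p"
      unfolding \<phi>_def has_hderiv_left L_def by (rule Psi_hderiv(1)[OF hv])
    ultimately show ?thesis unfolding has_hderiv_def by (rule DERIV_unique)
  qed
  have hX: "hX \<phi> = (\<lambda>p. Psi1 R e1 (L p))" and hY: "hY \<phi> = (\<lambda>p. Psi1 R e2 (L p))"
    by (simp_all add: hX_eq hY_eq der fun_eq_iff del: split_paired_All)
  have out: "R \<le> hrho (L p)" if "p \<notin> \<Omega>" for p
  proof (rule ccontr)
    assume "\<not> R \<le> hrho (L p)"
    hence "p \<in> {p. hdist \<xi> p \<le> R}" by (simp add: hdist_def L_def)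
    thus False using that sub by blast
  qed
  have cL: "continuous_on UNIV L" unfolding L_def by (intro continuous_intros)
  have c: "continuous_on UNIV \<phi>" "continuous_on UNIV (\<lambda>p. Psi1 R v (L p))" for v
    unfolding \<phi>_def L_def using R by (intro continuous_intros; simp)+
  have int_test: "integrable lborel (\<lambda>p. f (L p))" "(LINT p|lborel. f (L p)) = (LINT p|lborel. f p)"
    if f: "continuous_on UNIV f" "\<And>p. R \<le> hrho p \<Longrightarrow> f p = 0" for f :: "heis \<Rightarrow> real"
  proof -
    have fm: "f \<in> borel_measurable borel" by (rule borel_measurable_continuous_onI[OF f(1)])
    show "(LINT p|lborel. f (L p)) = (LINT p|lborel. f p)" unfolding L_def by (rule integral_hmult_left[OF fm])
    have "continuous_on UNIV (\<lambda>p. f (L p))" by (rule continuous_on_compose2[OF f(1) cL]) auto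
    moreover have "f (L p) = 0" if p: "p \<notin> hbox (R + hrho \<xi>)" for p
    proof (rule f(2))
      have "hrho p \<le> hrho \<xi> + hrho (L p)" using hrho_triangle[of \<xi> "L p"] by (simp add: L_def)
      thus "R \<le> hrho (L p)" using not_in_hbox[OF p] by linarith
    qed
    ultimately show "integrable lborel (\<lambda>p. f (L p))" by (rule integrable_hbox(1))
  qed
  have z: "Psi R p = 0" "Psi1 R v p = 0" if "R \<le> hrho p" for p v by (rule Psi_eq_0[OF R that])+
  have cP: "continuous_on UNIV (Psi R)" "continuous_on UNIV (Psi1 R v)" for v
    using continuous_on_Psi[OF continuous_on_id R] by auto
  have L2: "L2_on \<Omega> (\<lambda>p. f (L p))"
    if f: "continuous_on UNIV f" "\<And>p. R \<le> hrho p \<Longrightarrow> f p = 0" for f :: "heis \<Rightarrow> real"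
  proof -
    have fL: "continuous_on UNIV (\<lambda>p. f (L p))" by (rule continuous_on_compose2[OF f(1) cL]) simp
    have f0: "f (L p) = 0" if "p \<notin> \<Omega>" for p by (rule f(2)[OF out[OF that]])
    have "integrable lborel (\<lambda>p. (f (L p))\<^sup>2)"
      by (rule int_test(1)[of "\<lambda>p. (f p)\<^sup>2"]) (simp_all add: f(2) continuous_on_power[OF f(1)])
    hence "integrable (lebesgue_on \<Omega>) (\<lambda>p. (f (L p))\<^sup>2)"
      by (intro lebesgue_on_integral(2)[OF \<Omega> continuous_on_power[OF fL]]) (simp_all add: f0)
    thus ?thesis unfolding L2_on_def using lebesgue_on_integral(3)[OF \<Omega> fL f0] by blast
  qed
  have \<phi>L: "\<phi> = (\<lambda>p. Psi R (L p))" by (simp add: \<phi>_def L_def fun_eq_iff)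
  have \<phi>0: "\<phi> p = 0" if "p \<notin> \<Omega>" for p unfolding \<phi>L by (rule z(1)[OF out[OF that]])
  have test: "test_function \<Omega> \<phi>"
    unfolding test_function_def
  proof (intro conjI smooth exI[of _ "{p. hdist \<xi> p \<le> R}"] compact_hcball sub allI impI)
    fix p assume "p \<notin> {p. hdist \<xi> p \<le> R}"
    thus "\<phi> p = 0" unfolding \<phi>_def by (intro z) (simp add: hdist_def)
  qed
  have S: "S012 \<Omega> \<phi> (hX \<phi>) (hY \<phi>)"
    unfolding S012_def
  proof (intro conjI exI[of _ "\<lambda>_. \<phi>"])
    show "L2_on \<Omega> \<phi>" unfolding \<phi>L by (rule L2[OF cP(1) z(1)])
    show "L2_on \<Omega> (hX \<phi>)" unfolding hX by (rule L2[OF cP(2)]) (rule z(2))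
    show "L2_on \<Omega> (hY \<phi>)" unfolding hY by (rule L2[OF cP(2)]) (rule z(2))
  qed (simp_all add: test)
  have denom: "(LINT p|lebesgue_on \<Omega>. (\<phi> p)\<^sup>2) = R ^ 4 * bump_mass"
  proof -
    have "(LINT p|lebesgue_on \<Omega>. (\<phi> p)\<^sup>2) = (LINT p|lborel. (\<phi> p)\<^sup>2)"
      by (rule lebesgue_on_integral(1)[OF \<Omega> continuous_on_power[OF c(1)]]) (simp add: \<phi>0)
    also have "\<dots> = (LINT p|lborel. (Psi R p)\<^sup>2)"
      unfolding \<phi>L by (rule int_test(2)[OF continuous_on_power[OF cP(1)]]) (simp add: z(1))
    also have "\<dots> = R ^ 4 * (LINT p|lborel. (Psi R (hdil R p))\<^sup>2)"
      by (rule integral_hdil[OF _ R]) (intro borel_measurable_continuous_onI continuous_on_power cP)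
    also have "(\<lambda>p. (Psi R (hdil R p))\<^sup>2) = (\<lambda>p. (Gprof (hquart p))\<^sup>2)"
      using R by (simp add: Psi_def hquart_hdil)
    finally show ?thesis by (simp add: bump_mass_def)
  qed
  have num: "(LINT p|lebesgue_on \<Omega>. (hX \<phi> p)\<^sup>2 + (hY \<phi> p)\<^sup>2) = R\<^sup>2 * (16 * bump_energy)"
  proof -
    define f where "f p = (Psi1 R e1 p)\<^sup>2 + (Psi1 R e2 p)\<^sup>2" for p
    have f: "continuous_on UNIV f" "\<And>p. R \<le> hrho p \<Longrightarrow> f p = 0"
      unfolding f_def by (intro continuous_on_add continuous_on_power cP) (simp add: z(2))
    have fL: "continuous_on UNIV (\<lambda>p. f (L p))" by (rule continuous_on_compose2[OF f(1) cL]) auto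
    have "(LINT p|lebesgue_on \<Omega>. (hX \<phi> p)\<^sup>2 + (hY \<phi> p)\<^sup>2) = (LINT p|lebesgue_on \<Omega>. f (L p))"
      by (simp add: hX hY f_def)
    also have "\<dots> = (LINT p|lborel. f (L p))"
      by (rule lebesgue_on_integral(1)[OF \<Omega> fL]) (use f(2) out in blast)
    also have "\<dots> = (LINT p|lborel. f p)" by (rule int_test(2)[OF f])
    also have "\<dots> = R ^ 4 * (LINT p|lborel. f (hdil R p))"
      by (rule integral_hdil[OF borel_measurable_continuous_onI[OF f(1)] R])
    also have "(\<lambda>p. f (hdil R p)) = (\<lambda>p. (16 / R\<^sup>2) * ((gprof (hquart p))\<^sup>2 * (zsq p * hquart p)))"
    proof
      fix p
      have "f q = (gprof (hquart q / R ^ 4))\<^sup>2 * ((dsreg 0 e1 q)\<^sup>2 + (dsreg 0 e2 q)\<^sup>2) / R ^ 8" for q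
        using R by (simp add: f_def Psi1_def power_mult_distrib power_divide field_simps flip: power_mult)
      hence "f (hdil R p) = (gprof (hquart p))\<^sup>2 * (16 * (R\<^sup>2 * zsq p) * (R ^ 4 * hquart p)) / R ^ 8"
        using R by (simp add: sum_dsreg_sq sreg_0 zsq_hdil hquart_hdil)
      also have "\<dots> = (16 / R\<^sup>2) * ((gprof (hquart p))\<^sup>2 * (zsq p * hquart p))"
        using R by (simp add: field_simps eval_nat_numeral)
      finally show "f (hdil R p) = (16 / R\<^sup>2) * ((gprof (hquart p))\<^sup>2 * (zsq p * hquart p))" .
    qed
    also have "R ^ 4 * (LINT p|lborel. (16 / R\<^sup>2) * ((gprof (hquart p))\<^sup>2 * (zsq p * hquart p))) = R ^ 4 * ((16 / R\<^sup>2) * bump_energy)"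
      by (simp only: integral_mult_right_zero bump_energy_def)
    also have "\<dots> = R\<^sup>2 * (16 * bump_energy)" using R by (simp add: field_simps eval_nat_numeral)
    finally show ?thesis .
  qed
  have nz: "\<not> (AE p in lebesgue_on \<Omega>. \<phi> p = 0)"
  proof
    assume "AE p in lebesgue_on \<Omega>. \<phi> p = 0"
    hence "(LINT p|lebesgue_on \<Omega>. (\<phi> p)\<^sup>2) = 0"
      by (intro integral_eq_zero_AE) (auto elim: eventually_mono)
    thus False using denom bump_mass_pos R by simp
  qed
  have "first_eigenvalue \<Omega> \<le> (LINT p|lebesgue_on \<Omega>. (hX \<phi> p)\<^sup>2 + (hY \<phi> p)\<^sup>2) / (LINT p|lebesgue_on \<Omega>. (\<phi> p)\<^sup>2)"
    unfolding first_eigenvalue_def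
  proof (rule cInf_lower)
    show "bdd_below {(LINT p|lebesgue_on \<Omega>. (g p)\<^sup>2 + (h p)\<^sup>2) / (LINT p|lebesgue_on \<Omega>. (v p)\<^sup>2) |v g h.
       S012 \<Omega> v g h \<and> \<not> (AE p in lebesgue_on \<Omega>. v p = 0)}"
      by (rule bdd_belowI[of _ 0]) (auto intro!: divide_nonneg_nonneg Bochner_Integration.integral_nonneg)
  qed (use S nz in blast)
  also have "\<dots> = (16 * bump_energy) / (R\<^sup>2 * bump_mass)"
    unfolding num denom using R bump_mass_pos by (simp add: field_simps eval_nat_numeral)
  also have "\<dots> \<le> (110 * bump_mass) / (R\<^sup>2 * bump_mass)"
    using bump_energy_le_mass R bump_mass_pos by (intro divide_right_mono) auto
  also have "\<dots> = 110 / R\<^sup>2" using bump_mass_pos by simp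
  finally show ?thesis .
qed

text \<open>A point outside would be joined to the center by a dilation path, which has to cross the boundary within
  distance \<open>R\<close>.\<close>

lemma hcball_subset:
  assumes "\<xi> \<in> \<Omega>" "\<And>b. b \<in> frontier \<Omega> \<Longrightarrow> R < hdist \<xi> b"
  shows "{p. hdist \<xi> p \<le> R} \<subseteq> \<Omega>"
proof
  fix p assume p: "p \<in> {p. hdist \<xi> p \<le> R}"
  show "p \<in> \<Omega>"
  proof (rule ccontr)
    assume "p \<notin> \<Omega>"
    define q where "q = hmult (hinv \<xi>) p"
    define S where "S = (\<lambda>t. hmult \<xi> (hdil t q)) ` {0..1}"
    have "connected S" unfolding S_def by (intro connected_continuous_image continuous_intros) auto
    moreover have "\<xi> \<in> S" unfolding S_def by (rule image_eqI[of _ _ 0]) auto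
    moreover have "p \<in> S" unfolding S_def q_def by (rule image_eqI[of _ _ 1]) auto
    ultimately obtain b where b: "b \<in> S" "b \<in> frontier \<Omega>"
      using connected_Int_frontier[of S \<Omega>] assms(1) \<open>p \<notin> \<Omega>\<close> by blast
    then obtain t where t: "0 \<le> t" "t \<le> 1" "b = hmult \<xi> (hdil t q)" unfolding S_def by auto
    have "hdist \<xi> b = t * hrho q" using t by (simp add: hrho_hdil)
    also have "\<dots> \<le> 1 * hrho q" using t by (intro mult_right_mono) auto
    also have "\<dots> \<le> R" using p by (simp add: q_def hdist_def)
    finally show False using assms(2)[OF b(2)] by simp
  qed
qed

section \<open>The eigenvalue estimate\<close>

theorem theorem6p3:
  fixes \<Omega> :: "heis set"
  assumes "bounded_domain \<Omega>"
    and "smooth_boundary \<Omega>"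
    and "uniform_exterior_ball \<Omega>"
    and "uniform_exterior_ball (- closure \<Omega>)"
  shows "first_eigenvalue \<Omega> \<le> C_const \<Omega> * (l11\<^sup>2 / max_radius_sq \<Omega>)"
proof -
  interpret regular_domain \<Omega>
    by unfold_locales (use assms in \<open>auto simp: bounded_domain_def\<close>)
  obtain \<xi> where \<xi>: "\<xi> \<in> \<Omega>" "C_const \<Omega> = C_at \<Omega> \<xi>" "max_radius_sq \<Omega> = (harmonic_radius \<Omega> \<xi>)\<^sup>2"
    by (rule optimal_center)
  define r where "r = (harmonic_radius \<Omega> \<xi>)\<^sup>2"
  have r: "0 < r" "r \<le> (far \<xi>)\<^sup>2" using harmonic_radius_le_far[OF \<xi>(1)] by (simp_all add: r_def)
  have near: "0 < near \<xi>" by (rule near_pos[OF \<xi>(1)])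
  define \<alpha> where "\<alpha> = alpha \<Omega> \<xi>"
  have \<alpha>: "1 \<le> \<alpha>" "far \<xi> = \<alpha> * near \<xi>"
    using near near_le_far[of \<xi>] by (simp_all add: \<alpha>_def alpha_eq)
  \<comment> \<open>Slightly less than the distance to the boundary, because the support of the test function has to be
    a compact subset of the domain.\<close>
  define R where "R = 0.999 * near \<xi>"
  have R: "0 < R" using near by (simp add: R_def)
  have "first_eigenvalue \<Omega> \<le> 110 / R\<^sup>2"
  proof (rule first_eigenvalue_le[OF open_dom R hcball_subset[OF \<xi>(1)]])
    fix b assume "b \<in> frontier \<Omega>"
    from near_le[OF this, of \<xi>] show "R < hdist \<xi> b" using near by (simp add: R_def)
  qed
  also have "\<dots> \<le> 110.4 / (near \<xi>)\<^sup>2"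
    using near by (simp add: R_def power_mult_distrib field_simps)
  also have "\<dots> \<le> 110.4 * \<alpha> ^ 6 / r"
  proof -
    have "r \<le> \<alpha>\<^sup>2 * (near \<xi>)\<^sup>2" using r(2) \<alpha>(2) by (simp add: power_mult_distrib)
    also have "\<dots> \<le> \<alpha> ^ 6 * (near \<xi>)\<^sup>2"
      using \<alpha>(1) by (intro mult_right_mono power_increasing) auto
    finally show ?thesis using r(1) near by (simp add: field_simps)
  qed
  also have "\<dots> \<le> C_at \<Omega> \<xi> * (l11\<^sup>2 / r)"
  proof -
    have C: "((3 / (2 * pi)) powr (1 / 4))\<^sup>2 = sqrt (3 / (2 * pi))"
      by (simp add: powr_half_sqrt[symmetric] powr_power)
    \<comment> \<open>The slack is such that \<open>\<pi> < 4\<close> suffices: \<open>16 \<cdot> 8 \<cdot> 0.8625 = 110.4\<close>.\<close>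
    have "0.8625 \<le> sqrt (3 / pi)"
      using pi_less_4 by (intro real_le_rsqrt) (simp add: field_simps power2_eq_square)
    hence "110.4 \<le> 16 * sqrt (3 / pi) * 8" by simp
    also have "\<dots> = 16 * sqrt 2 * sqrt (3 / (2 * pi)) * 8"
      by (simp add: real_sqrt_divide real_sqrt_mult)
    also have "\<dots> \<le> 16 * sqrt 2 * sqrt (3 / (2 * pi)) * l11\<^sup>2"
      using l11_bound by (intro mult_left_mono) auto
    finally have "110.4 * \<alpha> ^ 6 \<le> 16 * sqrt 2 * sqrt (3 / (2 * pi)) * l11\<^sup>2 * \<alpha> ^ 6"
      using \<alpha>(1) by (intro mult_right_mono) auto
    also have "\<dots> = C_at \<Omega> \<xi> * l11\<^sup>2" by (simp add: C_at_def C \<alpha>_def)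
    finally have "110.4 * \<alpha> ^ 6 / r \<le> C_at \<Omega> \<xi> * l11\<^sup>2 / r"
      using r(1) by (intro divide_right_mono) auto
    thus ?thesis by simp
  qed
  finally show ?thesis by (simp add: \<xi> r_def)
qed

end
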